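(* Let $N\in\mathbb{N}_0$, let $w:\mathbb{N}_0\to[0,\infty)$, let $W_{ij}=2^{\ell(i)+\ell(j)}w(\ell(i\wedge j))$ for $i,j$ in the binary tree $\mathcal{T}^N$, let $h:\Lambda_N\to[0,\infty)$ be a pinning function with $h_j>0$ for at least one $j$ in each connected component of the graph $(\Lambda_N,\mathcal{E}_{\Lambda_N,W})$, let $A\subseteq\mathcal{T}^N$ be a maximal antichain compatible with $h$, and let $H_j=\sum_{i\in\mathcal{B}_j}h_i$ for $j\in A$. Then for all $(a_j)_{j\in A}\in(H^{3|2})^A$ such that $H_jo+a_j\in H^{3|2}_{+0}$ for all $j\in A$ and $H_jo+a_j\in H^{3|2}_+$ for at least one $j$ in every connected component of the graph $(A,\mathcal{E}_{A,W})$, one has $$E^{\Lambda_N}_{W,h}\Big[e^{\sum_{j\in A}\langle a_j,v_j\rangle}\Big]=E^A_{W,H}\Big[e^{\sum_{j\in A}\langle a_j,v_j\rangle}\Big].$$ On the left-hand side, $v_j$ ($j\in A$) denotes the block spin variable $v_j=2^{-\ell(j)}\sum_{i\in\mathcal{B}_j}v_i$ built from the spins $(v_i)_{i\in\Lambda_N}$; on the right-hand side, $v_j\in H^{2|2}$ ($j\in A$) are the spin variables of the $H^{2|2}$-model with vertex set $A$.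
   Context: **Binary tree.** $\Lambda_n=\{0,1\}^n$ is the set of binary words of length $n$ ($\Lambda_0=\{\emptyset\}$), $\mathcal{T}^N=\bigcup_{n=0}^N\Lambda_n$. For $j\in\Lambda_n$, $|j|=n$ and the level is $\ell(j)=N-|j|$. For nonempty $j=(j_0,\dots,j_{n-1})$, $\mathrm{cut}(j)=(j_1,\dots,j_{n-1})$; $\mathrm{cut}^l$ is the $l$-fold iterate. Write $i\preceq j$ if $i=\mathrm{cut}^l(j)$ for some $l\in\mathbb{N}_0$. For $i,j\in\mathcal{T}^N$, $i\wedge j$ is the least common ancestor: $i\wedge j=\mathrm{cut}^m(i)$ with the smallest $m\in\mathbb{N}_0$ such that $\mathrm{cut}^m(i)=\mathrm{cut}^{m'}(j)$ for some $m'\in\mathbb{N}_0$. For $i\in\mathcal{T}^N$, $\mathcal{B}_i=\{j\in\Lambda_N:i\preceq j\}$, so $|\mathcal{B}_i|=2^{\ell(i)}$. For $i,j\in\Lambda_N$, $\ell(i\wedge j)$ is the hierarchical distance $d(i,j)$ and $W_{ij}=w(d(i,j))$. **Antichains.** $A\subseteq\mathcal{T}^N$ is an antichain if $i\not\preceq j$ and $j\not\preceq i$ for all distinct $i,j\in A$; it is maximal if no antichain strictly contains it (equivalently, for every $i\in\Lambda_N$ there is precisely one $j\in A$ with $j\preceq i$). A maximal antichain $A$ is compatible with $h$ if for every $j\in A$ the restriction of $h$ to $\mathcal{B}_j$ is constant. **Graphs.** For $\Lambda=\Lambda_N$ or $\Lambda=A$, $(\Lambda,\mathcal{E}_{\Lambda,W})$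 is the graph with vertex set $\Lambda$ and edges $\{i,j\}$, $i,j\in\Lambda$, $W_{ij}>0$ (loops play no role). **Grassmann algebra and superspaces.** For a finite vertex set $\Lambda$, let $\mathcal{A}=\mathcal{A}_0\oplus\mathcal{A}_1$ be the real exterior (Grassmann) algebra on a finite-dimensional vector space with a basis consisting of generators $\xi_i,\eta_i$ ($i\in\Lambda$) and possibly finitely many additional generators ("Grassmann parameters"), with even part $\mathcal{A}_0$ and odd part $\mathcal{A}_1$. For $x\in\mathcal{A}_0$, $\mathrm{body}(x)\in\mathbb{R}$ is the degree-0 part. For $a,b\in\mathcal{A}_0$, $a<b$ means $\mathrm{body}(a)<\mathrm{body}(b)$, and similarly for $\le,>,\ge$. Smooth real functions are extended to even elements by Taylor expansion in the nilpotent parts. Put $H^{3|2}=\mathcal{A}_0^3\times\mathcal{A}_1^2$ with $$\langle v,v'\rangle=xx'+yy'-zz'+\xi\eta'-\eta\xi',\quad v=(x,y,z,\xi,\eta),\ v'=(x',y',z',\xi',\eta'),$$ $o=(0,0,1,0,0)$, $$H^{3|2}_+=\{v\in H^{3|2}:\langle v,v\rangle<0,\ z>0\},\qquad H^{3|2}_{+0}=\{v\in H^{3|2}:\langle v,v\rangle\le0,\ z\ge0\},$$ $$H^{2|2}=\{v\in H^{3|2}:\langle v,v\rangle=-1,\ \mathrm{body}(z)>0\}.$$ The parameters $a_j$ do not depend on the integration variables: their components lie in the subalgebra generated by the additional Grassmann parameters. **Superintegration.** For a generator $\chi$ and $\omega=\omega_0+\chi\omega_1$ with $\omega_0,\omega_1$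 in the subalgebra generated by the other generators, $\partial_\chi\omega:=\omega_1$. For a superfunction $f$ (an expansion in Grassmann monomials with smooth coefficients) decaying sufficiently fast, $$\int_{(H^{2|2})^\Lambda}\mathcal{D}v_\Lambda\,f(v_\Lambda):=\frac1{(2\pi)^{|\Lambda|}}\int_{(\mathbb{R}^2)^\Lambda}\prod_{j\in\Lambda}dx_j\,dy_j\,\Big(\prod_{j\in\Lambda}\partial_{\xi_j}\partial_{\eta_j}\Big)\Big(\prod_{j\in\Lambda}\frac1{z_j}\,f(v_\Lambda)\Big),$$ where $v_j=(x_j,y_j,z_j,\xi_j,\eta_j)$ and $z_j=\sqrt{1+x_j^2+y_j^2+2\xi_j\eta_j}=\sqrt{1+x_j^2+y_j^2}+\frac{\xi_j\eta_j}{\sqrt{1+x_j^2+y_j^2}}$. **The model.** For weights $W$ and pinning $h$ on $\Lambda$, $$E^\Lambda_{W,h}[f(v_\Lambda)]=\int_{(H^{2|2})^\Lambda}\mathcal{D}v_\Lambda\,e^{S^\Lambda_{W,h}(v_\Lambda)}f(v_\Lambda),\qquad S^\Lambda_{W,h}(v_\Lambda)=\sum_{i,j\in\Lambda}W_{ij}(1+\langle v_i,v_j\rangle)+\sum_{i\in\Lambda}h_i(1+\langle v_i,o\rangle),$$ the first sum being over ordered pairs (terms $i=j$ vanish since $\langle v_i,v_i\rangle=-1$). $E^{\Lambda_N}_{W,h}$ and $E^A_{W,H}$ use the restrictions of $W$ (and $H$) to $\Lambda_N$ and $A$ respectively. *)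

theory Defs
  imports "HOL-Analysis.Analysis" "HOL-Library.List_Lexorder"
begin

section \<open>Grassmann algebras\<close>

text \<open>
  An element is the family of its coefficients with respect to the monomials
  \<open>\<xi>\<^sub>S = \<Prod>g\<in>S. g\<close> (factors in increasing order), where \<open>S\<close> ranges over the finite sets of
  generators. The type \<open>'g\<close> of generators may be infinite; the real exterior algebra on a
  finite set \<open>G\<close> of generators is the subalgebra \<open>galg G\<close> below.
\<close>

typedef 'g grassmann = "{f :: 'g set \<Rightarrow> real. \<forall>S. infinite S \<longrightarrow> f S = 0}"
  morphisms gcoeff Abs_grassmann
  by (rule exI[of _ "\<lambda>_. 0"]) simp

setup_lifting type_definition_grassmann

lemma gcoeff_infinite: "infinite S \<Longrightarrow> gcoeff a S = 0"
  using gcoeff[of a] by simp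

lemma grassmann_eqI: "(\<And>S. finite S \<Longrightarrow> gcoeff a S = gcoeff b S) \<Longrightarrow> a = b"
  by (metis gcoeff_inject ext gcoeff_infinite)

text \<open>
  The sign in \<open>\<xi>\<^sub>T \<xi>\<^sub>U = gsign T U \<cdot> \<xi>\<^bsub>T \<union> U\<^esub>\<close> for disjoint \<open>T\<close>, \<open>U\<close>.
\<close>

definition gsign :: "'g::linorder set \<Rightarrow> 'g set \<Rightarrow> real" where
  "gsign T U = (-1) ^ card {(t, u). t \<in> T \<and> u \<in> U \<and> u < t}"

lemma gsign_Un_left:
  assumes "finite T" "finite T'" "finite U" "T \<inter> T' = {}"
  shows "gsign (T \<union> T') U = gsign T U * gsign T' U"
proof -
  have "{(t, u). t \<in> T \<union> T' \<and> u \<in> U \<and> u < t} =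
      {(t, u). t \<in> T \<and> u \<in> U \<and> u < t} \<union> {(t, u). t \<in> T' \<and> u \<in> U \<and> u < t}"
    by auto
  moreover have "finite {(t, u). t \<in> T \<and> u \<in> U \<and> u < t}"
    by (rule finite_subset[of _ "T \<times> U"]) (use assms in auto)
  moreover have "finite {(t, u). t \<in> T' \<and> u \<in> U \<and> u < t}"
    by (rule finite_subset[of _ "T' \<times> U"]) (use assms in auto)
  ultimately show ?thesis
    unfolding gsign_def using assms(4)
    by (subst \<open>_ = _ \<union> _\<close>, subst card_Un_disjoint) (auto simp: power_add)
qed

lemma gsign_Un_right:
  assumes "finite T" "finite U" "finite U'" "U \<inter> U' = {}"
  shows "gsign T (U \<union> U') = gsign T U * gsign T U'"
proof -
  have "{(t, u). t \<in> T \<and> u \<in> U \<union> U' \<and> u < t} =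
      {(t, u). t \<in> T \<and> u \<in> U \<and> u < t} \<union> {(t, u). t \<in> T \<and> u \<in> U' \<and> u < t}"
    by auto
  moreover have "finite {(t, u). t \<in> T \<and> u \<in> U \<and> u < t}"
    by (rule finite_subset[of _ "T \<times> U"]) (use assms in auto)
  moreover have "finite {(t, u). t \<in> T \<and> u \<in> U' \<and> u < t}"
    by (rule finite_subset[of _ "T \<times> U'"]) (use assms in auto)
  ultimately show ?thesis
    unfolding gsign_def using assms(4)
    by (subst \<open>_ = _ \<union> _\<close>, subst card_Un_disjoint) (auto simp: power_add)
qed

lemma gsign_empty [simp]: "gsign {} U = 1" "gsign T {} = 1"
  by (simp_all add: gsign_def)

instantiation grassmann :: (type) real_vector
begin

lift_definition zero_grassmann :: "'a grassmann" is "\<lambda>_. 0" by simp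
lift_definition plus_grassmann :: "'a grassmann \<Rightarrow> 'a grassmann \<Rightarrow> 'a grassmann"
  is "\<lambda>f g S. f S + g S" by simp
lift_definition uminus_grassmann :: "'a grassmann \<Rightarrow> 'a grassmann" is "\<lambda>f S. - f S" by simp
lift_definition minus_grassmann :: "'a grassmann \<Rightarrow> 'a grassmann \<Rightarrow> 'a grassmann"
  is "\<lambda>f g S. f S - g S" by simp
lift_definition scaleR_grassmann :: "real \<Rightarrow> 'a grassmann \<Rightarrow> 'a grassmann"
  is "\<lambda>r f S. r * f S" by simp

instance
  by standard (transfer; simp add: fun_eq_iff algebra_simps)+

end

instantiation grassmann :: (linorder) real_algebra_1
begin

lift_definition one_grassmann :: "'a grassmann" is "\<lambda>S. if S = {} then 1 else 0" by auto

text \<open>For infinite \<open>S\<close> the sum is over the infinite set \<open>Pow S\<close> and hence \<open>0\<close>.\<close>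

lift_definition times_grassmann :: "'a grassmann \<Rightarrow> 'a grassmann \<Rightarrow> 'a grassmann"
  is "\<lambda>f g S. \<Sum>T\<in>Pow S. gsign T (S - T) * f T * g (S - T)"
  by simp

instance
proof
  fix a b c :: "'a grassmann" and r :: real
  show "(a + b) * c = a * c + b * c"
    by transfer (simp add: fun_eq_iff algebra_simps sum.distrib)
  show "a * (b + c) = a * b + a * c"
    by transfer (simp add: fun_eq_iff algebra_simps sum.distrib)
  show "r *\<^sub>R a * b = r *\<^sub>R (a * b)"
    by transfer (simp add: fun_eq_iff sum_distrib_left mult_ac)
  show "a * r *\<^sub>R b = r *\<^sub>R (a * b)"
    by transfer (simp add: fun_eq_iff sum_distrib_left mult_ac)
  show "(0::'a grassmann) \<noteq> 1"
    by transfer (auto dest: fun_cong[of _ _ "{}"])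
  show "1 * a = a"
  proof (rule grassmann_eqI)
    fix S :: "'a set" assume S: "finite S"
    have "gcoeff (1 * a) S = (\<Sum>T\<in>Pow S. if T = {} then gcoeff a S else 0)"
      by transfer (auto intro!: sum.cong)
    also have "\<dots> = gcoeff a S"
      using S by simp
    finally show "gcoeff (1 * a) S = gcoeff a S" .
  qed
  show "a * 1 = a"
  proof (rule grassmann_eqI)
    fix S :: "'a set" assume S: "finite S"
    have "gcoeff (a * 1) S = (\<Sum>T\<in>Pow S. if T = S then gcoeff a S else 0)"
      by transfer (auto intro!: sum.cong)
    also have "\<dots> = gcoeff a S"
      using S by simp
    finally show "gcoeff (a * 1) S = gcoeff a S" .
  qed
  show "a * b * c = a * (b * c)"
  proof (rule grassmann_eqI)
    fix S :: "'a set" assume S: "finite S"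
    note fin = finite_subset[OF _ S]
    have "gcoeff (a * b * c) S =
        (\<Sum>(T, U)\<in>Sigma (Pow S) Pow. gsign T (S - T) * gsign U (T - U) *
           gcoeff a U * gcoeff b (T - U) * gcoeff c (S - T))"
      using S fin
      by (simp add: times_grassmann.rep_eq sum_distrib_left sum_distrib_right mult_ac
            flip: sum.Sigma)
    also have "\<dots> = (\<Sum>(U, V)\<in>Sigma (Pow S) (\<lambda>U. Pow (S - U)). gsign U (S - U) * gsign V (S - U - V) *
           gcoeff a U * gcoeff b V * gcoeff c (S - U - V))"
    proof (rule sum.reindex_bij_witness[where i = "\<lambda>(U, V). (U \<union> V, U)" and j = "\<lambda>(T, U). (U, T - U)"])
      fix p assume p: "p \<in> Sigma (Pow S) Pow"
      obtain T U where [simp]: "p = (T, U)" by force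
      have TU: "T \<subseteq> S" "U \<subseteq> T" using p by auto
      have f: "finite U" "finite (T - U)" "finite (S - T)"
        using TU by (auto intro: fin)
      have 1: "S - U - (T - U) = S - T" "S - U = (T - U) \<union> (S - T)" using TU by auto
      have "gsign (U \<union> (T - U)) (S - T) = gsign U (S - T) * gsign (T - U) (S - T)"
        by (rule gsign_Un_left) (use f in auto)
      moreover have "U \<union> (T - U) = T" using TU by auto
      moreover have "gsign U (S - U) = gsign U (T - U) * gsign U (S - T)"
        unfolding 1(2) by (rule gsign_Un_right) (use f in auto)
      ultimately have "gsign T (S - T) * gsign U (T - U) = gsign U (S - U) * gsign (T - U) (S - T)"
        by simp
      then show "(case case p of (T, U) \<Rightarrow> (U, T - U) of (U, V) \<Rightarrow> gsign U (S - U) * gsign V (S - U - V) *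
           gcoeff a U * gcoeff b V * gcoeff c (S - U - V)) = (case p of (T, U) \<Rightarrow>
           gsign T (S - T) * gsign U (T - U) * gcoeff a U * gcoeff b (T - U) * gcoeff c (S - T))"
        by (simp add: 1(1))
    qed auto
    also have "\<dots> = gcoeff (a * (b * c)) S"
      using S fin
      by (simp add: times_grassmann.rep_eq sum_distrib_left sum_distrib_right mult_ac
            flip: sum.Sigma)
    finally show "gcoeff (a * b * c) S = gcoeff (a * (b * c)) S" .
  qed
qed

end

lift_definition gvar :: "'g \<Rightarrow> 'g grassmann" is "\<lambda>g S. if S = {g} then 1 else 0" by auto

text \<open>The subalgebra generated by the generators in \<open>G\<close>, i.e. the span of the monomials in \<open>G\<close>.\<close>

definition galg :: "'g set \<Rightarrow> 'g grassmann set" where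
  "galg G = {a. \<forall>S. gcoeff a S \<noteq> 0 \<longrightarrow> S \<subseteq> G}"

definition geven :: "'g grassmann set" where
  "geven = {a. \<forall>S. gcoeff a S \<noteq> 0 \<longrightarrow> even (card S)}"

definition godd :: "'g grassmann set" where
  "godd = {a. \<forall>S. gcoeff a S \<noteq> 0 \<longrightarrow> odd (card S)}"

definition body :: "'g grassmann \<Rightarrow> real" where
  "body a = gcoeff a {}"

definition soul :: "'g::linorder grassmann \<Rightarrow> 'g grassmann" where
  "soul a = a - of_real (body a)"

text \<open>
  Taylor expansion of a real function in the nilpotent part of its argument. The sum is finite for
  \<open>a \<in> galg G\<close> with \<open>G\<close> finite. The argument is meant to be even.
\<close>

definition gext :: "(real \<Rightarrow> real) \<Rightarrow> 'g::linorder grassmann \<Rightarrow> 'g grassmann" where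
  "gext f a = (\<Sum>k | soul a ^ k \<noteq> 0. ((deriv ^^ k) f (body a) / fact k) *\<^sub>R soul a ^ k)"

text \<open>The (left) derivative: \<open>\<omega>\<^sub>1\<close> in the decomposition \<open>\<omega> = \<omega>\<^sub>0 + g \<omega>\<^sub>1\<close>.\<close>

definition gderiv :: "'g::linorder \<Rightarrow> 'g grassmann \<Rightarrow> 'g grassmann" where
  "gderiv g \<omega> = (THE \<omega>1. \<omega>1 \<in> galg (- {g}) \<and> (\<exists>\<omega>0 \<in> galg (- {g}). \<omega> = \<omega>0 + gvar g * \<omega>1))"

lemma gcoeff_gvar_mult:
  assumes "finite S"
  shows "gcoeff (gvar g * a) S = (if g \<in> S then gsign {g} (S - {g}) * gcoeff a (S - {g}) else 0)"
proof -
  have "gcoeff (gvar g * a) S =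
      (\<Sum>T\<in>Pow S. if T = {g} then gsign {g} (S - {g}) * gcoeff a (S - {g}) else 0)"
    by (auto simp: times_grassmann.rep_eq gvar.rep_eq intro!: sum.cong)
  then show ?thesis using assms by simp
qed

lemma gsign_square [simp]: "gsign T U * gsign T U = 1"
  by (simp add: gsign_def flip: power_add mult_2)

lemma gsign_square_left [simp]: "gsign T U * (gsign T U * x) = x"
  by (simp flip: mult.assoc)

lemma gderiv_eqI:
  assumes "\<omega>1 \<in> galg (- {g})" "\<omega>0 \<in> galg (- {g})" "\<omega> = \<omega>0 + gvar g * \<omega>1"
  shows "gderiv g \<omega> = \<omega>1"
  unfolding gderiv_def
proof (rule the_equality)
  show "\<omega>1 \<in> galg (- {g}) \<and> (\<exists>\<omega>0 \<in> galg (- {g}). \<omega> = \<omega>0 + gvar g * \<omega>1)"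
    using assms by auto
next
  fix \<eta> assume "\<eta> \<in> galg (- {g}) \<and> (\<exists>\<omega>0 \<in> galg (- {g}). \<omega> = \<omega>0 + gvar g * \<eta>)"
  then obtain \<theta> where *: "\<eta> \<in> galg (- {g})" "\<theta> \<in> galg (- {g})" "\<omega> = \<theta> + gvar g * \<eta>"
    by auto
  show "\<eta> = \<omega>1"
  proof (rule grassmann_eqI)
    fix S :: "'a set" assume S: "finite S"
    show "gcoeff \<eta> S = gcoeff \<omega>1 S"
    proof (cases "g \<in> S")
      case True
      then show ?thesis using * assms by (force simp: galg_def)
    next
      case False
      have "gcoeff \<theta> (insert g S) = 0" "gcoeff \<omega>0 (insert g S) = 0"
        using *(2) assms(2) by (force simp: galg_def)+
      moreover have "gcoeff (\<theta> + gvar g * \<eta>) (insert g S) = gcoeff (\<omega>0 + gvar g * \<omega>1) (insert g S)"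
        using *(3) assms(3) by simp
      ultimately have "gsign {g} S * gcoeff \<eta> S = gsign {g} S * gcoeff \<omega>1 S"
        using S False by (simp add: plus_grassmann.rep_eq gcoeff_gvar_mult)
      then show ?thesis
        by (metis gsign_square_left)
    qed
  qed
qed

lemma gcoeff_gderiv:
  "gcoeff (gderiv g \<omega>) S = (if g \<in> S then 0 else gsign {g} S * gcoeff \<omega> (insert g S))"
proof -
  define \<omega>1 where "\<omega>1 = Abs_grassmann (\<lambda>S. if g \<in> S then 0 else gsign {g} S * gcoeff \<omega> (insert g S))"
  define \<omega>0 where "\<omega>0 = Abs_grassmann (\<lambda>S. if g \<in> S then 0 else gcoeff \<omega> S)"
  have 1: "gcoeff \<omega>1 = (\<lambda>S. if g \<in> S then 0 else gsign {g} S * gcoeff \<omega> (insert g S))"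
    unfolding \<omega>1_def by (rule Abs_grassmann_inverse) (auto simp: gcoeff_infinite)
  have 0: "gcoeff \<omega>0 = (\<lambda>S. if g \<in> S then 0 else gcoeff \<omega> S)"
    unfolding \<omega>0_def by (rule Abs_grassmann_inverse) (auto simp: gcoeff_infinite)
  have "gderiv g \<omega> = \<omega>1"
  proof (rule gderiv_eqI)
    show "\<omega>1 \<in> galg (- {g})" "\<omega>0 \<in> galg (- {g})"
      by (auto simp: galg_def 0 1)
    show "\<omega> = \<omega>0 + gvar g * \<omega>1"
    proof (rule grassmann_eqI)
      fix S :: "'a set" assume "finite S"
      then show "gcoeff \<omega> S = gcoeff (\<omega>0 + gvar g * \<omega>1) S"
        by (auto simp: plus_grassmann.rep_eq gcoeff_gvar_mult 0 1 insert_absorb)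
    qed
  qed
  then show ?thesis by (simp add: 1)
qed

lemma gcoeff_gvar_gvar:
  "gcoeff (gvar g * gvar g') S =
     (if g \<noteq> g' \<and> S = {g, g'} then (if g' < g then -1 else 1) else 0)"
proof (cases "finite S")
  case True
  have "{(t, u). t = g \<and> u = g' \<and> u < t} = (if g' < g then {(g, g')} else {})"
    by auto
  then have "gsign {g} {g'} = (if g' < g then -1 else 1)"
    by (simp add: gsign_def)
  moreover have "g \<in> S \<and> S - {g} = {g'} \<longleftrightarrow> g \<noteq> g' \<and> S = {g, g'}"
    by auto
  ultimately show ?thesis
    using True by (auto simp: gcoeff_gvar_mult gvar.rep_eq)
qed (auto simp: gcoeff_infinite)

lemma gvar_square [simp]: "gvar g * gvar g = 0"
  by (rule grassmann_eqI) (simp add: gcoeff_gvar_gvar zero_grassmann.rep_eq)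

lemma gvar_anticommute: "gvar g * gvar g' = - (gvar g' * gvar g)"
  by (rule grassmann_eqI) (auto simp: gcoeff_gvar_gvar uminus_grassmann.rep_eq insert_commute)

lemma gvar_gvar_square: "(gvar g * gvar g') * (gvar g * gvar g') = 0"
proof -
  have "(gvar g * gvar g') * (gvar g * gvar g') = gvar g * (gvar g' * gvar g) * gvar g'"
    by (simp add: mult.assoc)
  also have "\<dots> = - (gvar g * gvar g * (gvar g' * gvar g'))"
    by (subst gvar_anticommute[of g' g]) (simp only: mult.assoc mult_minus_left mult_minus_right)
  finally show ?thesis by simp
qed

lemma gcoeff_of_real: "gcoeff (of_real r) S = (if S = {} then r else 0)"
  by (simp add: of_real_def scaleR_grassmann.rep_eq one_grassmann.rep_eq)

lemma gext_square_zero: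
  assumes "body n = 0" "n * n = 0"
  shows "gext f (of_real b + n) = of_real (f b) + deriv f b *\<^sub>R n"
proof -
  have b: "body (of_real b + n) = b"
    using assms(1) by (simp add: body_def plus_grassmann.rep_eq gcoeff_of_real)
  have s: "soul (of_real b + n) = n"
    unfolding soul_def b by simp
  have "n ^ k = 0" if "k \<ge> 2" for k
  proof -
    have "n ^ k = n ^ 2 * n ^ (k - 2)"
      by (simp only: le_add_diff_inverse[OF that] flip: power_add)
    then have "n ^ k = n * n * n ^ (k - 2)" by (simp only: power2_eq_square)
    then show ?thesis using assms(2) by simp
  qed
  then have "n ^ k \<noteq> 0 \<longleftrightarrow> k = 0 \<or> k = 1 \<and> n \<noteq> 0" for k
    by (cases "k \<ge> 2") (auto simp: not_le dest: less_2_cases)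
  then have "{k. n ^ k \<noteq> 0} = (if n = 0 then {0} else {0, 1})"
    by auto
  then show ?thesis
    unfolding gext_def b s by (auto simp: of_real_def)
qed


section \<open>The superspaces\<close>

text \<open>Points \<open>(x, y, z, \<xi>, \<eta>)\<close>; addition and scaling are componentwise.\<close>

type_synonym 'g svec = "'g grassmann \<times> 'g grassmann \<times> 'g grassmann \<times> 'g grassmann \<times> 'g grassmann"

fun sinner :: "'g::linorder svec \<Rightarrow> 'g svec \<Rightarrow> 'g grassmann" where
  "sinner (x, y, z, \<xi>, \<eta>) (x', y', z', \<xi>', \<eta>') = x * x' + y * y' - z * z' + \<xi> * \<eta>' - \<eta> * \<xi>'"

definition sorigin :: "'g::linorder svec" where
  "sorigin = (0, 0, 1, 0, 0)"

text \<open>In each case \<open>G\<close> is the set of generators of the underlying Grassmann algebra.\<close>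

definition H32 :: "'g set \<Rightarrow> 'g svec set" where
  "H32 G = (let E = galg G \<inter> geven; D = galg G \<inter> godd in E \<times> E \<times> E \<times> D \<times> D)"

definition H32_plus :: "'g::linorder set \<Rightarrow> 'g svec set" where
  "H32_plus G = {v \<in> H32 G. body (sinner v v) < 0 \<and> (case v of (x, y, z, \<xi>, \<eta>) \<Rightarrow> body z > 0)}"

definition H32_plus0 :: "'g::linorder set \<Rightarrow> 'g svec set" where
  "H32_plus0 G = {v \<in> H32 G. body (sinner v v) \<le> 0 \<and> (case v of (x, y, z, \<xi>, \<eta>) \<Rightarrow> body z \<ge> 0)}"

definition H22 :: "'g::linorder set \<Rightarrow> 'g svec set" where
  "H22 G = {v \<in> H32 G. sinner v v = -1 \<and> (case v of (x, y, z, \<xi>, \<eta>) \<Rightarrow> body z > 0)}"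


section \<open>Superintegration and the model\<close>

text \<open>
  The generators \<open>\<xi>\<^sub>i\<close>, \<open>\<eta>\<^sub>i\<close> attached to vertices, and Grassmann parameters. The linear order only
  fixes the basis of monomials.
\<close>

datatype 'v gen = Param nat | Xi 'v | Eta 'v

instantiation gen :: (linorder) linorder
begin

fun less_eq_gen :: "'a gen \<Rightarrow> 'a gen \<Rightarrow> bool" where
  "less_eq_gen (Param m) (Param n) = (m \<le> n)"
| "less_eq_gen (Param m) (Xi v) = True"
| "less_eq_gen (Param m) (Eta v) = True"
| "less_eq_gen (Xi u) (Param n) = False"
| "less_eq_gen (Xi u) (Xi v) = (u \<le> v)"
| "less_eq_gen (Xi u) (Eta v) = True"
| "less_eq_gen (Eta u) (Param n) = False"
| "less_eq_gen (Eta u) (Xi v) = False"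
| "less_eq_gen (Eta u) (Eta v) = (u \<le> v)"

definition less_gen :: "'a gen \<Rightarrow> 'a gen \<Rightarrow> bool" where
  "less_gen a b \<longleftrightarrow> a \<le> b \<and> \<not> b \<le> a"

instance
proof
  fix a b c :: "'a gen"
  show "a < b \<longleftrightarrow> a \<le> b \<and> \<not> b \<le> a" by (rule less_gen_def)
  show "a \<le> a" by (cases a) auto
  show "a \<le> b \<Longrightarrow> b \<le> c \<Longrightarrow> a \<le> c" by (cases a; cases b; cases c) auto
  show "a \<le> b \<Longrightarrow> b \<le> a \<Longrightarrow> a = b" by (cases a; cases b) auto
  show "a \<le> b \<or> b \<le> a" by (cases a; cases b) auto
qed

end

text \<open>The spin at vertex \<open>j\<close>, in the coordinates \<open>x\<^sub>j\<close>, \<open>y\<^sub>j\<close>, \<open>\<xi>\<^sub>j\<close>, \<open>\<eta>\<^sub>j\<close>.\<close>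

definition spin_z :: "'v::linorder \<Rightarrow> real \<times> real \<Rightarrow> 'v gen grassmann" where
  "spin_z j = (\<lambda>(x, y). gext sqrt (of_real (1 + x\<^sup>2 + y\<^sup>2) + 2 *\<^sub>R (gvar (Xi j) * gvar (Eta j))))"

definition spin :: "'v::linorder \<Rightarrow> real \<times> real \<Rightarrow> 'v gen svec" where
  "spin j p = (of_real (fst p), of_real (snd p), spin_z j p, gvar (Xi j), gvar (Eta j))"

lemma spin_z_eq:
  "spin_z j (x, y) = of_real (sqrt (1 + x\<^sup>2 + y\<^sup>2)) +
     (1 / sqrt (1 + x\<^sup>2 + y\<^sup>2)) *\<^sub>R (gvar (Xi j) * gvar (Eta j))"
proof -
  let ?n = "gvar (Xi j) * gvar (Eta j)"
  have pos: "1 + x\<^sup>2 + y\<^sup>2 > 0" by (simp add: add_pos_nonneg)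
  have "?n * ?n = 0"
    by (rule gvar_gvar_square)
  moreover have "body ?n = 0" by (simp add: body_def gcoeff_gvar_gvar)
  moreover have "deriv sqrt (1 + x\<^sup>2 + y\<^sup>2) = inverse (sqrt (1 + x\<^sup>2 + y\<^sup>2)) / 2"
    by (rule DERIV_imp_deriv[OF DERIV_real_sqrt[OF pos]])
  ultimately show ?thesis
    unfolding spin_z_def case_prod_conv
    by (subst gext_square_zero) (auto simp: body_def scaleR_grassmann.rep_eq field_simps)
qed

lemma spin_in_H22: "spin j p \<in> H22 {Xi j, Eta j}"
proof -
  obtain x y where p: "p = (x, y)" by (cases p)
  let ?r = "sqrt (1 + x\<^sup>2 + y\<^sup>2)" and ?n = "gvar (Xi j) * gvar (Eta j)"
  have pos: "1 + x\<^sup>2 + y\<^sup>2 > 0" by (simp add: add_pos_nonneg)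
  have nn: "?n * ?n = 0"
    by (rule gvar_gvar_square)
  have "(of_real ?r + (1 / ?r) *\<^sub>R ?n) * (of_real ?r + (1 / ?r) *\<^sub>R ?n) =
      of_real (?r * ?r) + (?r * (1 / ?r)) *\<^sub>R ?n + ((1 / ?r) * ?r) *\<^sub>R ?n +
      ((1 / ?r) * (1 / ?r)) *\<^sub>R (?n * ?n)"
    by (simp only: of_real_def distrib_left distrib_right mult_scaleR_left mult_scaleR_right
        mult_1_left mult_1_right scaleR_scaleR scaleR_right_distrib add.assoc)
  also have "?r * ?r = 1 + x\<^sup>2 + y\<^sup>2" using pos by simp
  also have "?r * (1 / ?r) = 1" using pos by simp
  also have "1 / ?r * ?r = 1" using pos by simp
  finally have zz: "spin_z j p * spin_z j p = of_real (1 + x\<^sup>2 + y\<^sup>2) + ?n + ?n"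
    by (simp only: p spin_z_eq nn scaleR_one scaleR_zero_right add_0_right)
  have "sinner (spin j p) (spin j p) = -1"
    unfolding spin_def sinner.simps zz gvar_anticommute[of "Eta j" "Xi j"]
    by (simp add: p power2_eq_square)
  moreover have "body (spin_z j p) > 0"
    using pos by (simp add: p spin_z_eq body_def plus_grassmann.rep_eq scaleR_grassmann.rep_eq
        gcoeff_of_real gcoeff_gvar_gvar)
  moreover have "spin j p \<in> H32 {Xi j, Eta j}"
  proof -
    have "spin_z j p \<in> galg {Xi j, Eta j}" "spin_z j p \<in> geven"
      by (auto simp: p spin_z_eq galg_def geven_def plus_grassmann.rep_eq scaleR_grassmann.rep_eq
          gcoeff_of_real gcoeff_gvar_gvar)
    then show ?thesis
      by (auto simp: H32_def Let_def spin_def galg_def geven_def godd_def gcoeff_of_real gvar.rep_eq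
          split: if_splits)
  qed
  ultimately show ?thesis by (simp add: H22_def spin_def)
qed

text \<open>
  Superfunctions are represented as functions of the family \<open>v\<close> of spins. The elements \<open>1 / z\<^sub>j\<close> and
  the operators \<open>\<partial>\<^bsub>\<xi>\<^sub>j\<^esub> \<partial>\<^bsub>\<eta>\<^sub>j\<^esub>\<close> are even and hence commute, so the order of the vertices in
  the two products is immaterial.
\<close>

definition berezin_integrand ::
  "'v::linorder set \<Rightarrow> (('v \<Rightarrow> 'v gen svec) \<Rightarrow> 'v gen grassmann) \<Rightarrow> ('v \<Rightarrow> real \<times> real) \<Rightarrow> 'v gen grassmann"
where
  "berezin_integrand \<Lambda> f p =
     foldr (\<lambda>j. gderiv (Xi j) \<circ> gderiv (Eta j)) (sorted_list_of_set \<Lambda>)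
       ((\<Prod>j\<leftarrow>sorted_list_of_set \<Lambda>. gext (\<lambda>t. 1 / t) (spin_z j (p j))) * f (\<lambda>j. spin j (p j)))"

text \<open>
  Integrals of Grassmann-valued functions are taken coefficientwise. Since the Lebesgue integral of a
  non-integrable function is \<open>0\<close>, existence of the superintegral is a separate predicate.
\<close>

definition super_integrable ::
  "'v::linorder set \<Rightarrow> (('v \<Rightarrow> 'v gen svec) \<Rightarrow> 'v gen grassmann) \<Rightarrow> bool"
where
  "super_integrable \<Lambda> f \<longleftrightarrow>
     (\<forall>S. integrable (PiM \<Lambda> (\<lambda>_. lborel)) (\<lambda>p. gcoeff (berezin_integrand \<Lambda> f p) S))"

lift_definition super_integral ::
  "'v::linorder set \<Rightarrow> (('v \<Rightarrow> 'v gen svec) \<Rightarrow> 'v gen grassmann) \<Rightarrow> 'v gen grassmann"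
is "\<lambda>\<Lambda> f S. 1 / (2 * pi) ^ card \<Lambda> *
      (\<integral>p. gcoeff (berezin_integrand \<Lambda> f p) S \<partial>(PiM \<Lambda> (\<lambda>_. lborel)))"
  by (simp add: gcoeff_infinite)

definition action ::
  "'v::linorder set \<Rightarrow> ('v \<Rightarrow> 'v \<Rightarrow> real) \<Rightarrow> ('v \<Rightarrow> real) \<Rightarrow> ('v \<Rightarrow> 'v gen svec) \<Rightarrow> 'v gen grassmann"
where
  "action \<Lambda> W h v =
     (\<Sum>i\<in>\<Lambda>. \<Sum>j\<in>\<Lambda>. W i j *\<^sub>R (1 + sinner (v i) (v j))) +
     (\<Sum>i\<in>\<Lambda>. h i *\<^sub>R (1 + sinner (v i) sorigin))"

definition has_expectation ::
  "'v::linorder set \<Rightarrow> ('v \<Rightarrow> 'v \<Rightarrow> real) \<Rightarrow> ('v \<Rightarrow> real) \<Rightarrow>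
     (('v \<Rightarrow> 'v gen svec) \<Rightarrow> 'v gen grassmann) \<Rightarrow> bool"
where
  "has_expectation \<Lambda> W h f \<longleftrightarrow> super_integrable \<Lambda> (\<lambda>v. gext exp (action \<Lambda> W h v) * f v)"

definition expectation ::
  "'v::linorder set \<Rightarrow> ('v \<Rightarrow> 'v \<Rightarrow> real) \<Rightarrow> ('v \<Rightarrow> real) \<Rightarrow>
     (('v \<Rightarrow> 'v gen svec) \<Rightarrow> 'v gen grassmann) \<Rightarrow> 'v gen grassmann"
where
  "expectation \<Lambda> W h f = super_integral \<Lambda> (\<lambda>v. gext exp (action \<Lambda> W h v) * f v)"


section \<open>Weighted graphs\<close>

definition graph_edges :: "'v set \<Rightarrow> ('v \<Rightarrow> 'v \<Rightarrow> real) \<Rightarrow> 'v set set" where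
  "graph_edges \<Lambda> W = {{i, j} | i j. i \<in> \<Lambda> \<and> j \<in> \<Lambda> \<and> W i j > 0}"

definition graph_components :: "'v set \<Rightarrow> ('v \<Rightarrow> 'v \<Rightarrow> real) \<Rightarrow> 'v set set" where
  "graph_components \<Lambda> W = \<Lambda> // {(i, j) \<in> \<Lambda> \<times> \<Lambda>. (i, j) \<in> {(u, v). {u, v} \<in> graph_edges \<Lambda> W}\<^sup>*}"


section \<open>The binary tree\<close>

type_synonym word = "bool list"

definition leaves :: "nat \<Rightarrow> word set" where
  "leaves n = {j. length j = n}"

definition tree :: "nat \<Rightarrow> word set" where
  "tree N = (\<Union>n\<le>N. leaves n)"

definition level :: "nat \<Rightarrow> word \<Rightarrow> nat" where
  "level N j = N - length j"

text \<open>
  \<open>tl\<close> drops the first letter. It is total with \<open>tl [] = []\<close>, which makes no difference below since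
  the empty word is reached from any word anyway.
\<close>

abbreviation cut :: "word \<Rightarrow> word" where
  "cut \<equiv> tl"

definition ancestor_eq :: "word \<Rightarrow> word \<Rightarrow> bool" (infix "\<preceq>" 50) where
  "i \<preceq> j \<longleftrightarrow> (\<exists>l. i = (cut ^^ l) j)"

definition lca :: "word \<Rightarrow> word \<Rightarrow> word" where
  "lca i j = (cut ^^ (LEAST m. \<exists>m'. (cut ^^ m) i = (cut ^^ m') j)) i"

definition blk :: "nat \<Rightarrow> word \<Rightarrow> word set" where
  "blk N i = {j \<in> leaves N. i \<preceq> j}"

definition antichain :: "nat \<Rightarrow> word set \<Rightarrow> bool" where
  "antichain N A \<longleftrightarrow> A \<subseteq> tree N \<and> (\<forall>i\<in>A. \<forall>j\<in>A. i \<noteq> j \<longrightarrow> \<not> i \<preceq> j \<and> \<not> j \<preceq> i)"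

definition maximal_antichain :: "nat \<Rightarrow> word set \<Rightarrow> bool" where
  "maximal_antichain N A \<longleftrightarrow> antichain N A \<and> (\<nexists>A'. antichain N A' \<and> A \<subset> A')"

definition compatible :: "nat \<Rightarrow> (word \<Rightarrow> real) \<Rightarrow> word set \<Rightarrow> bool" where
  "compatible N h A \<longleftrightarrow> (\<forall>j\<in>A. h constant_on blk N j)"

definition tree_weight :: "nat \<Rightarrow> (nat \<Rightarrow> real) \<Rightarrow> word \<Rightarrow> word \<Rightarrow> real" where
  "tree_weight N w i j = 2 ^ (level N i + level N j) * w (level N (lca i j))"

definition block_pinning :: "nat \<Rightarrow> (word \<Rightarrow> real) \<Rightarrow> word \<Rightarrow> real" where
  "block_pinning N h j = (\<Sum>i\<in>blk N j. h i)"

definition block_spin :: "nat \<Rightarrow> (word \<Rightarrow> word gen svec) \<Rightarrow> word \<Rightarrow> word gen svec" where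
  "block_spin N v j = (1 / 2 ^ level N j) *\<^sub>R (\<Sum>i\<in>blk N j. v i)"

end

theory Submission
  imports Defs "HOL-Computational_Algebra.Formal_Power_Series"
begin

text \<open>
  For a field \<open>b\<close> in the open forward cone with \<open>\<langle>b, b\<rangle> = - m\<^sup>2\<close>, supersymmetry localizes the
  superintegral over one spin: \<open>F (- \<langle>v, b\<rangle>)\<close> has superintegral \<open>F m\<close>. In particular \<open>exp \<langle>v, b\<rangle>\<close> has
  superintegral \<open>exp (- m)\<close>. Consequently two spins that interact with weight \<open>W\<close> and feel the same
  field \<open>b\<close> contribute \<open>exp (- 2 m)\<close>, independently of \<open>W\<close>: integrating the first one gives
  \<open>exp (W - sqrt (W\<^sup>2 - 2 W \<langle>v, b\<rangle> + m\<^sup>2))\<close>, which at \<open>- \<langle>v, b\<rangle> = m\<close> equals \<open>exp (- m)\<close>. This is the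
  contribution of a single spin in the field \<open>2 b\<close>. Since two sibling blocks of the tree see the rest of the
  system through the same field, they can be merged into their parent, and every antichain is
  reached from the leaves by such steps.

  Localization holds with Grassmann parameters in \<open>b\<close> because it is proved by integration by parts: the
  integrand for \<open>b\<close> differs from the radial one for \<open>(0, 0, m, 0, 0)\<close> by a total divergence.
\<close>

section \<open>Parity in Grassmann algebras\<close>


text \<open>The field at a spin contains the other spins and so their odd generators; one-spin
  localization must admit odd components even if the sources have none. Integrating out one of two
  siblings leaves a factor that is not the exponential of an affine function of the other.
  Localization is therefore proved for a class of functions \<open>F\<close>
  (\<open>super_fun\<close>), handled through a chain rule and an exponential bound. The member used
  is \<open>exp (- q - sqrt (\<kappa> + \<omega> q))\<close>, with \<open>\<omega> = 0\<close>
  giving a multiple of the exponential. Spins are removed by Fubini, which asks for integrability of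
  the full integrand. On bodies, minus the exponent controls the hyperbolic cosine of every spin: an
  edge compares its two ends, and a field in the open cone is coercive at its own vertex. One such
  vertex per component thus gives integrability; it also puts the field at each vertex in the open
  cone, where its mass is defined. These hypotheses pass to refinements, so the induction descends
  from \<open>A\<close> to the leaves.\<close>

lemmas gcoeff_simps [simp] = plus_grassmann.rep_eq minus_grassmann.rep_eq uminus_grassmann.rep_eq
  scaleR_grassmann.rep_eq zero_grassmann.rep_eq

lemma gsign_abs [simp]: "\<bar>gsign T U\<bar> = 1"
  by (simp add: gsign_def power_abs)

text \<open>Each pair in \<open>T \<times> U\<close> is an inversion in exactly one of the two
  orders, so the two inversion counts add up to \<open>card T * card U\<close>.\<close>

lemma gsign_swap:
  assumes "finite T" "finite U" "T \<inter> U = {}"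
  shows "gsign U T = (-1) ^ (card T * card U) * gsign T U"
proof -
  let ?A = "{(t, u). t \<in> T \<and> u \<in> U \<and> u < t}" and ?B = "{(u, t). u \<in> U \<and> t \<in> T \<and> t < u}"
  have fin: "finite (T \<times> U)" using assms by simp
  have "card ?B = card (prod.swap ` ?B)"
    by (subst card_image) auto
  moreover have "prod.swap ` ?B = {(t, u). t \<in> T \<and> u \<in> U \<and> t < u}"
    by (auto simp: image_iff)
  moreover have "T \<times> U = ?A \<union> {(t, u). t \<in> T \<and> u \<in> U \<and> t < u}"
    using assms(3) by (auto simp: not_less dest: order_antisym)
  moreover have "card (?A \<union> {(t, u). t \<in> T \<and> u \<in> U \<and> t < u}) = card ?A + card {(t, u). t \<in> T \<and> u \<in> U \<and> t < u}"
    by (rule card_Un_disjoint) (auto intro: finite_subset[OF _ fin])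
  ultimately have "card T * card U = card ?A + card ?B"
    by (metis card_cartesian_product)
  then have "(-1::real) ^ (card T * card U) * gsign T U = (-1) ^ card ?B * (gsign T U * gsign T U)"
    by (simp add: gsign_def power_add)
  then show ?thesis
    by (simp add: gsign_def[of U T])
qed

text \<open>The sign is asked for only on splittings that contribute, so one lemma serves an even
  factor (\<open>e = 1\<close>) and two odd ones (\<open>e = -1\<close>).\<close>

lemma gcoeff_mult_commute:
  assumes "finite S" "\<And>T. T \<subseteq> S \<Longrightarrow> gcoeff a T \<noteq> 0 \<Longrightarrow> gcoeff b (S - T) \<noteq> 0 \<Longrightarrow> (-1) ^ (card T * card (S - T)) = (e::real)"
  shows "gcoeff (b * a) S = e * gcoeff (a * b) S"
proof -
  have "gcoeff (b * a) S = (\<Sum>T\<in>Pow S. gsign T (S - T) * gcoeff b T * gcoeff a (S - T))"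
    by (simp add: times_grassmann.rep_eq)
  also have "\<dots> = (\<Sum>T\<in>Pow S. gsign (S - T) T * gcoeff b (S - T) * gcoeff a T)"
    by (rule sum.reindex_bij_witness[where i = "\<lambda>T. S - T" and j = "\<lambda>T. S - T"])
      (auto simp: double_diff)
  also have "\<dots> = (\<Sum>T\<in>Pow S. e * (gsign T (S - T) * gcoeff a T * gcoeff b (S - T)))"
  proof (rule sum.cong)
    fix T assume T: "T \<in> Pow S"
    show "gsign (S - T) T * gcoeff b (S - T) * gcoeff a T = e * (gsign T (S - T) * gcoeff a T * gcoeff b (S - T))"
    proof (cases "gcoeff a T = 0 \<or> gcoeff b (S - T) = 0")
      case False
      then have "(-1) ^ (card T * card (S - T)) = e" using T assms(2) by auto
      moreover have "finite T" using T assms(1) finite_subset by auto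
      ultimately show ?thesis
        using gsign_swap[of T "S - T"] assms(1) by auto
    qed auto
  qed simp
  finally show ?thesis
    by (simp add: times_grassmann.rep_eq sum_distrib_left)
qed

lemma geven_commute: "a \<in> geven \<Longrightarrow> a * b = b * a"
  by (rule grassmann_eqI, rule gcoeff_mult_commute[where e = 1, unfolded mult_1])
    (auto simp: geven_def)

lemma godd_anticommute:
  assumes "a \<in> godd" "b \<in> godd"
  shows "a * b = - (b * a)"
proof (rule grassmann_eqI)
  fix S :: "'a set" assume "finite S"
  then show "gcoeff (a * b) S = gcoeff (- (b * a)) S"
    using gcoeff_mult_commute[of S b a "-1"] assms by (auto simp: godd_def)
qed

lemma godd_square: "a \<in> godd \<Longrightarrow> a * a = 0"
proof -
  assume "a \<in> godd"
  then have "2 *\<^sub>R (a * a) = 0"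
    using godd_anticommute[of a a] by (simp add: scaleR_2 add_eq_0_iff)
  then show ?thesis by simp
qed

lemma gcoeff_mult_nonzeroE:
  assumes "gcoeff (a * b) S \<noteq> 0"
  obtains T where "T \<subseteq> S" "finite S" "gcoeff a T \<noteq> 0" "gcoeff b (S - T) \<noteq> 0"
proof -
  have "finite S" using assms gcoeff_infinite by blast
  moreover have "\<exists>T\<in>Pow S. gsign T (S - T) * gcoeff a T * gcoeff b (S - T) \<noteq> 0"
    using assms by (metis (no_types, lifting) sum.neutral times_grassmann.rep_eq)
  ultimately show ?thesis using that by fastforce
qed

lemma gcoeff_one: "gcoeff 1 S = (if S = {} then 1 else 0)"
  by (simp add: one_grassmann.rep_eq)

lemma galg_0: "0 \<in> galg G" by (simp add: galg_def)
lemma galg_1: "1 \<in> galg G" by (simp add: galg_def gcoeff_one)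
lemma galg_add: "a \<in> galg G \<Longrightarrow> b \<in> galg G \<Longrightarrow> a + b \<in> galg G"
  unfolding galg_def by simp (metis add.right_neutral)
lemma galg_scaleR: "a \<in> galg G \<Longrightarrow> r *\<^sub>R a \<in> galg G" by (simp add: galg_def)
lemma galg_minus: "a \<in> galg G \<Longrightarrow> - a \<in> galg G" by (simp add: galg_def)
lemma galg_diff: "a \<in> galg G \<Longrightarrow> b \<in> galg G \<Longrightarrow> a - b \<in> galg G"
  using galg_add[of a G "- b"] galg_minus[of b G] by simp
lemma galg_mult: "a \<in> galg G \<Longrightarrow> b \<in> galg G \<Longrightarrow> a * b \<in> galg G"
  unfolding galg_def by (auto elim!: gcoeff_mult_nonzeroE)
lemma galg_of_real: "of_real r \<in> galg G" by (simp add: galg_def gcoeff_of_real)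
lemma galg_gvar: "g \<in> G \<Longrightarrow> gvar g \<in> galg G" by (simp add: galg_def gvar.rep_eq)
lemma galg_mono: "a \<in> galg G \<Longrightarrow> G \<subseteq> G' \<Longrightarrow> a \<in> galg G'" by (auto simp: galg_def)
lemma galg_sum: "(\<And>i. i \<in> I \<Longrightarrow> f i \<in> galg G) \<Longrightarrow> sum f I \<in> galg G"
  by (induction I rule: infinite_finite_induct) (auto intro: galg_0 galg_add)

lemmas galg_intros = galg_0 galg_1 galg_add galg_scaleR galg_minus galg_diff galg_mult galg_of_real galg_gvar galg_sum

lemma geven_0: "0 \<in> geven" by (simp add: geven_def)
lemma geven_1: "1 \<in> geven" by (simp add: geven_def gcoeff_one)
lemma geven_add: "a \<in> geven \<Longrightarrow> b \<in> geven \<Longrightarrow> a + b \<in> geven"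
  unfolding geven_def by simp (metis add.right_neutral)
lemma geven_scaleR: "a \<in> geven \<Longrightarrow> r *\<^sub>R a \<in> geven" by (simp add: geven_def)
lemma geven_minus: "a \<in> geven \<Longrightarrow> - a \<in> geven" by (simp add: geven_def)
lemma geven_diff: "a \<in> geven \<Longrightarrow> b \<in> geven \<Longrightarrow> a - b \<in> geven"
  using geven_add[of a "- b"] geven_minus[of b] by simp
lemma card_split: "finite S \<Longrightarrow> T \<subseteq> S \<Longrightarrow> card S = card T + card (S - T)"
  by (metis card_Diff_subset card_mono finite_subset le_add_diff_inverse)
lemma geven_mult: "a \<in> geven \<Longrightarrow> b \<in> geven \<Longrightarrow> a * b \<in> geven"
  unfolding geven_def by (auto elim!: gcoeff_mult_nonzeroE simp: card_split)
lemma godd_mult: "a \<in> godd \<Longrightarrow> b \<in> godd \<Longrightarrow> a * b \<in> geven"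
  unfolding geven_def godd_def by (auto elim!: gcoeff_mult_nonzeroE simp: card_split)
lemma geven_of_real: "of_real r \<in> geven" by (simp add: geven_def gcoeff_of_real)
lemma godd_gvar: "gvar g \<in> godd" by (simp add: godd_def gvar.rep_eq)
lemma godd_0: "0 \<in> godd" by (simp add: godd_def)
lemma godd_add: "a \<in> godd \<Longrightarrow> b \<in> godd \<Longrightarrow> a + b \<in> godd"
  unfolding godd_def by simp (metis add.right_neutral)
lemma godd_scaleR: "a \<in> godd \<Longrightarrow> r *\<^sub>R a \<in> godd" by (simp add: godd_def)

section \<open>The commutative algebra of even elements\<close>

definition supp :: "'g grassmann \<Rightarrow> 'g set set" where
  "supp a = {S. gcoeff a S \<noteq> 0}"

lemma galg_finite_supp: "a \<in> galg G \<Longrightarrow> finite G \<Longrightarrow> finite (supp a)"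
  by (rule finite_subset[of _ "Pow G"]) (auto simp: galg_def supp_def)

text \<open>
  Every integrand of the model is even: odd elements enter only through products of two of them.
  So analysis can be done in a commutative algebra, normed by the sum of the absolute values of the
  coefficients.
\<close>

typedef 'g ev = "{a :: 'g::linorder grassmann. a \<in> geven \<and> (\<exists>G. finite G \<and> a \<in> galg G)}"
  morphisms gr Ev
  by (rule exI[of _ 0]) (auto intro: geven_0 galg_0)

setup_lifting type_definition_ev

text \<open>Keeping track of \<open>G\<close> gives the bound \<open>card G\<close> on degrees,
  which limits the Taylor sums and enters the growth estimates.\<close>

definition evG :: "'g set \<Rightarrow> 'g::linorder ev set" where
  "evG G = {a. gr a \<in> galg G}"

lemma Ev_cases: obtains G where "finite G" "gr a \<in> galg G"
  using gr[of a] by auto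

lemma finite_supp_gr: "finite (supp (gr a))"
  by (metis Ev_cases galg_finite_supp)

lemma gr_even: "gr a \<in> geven"
  using gr[of a] by auto

instantiation ev :: (linorder) comm_ring_1
begin
lift_definition zero_ev :: "'a ev" is 0 by (auto intro: geven_0 galg_0)
lift_definition one_ev :: "'a ev" is 1 by (auto intro: geven_1 galg_1)
lift_definition plus_ev :: "'a ev \<Rightarrow> 'a ev \<Rightarrow> 'a ev" is "(+)"
  by (auto intro!: geven_add) (meson finite_UnI galg_add galg_mono sup_ge1 sup_ge2)
lift_definition minus_ev :: "'a ev \<Rightarrow> 'a ev \<Rightarrow> 'a ev" is "(-)"
  by (auto intro!: geven_diff) (meson finite_UnI galg_diff galg_mono sup_ge1 sup_ge2)
lift_definition uminus_ev :: "'a ev \<Rightarrow> 'a ev" is "uminus"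
  by (auto intro!: geven_minus intro: galg_minus)
lift_definition times_ev :: "'a ev \<Rightarrow> 'a ev \<Rightarrow> 'a ev" is "(*)"
  by (auto intro!: geven_mult) (meson finite_UnI galg_mult galg_mono sup_ge1 sup_ge2)
instance
proof
  show "a * b = b * a" for a b :: "'a ev"
    by transfer (auto intro: geven_commute)
qed (transfer; simp add: algebra_simps)+
end

instantiation ev :: (linorder) real_algebra_1
begin
lift_definition scaleR_ev :: "real \<Rightarrow> 'a ev \<Rightarrow> 'a ev" is "(*\<^sub>R)"
  by (auto intro!: geven_scaleR intro: galg_scaleR)
instance
  by standard (transfer; simp add: algebra_simps)+
end

definition evcoeff :: "'g::linorder ev \<Rightarrow> 'g set \<Rightarrow> real" where
  "evcoeff a S = gcoeff (gr a) S"

lemma evcoeff_simps [simp]: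
  "evcoeff (a + b) S = evcoeff a S + evcoeff b S"
  "evcoeff (a - b) S = evcoeff a S - evcoeff b S"
  "evcoeff (- a) S = - evcoeff a S"
  "evcoeff (r *\<^sub>R a) S = r * evcoeff a S"
  "evcoeff 0 S = 0"
  by (simp_all add: evcoeff_def plus_ev.rep_eq minus_ev.rep_eq uminus_ev.rep_eq scaleR_ev.rep_eq zero_ev.rep_eq)

lemma evcoeff_one: "evcoeff 1 S = (if S = {} then 1 else 0)"
  by (simp add: evcoeff_def one_ev.rep_eq gcoeff_one)

lemma evcoeff_of_real: "evcoeff (of_real r) S = (if S = {} then r else 0)"
  by (simp add: of_real_def evcoeff_one)

lemma evcoeff_sum [simp]: "evcoeff (sum f I) S = (\<Sum>i\<in>I. evcoeff (f i) S)"
  by (induction I rule: infinite_finite_induct) auto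

lemma evcoeff_mult: "evcoeff (a * b) S = (\<Sum>T\<in>Pow S. gsign T (S - T) * evcoeff a T * evcoeff b (S - T))"
  by (simp add: evcoeff_def times_ev.rep_eq times_grassmann.rep_eq)

lemma ev_eqI: "(\<And>S. evcoeff a S = evcoeff b S) \<Longrightarrow> a = b"
  unfolding evcoeff_def by (metis gr_inject grassmann_eqI)

lemma gr_simps: "gr (a + b) = gr a + gr b" "gr (a - b) = gr a - gr b" "gr (- a) = - gr a"
  "gr (a * b) = gr a * gr b" "gr (r *\<^sub>R a) = r *\<^sub>R gr a" "gr 0 = 0" "gr 1 = 1"
  by (simp_all add: plus_ev.rep_eq minus_ev.rep_eq uminus_ev.rep_eq scaleR_ev.rep_eq zero_ev.rep_eq
      times_ev.rep_eq one_ev.rep_eq)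

lemma gr_of_real: "gr (of_real r) = of_real r"
  by (simp add: of_real_def gr_simps)

lemma gr_power: "gr (a ^ k) = gr a ^ k"
  by (induction k) (simp_all add: gr_simps)

lemma gr_sum: "gr (sum f I) = (\<Sum>i\<in>I. gr (f i))"
  by (induction I rule: infinite_finite_induct) (simp_all add: gr_simps)

lemma evG_iff: "a \<in> evG G \<longleftrightarrow> (\<forall>S. evcoeff a S \<noteq> 0 \<longrightarrow> S \<subseteq> G)"
  by (simp add: evG_def galg_def evcoeff_def)

lemma evG_mono: "a \<in> evG G \<Longrightarrow> G \<subseteq> G' \<Longrightarrow> a \<in> evG G'"
  by (auto simp: evG_def intro: galg_mono)

lemma evG_simps [intro]:
  "0 \<in> evG G" "1 \<in> evG G" "of_real r \<in> evG G"
  "a \<in> evG G \<Longrightarrow> b \<in> evG G \<Longrightarrow> a + b \<in> evG G"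
  "a \<in> evG G \<Longrightarrow> b \<in> evG G \<Longrightarrow> a - b \<in> evG G"
  "a \<in> evG G \<Longrightarrow> b \<in> evG G \<Longrightarrow> a * b \<in> evG G"
  "a \<in> evG G \<Longrightarrow> - a \<in> evG G"
  "a \<in> evG G \<Longrightarrow> r *\<^sub>R a \<in> evG G"
  by (simp_all add: evG_def gr_simps gr_of_real galg_intros)

lemma evG_power [intro]: "a \<in> evG G \<Longrightarrow> a ^ k \<in> evG G"
  by (induction k) auto

lemma evG_sum [intro]: "(\<And>i. i \<in> I \<Longrightarrow> f i \<in> evG G) \<Longrightarrow> sum f I \<in> evG G"
  by (simp add: evG_def gr_sum galg_sum)

instantiation ev :: (linorder) real_normed_algebra_1
begin

definition norm_ev :: "'a ev \<Rightarrow> real" where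
  "norm_ev a = (\<Sum>S\<in>supp (gr a). \<bar>evcoeff a S\<bar>)"

definition sgn_ev :: "'a ev \<Rightarrow> 'a ev" where "sgn_ev a = a /\<^sub>R norm a"
definition dist_ev :: "'a ev \<Rightarrow> 'a ev \<Rightarrow> real" where "dist_ev a b = norm (a - b)"
definition uniformity_ev :: "('a ev \<times> 'a ev) filter" where
  "uniformity_ev = (INF e\<in>{0<..}. principal {(x, y). dist x y < e})"
definition open_ev :: "'a ev set \<Rightarrow> bool" where
  "open_ev U = (\<forall>x\<in>U. eventually (\<lambda>(x', y). x' = x \<longrightarrow> y \<in> U) uniformity)"

lemma norm_ev_eq:
  assumes "a \<in> evG G" "finite G"
  shows "norm a = (\<Sum>S\<in>Pow G. \<bar>evcoeff a S\<bar>)"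
  unfolding norm_ev_def using assms
  by (intro sum.mono_neutral_left) (auto simp: supp_def evG_iff evcoeff_def)

instance
proof
  fix a b :: "'a ev" and r :: real
  show "dist a b = norm (a - b)" by (rule dist_ev_def)
  show "sgn a = a /\<^sub>R norm a" by (rule sgn_ev_def)
  show "uniformity = (INF e\<in>{0<..}. principal {(x::'a ev, y). dist x y < e})" by (rule uniformity_ev_def)
  show "open U = (\<forall>x\<in>U. eventually (\<lambda>(x', y). x' = x \<longrightarrow> y \<in> U) uniformity)" for U :: "'a ev set"
    by (rule open_ev_def)
  obtain G1 G2 where "finite G1" "a \<in> evG G1" "finite G2" "b \<in> evG G2"
    by (metis Ev_cases evG_def mem_Collect_eq)
  then obtain G where G: "finite G" "a \<in> evG G" "b \<in> evG G"
    by (metis evG_mono finite_Un sup_ge1 sup_ge2)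
  have ne: "norm x = (\<Sum>S\<in>Pow G. \<bar>evcoeff x S\<bar>)" if "x \<in> evG G" for x
    by (rule norm_ev_eq[OF that G(1)])
  show "(norm a = 0) = (a = 0)"
  proof
    assume "norm a = 0"
    then have "\<forall>S\<in>supp (gr a). \<bar>evcoeff a S\<bar> = 0"
      unfolding norm_ev_def by (subst (asm) sum_nonneg_eq_0_iff) (auto simp: finite_supp_gr)
    then show "a = 0"
      by (intro ev_eqI) (auto simp: supp_def evcoeff_def gr_simps)
  qed (simp add: norm_ev_def)
  show "norm (a + b) \<le> norm a + norm b"
    using G by (simp add: ne evG_simps sum.distrib[symmetric]) (intro sum_mono abs_triangle_ineq)
  show "norm (r *\<^sub>R a) = \<bar>r\<bar> * norm a"
    using G by (simp add: ne evG_simps abs_mult sum_distrib_left)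
  show "norm (1 :: 'a ev) = 1"
    by (subst norm_ev_eq[where G = "{}"]) (auto simp: evcoeff_one)
  have fin: "S \<subseteq> G \<Longrightarrow> finite S" for S using G finite_subset by auto
  have "norm (a * b) = (\<Sum>S\<in>Pow G. \<bar>\<Sum>T\<in>Pow S. gsign T (S - T) * evcoeff a T * evcoeff b (S - T)\<bar>)"
    using G by (simp add: ne evG_simps evcoeff_mult)
  also have "\<dots> \<le> (\<Sum>S\<in>Pow G. \<Sum>T\<in>Pow S. \<bar>evcoeff a T\<bar> * \<bar>evcoeff b (S - T)\<bar>)"
    by (intro sum_mono order_trans[OF sum_abs]) (auto simp: abs_mult)
  also have "\<dots> = (\<Sum>(S, T)\<in>Sigma (Pow G) Pow. \<bar>evcoeff a T\<bar> * \<bar>evcoeff b (S - T)\<bar>)"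
    using G fin by (subst sum.Sigma) auto
  \<comment> \<open>A splitting \<open>(S, T)\<close> becomes the disjoint pair
    \<open>(T, S - T)\<close>; extending the sum to all pairs only adds nonnegative terms.\<close>
  also have "\<dots> = (\<Sum>(T, U)\<in>(\<lambda>(S, T). (T, S - T)) ` Sigma (Pow G) Pow. \<bar>evcoeff a T\<bar> * \<bar>evcoeff b U\<bar>)"
    by (subst sum.reindex) (auto simp: inj_on_def split_beta)
  also have "\<dots> \<le> (\<Sum>(T, U)\<in>Pow G \<times> Pow G. \<bar>evcoeff a T\<bar> * \<bar>evcoeff b U\<bar>)"
    using G by (intro sum_mono2) auto
  also have "\<dots> = norm a * norm b"
    using G by (simp add: ne sum_product sum.cartesian_product)
  finally show "norm (a * b) \<le> norm a * norm b" .
qed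

end

lemma evcoeff_le_norm: "\<bar>evcoeff a S\<bar> \<le> norm a"
proof (cases "S \<in> supp (gr a)")
  case True
  then show ?thesis
    unfolding norm_ev_def by (intro member_le_sum) (auto simp: finite_supp_gr)
next
  case False
  then show ?thesis by (simp add: supp_def evcoeff_def[symmetric])
qed

lemma bounded_linear_evcoeff: "bounded_linear (\<lambda>a. evcoeff a S)"
  by (rule bounded_linear_intro[where K = 1]) (auto simp: evcoeff_le_norm)

section \<open>Bodies, nilpotency and Taylor series\<close>

definition evbody :: "'g::linorder ev \<Rightarrow> real" where
  "evbody a = evcoeff a {}"

definition evsoul :: "'g::linorder ev \<Rightarrow> 'g ev" where
  "evsoul a = a - of_real (evbody a)"

lemma evbody_simps [simp]:
  "evbody (a + b) = evbody a + evbody b" "evbody (a - b) = evbody a - evbody b"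
  "evbody (- a) = - evbody a" "evbody (r *\<^sub>R a) = r * evbody a" "evbody 0 = 0" "evbody 1 = 1"
  "evbody (of_real r) = r" "evbody (a * b) = evbody a * evbody b"
  by (simp_all add: evbody_def evcoeff_one evcoeff_of_real evcoeff_mult)

lemma evbody_power [simp]: "evbody (a ^ k) = evbody a ^ k"
  by (induction k) simp_all

lemma evbody_sum [simp]: "evbody (sum f I) = (\<Sum>i\<in>I. evbody (f i))"
  by (simp add: evbody_def)

lemma evbody_numeral [simp]: "evbody (numeral n) = numeral n"
  by (metis evbody_simps(7) of_real_numeral)

lemma body_gr: "body (gr a) = evbody a"
  by (simp add: body_def evbody_def evcoeff_def)

lemma gr_evsoul: "gr (evsoul a) = soul (gr a)"
  by (simp add: evsoul_def soul_def gr_simps gr_of_real body_gr)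

lemma evbody_evsoul [simp]: "evbody (evsoul a) = 0"
  by (simp add: evsoul_def)

lemma evsoul_simps: "evsoul (a + b) = evsoul a + evsoul b"
  "evsoul (r *\<^sub>R a) = r *\<^sub>R evsoul a" "evsoul (of_real r) = 0" "evsoul (- a) = - evsoul a"
  "evsoul (evsoul a) = evsoul a"
  by (simp_all add: evsoul_def scaleR_conv_of_real right_diff_distrib)

lemma evG_soul [intro]: "a \<in> evG G \<Longrightarrow> evsoul a \<in> evG G"
  by (auto simp: evsoul_def)

lemma abs_evbody_le: "\<bar>evbody a\<bar> \<le> norm a"
  by (simp add: evbody_def evcoeff_le_norm)

lemma norm_evsoul: "norm (evsoul a) \<le> 2 * norm a"
  using norm_triangle_ineq4[of a "of_real (evbody a)"] abs_evbody_le[of a] by (simp add: evsoul_def)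

section \<open>The filtration by degree and nilpotency\<close>

definition order_ge :: "nat \<Rightarrow> 'g::linorder ev \<Rightarrow> bool" where
  "order_ge k a \<longleftrightarrow> (\<forall>S. evcoeff a S \<noteq> 0 \<longrightarrow> k \<le> card S)"

lemma order_ge_mult:
  assumes "order_ge k a" "order_ge l b"
  shows "order_ge (k + l) (a * b)"
  unfolding order_ge_def
proof (intro allI impI)
  fix S assume "evcoeff (a * b) S \<noteq> 0"
  then have "gcoeff (gr a * gr b) S \<noteq> 0" by (simp add: evcoeff_def gr_simps)
  then show "k + l \<le> card S"
    by (elim gcoeff_mult_nonzeroE)
      (use assms in \<open>auto simp: order_ge_def evcoeff_def card_split intro!: add_mono\<close>)
qed

lemma order_ge_0: "order_ge 0 a"
  by (simp add: order_ge_def)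

lemma order_ge_1: "evbody a = 0 \<Longrightarrow> order_ge 1 a"
  unfolding order_ge_def evbody_def evcoeff_def
  by (metis Suc_leI card_gt_0_iff gcoeff_infinite One_nat_def)

lemma order_ge_power: "evbody a = 0 \<Longrightarrow> order_ge k (a ^ k)"
  by (induction k) (use order_ge_0 order_ge_mult[OF order_ge_1] in auto)

text \<open>No monomial in the generators \<open>G\<close> has degree above
  \<open>card G\<close>.\<close>

lemma order_ge_vanish:
  assumes "order_ge k a" "a \<in> evG G" "finite G" "card G < k"
  shows "a = 0"
proof (rule ev_eqI)
  fix S
  have "evcoeff a S \<noteq> 0 \<Longrightarrow> k \<le> card S \<and> S \<subseteq> G"
    using assms by (auto simp: order_ge_def evG_iff)
  then show "evcoeff a S = evcoeff 0 S"
    using card_mono[OF assms(3), of S] assms(4) by (cases "evcoeff a S = 0") auto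
qed

lemma nilpotent_mult:
  assumes "evbody x = 0" "evbody y = 0" "x \<in> evG G" "y \<in> evG G" "finite G" "card G < i + l"
  shows "x ^ i * y ^ l = 0"
  by (rule order_ge_vanish[OF order_ge_mult[OF order_ge_power order_ge_power]]) (use assms in auto)

lemma nilpotent_power:
  assumes "evbody x = 0" "x \<in> evG G" "finite G" "card G < i"
  shows "x ^ i = 0"
  by (rule order_ge_vanish[OF order_ge_power]) (use assms in auto)

text \<open>\<open>f k\<close> plays the role of the \<open>k\<close>-th Taylor coefficient \<open>f\<^sup>(\<^sup>k\<^sup>) / k!\<close>.\<close>

definition tser :: "(nat \<Rightarrow> real \<Rightarrow> real) \<Rightarrow> 'g::linorder ev \<Rightarrow> 'g ev" where
  "tser f a = (\<Sum>k | evsoul a ^ k \<noteq> 0. f k (evbody a) *\<^sub>R evsoul a ^ k)"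

lemma tser_eq:
  assumes "a \<in> evG G" "finite G"
  shows "tser f a = (\<Sum>k\<le>card G. f k (evbody a) *\<^sub>R evsoul a ^ k)"
  unfolding tser_def
proof (rule sum.mono_neutral_left)
  show "{k. evsoul a ^ k \<noteq> 0} \<subseteq> {..card G}"
    using nilpotent_power[OF evbody_evsoul evG_soul[OF assms(1)] assms(2)] by (force simp: not_le[symmetric])
qed auto

lemma tser_evG [intro]: "a \<in> evG G \<Longrightarrow> finite G \<Longrightarrow> tser f a \<in> evG G"
  by (subst tser_eq) auto

lemma evbody_tser [simp]: "evbody (tser f a) = f 0 (evbody a)"
proof -
  obtain G where G: "finite G" "a \<in> evG G" by (metis Ev_cases evG_def mem_Collect_eq)
  have "evbody (tser f a) = (\<Sum>k\<le>card G. if k = 0 then f k (evbody a) else 0)"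
    using G by (subst tser_eq) (auto intro!: sum.cong)
  then show ?thesis by simp
qed

lemma tser_of_real: "tser f (of_real r) = of_real (f 0 r)"
  by (subst tser_eq[where G = "{}"]) (auto simp: evsoul_simps scaleR_conv_of_real)

text \<open>With \<open>f k\<close> in the place of the \<open>k\<close>-th derivative over
  \<open>k!\<close>, differentiating a Taylor coefficient gives \<open>k + 1\<close> times the next
  one.\<close>

definition taylor_on :: "real set \<Rightarrow> (nat \<Rightarrow> real \<Rightarrow> real) \<Rightarrow> bool" where
  "taylor_on U f \<longleftrightarrow> (\<forall>k. \<forall>x\<in>U. (f k has_real_derivative real (Suc k) * f (Suc k) x) (at x))"

lemma has_vector_derivative_ev_power:
  fixes c :: "real \<Rightarrow> 'g::linorder ev"
  assumes "(c has_vector_derivative c') (at t)"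
  shows "((\<lambda>t. c t ^ k) has_vector_derivative of_nat k * c t ^ (k - 1) * c') (at t)"
proof (induction k)
  case (Suc k)
  have "((\<lambda>t. c t * c t ^ k) has_vector_derivative c t * (of_nat k * c t ^ (k - 1) * c') + c' * c t ^ k) (at t)"
    by (rule has_vector_derivative_mult[OF assms Suc.IH])
  also have "c t * (of_nat k * c t ^ (k - 1) * c') + c' * c t ^ k = of_nat (Suc k) * c t ^ (Suc k - 1) * c'"
    by (cases k) (simp_all add: algebra_simps)
  finally show ?case by simp
qed simp

lemma vector_derivative_coeff:
  assumes "(c has_vector_derivative c') (at t within X)"
  shows "((\<lambda>t. evcoeff (c t) S) has_real_derivative evcoeff c' S) (at t within X)"
  using bounded_linear.has_vector_derivative[OF bounded_linear_evcoeff assms]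
  by (simp add: has_real_derivative_iff_has_vector_derivative)

lemma vector_derivative_body:
  "(c has_vector_derivative c') (at t within X) \<Longrightarrow>
    ((\<lambda>t. evbody (c t)) has_real_derivative evbody c') (at t within X)"
  unfolding evbody_def by (rule vector_derivative_coeff)

text \<open>The subalgebra is cut out by the vanishing of coefficients, and a coefficient that
  vanishes along the curve has zero derivative.\<close>

lemma vector_derivative_evG:
  assumes "(c has_vector_derivative c') (at t)" "\<And>t. c t \<in> evG G"
  shows "c' \<in> evG G"
  unfolding evG_iff
proof (intro allI impI, rule ccontr)
  fix S assume *: "evcoeff c' S \<noteq> 0" "\<not> S \<subseteq> G"
  then have "evcoeff (c t) S = 0" for t
    using assms(2)[of t] by (auto simp: evG_iff)
  then have "((\<lambda>t. evcoeff (c t) S) has_real_derivative 0) (at t)" by simp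
  with vector_derivative_coeff[OF assms(1)] have "evcoeff c' S = 0"
    by (rule DERIV_unique)
  with * show False by simp
qed

lemma has_vector_derivative_of_real_ev:
  assumes "(f has_real_derivative f') (at t)"
  shows "((\<lambda>t. of_real (f t) :: 'g::linorder ev) has_vector_derivative of_real f') (at t)"
  using bounded_linear.has_vector_derivative[OF bounded_linear_of_real] assms
  by (simp add: has_real_derivative_iff_has_vector_derivative)

text \<open>Differentiating the Taylor sum gives one part from the coefficients, carrying the body
  of \<open>c'\<close>, and one from the powers, carrying its soul. After an index shift both have
  the same coefficients and combine to \<open>c'\<close>.\<close>

lemma tser_chain:
  assumes f: "taylor_on U f" and c: "(c has_vector_derivative c') (at t)"
    and G: "finite G" "\<And>t. c t \<in> evG G" and U: "evbody (c t) \<in> U"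
  shows "((\<lambda>t. tser f (c t)) has_vector_derivative tser (\<lambda>k x. real (Suc k) * f (Suc k) x) (c t) * c') (at t)"
proof -
  define s where "s = (\<lambda>t. evsoul (c t))"
  have c': "c' \<in> evG G" by (rule vector_derivative_evG[OF c G(2)])
  have s: "(s has_vector_derivative evsoul c') (at t)"
    unfolding s_def evsoul_def
    by (intro has_vector_derivative_diff c has_vector_derivative_of_real_ev vector_derivative_body)
  have sG: "s t \<in> evG G" "evbody (s t) = 0" using G by (auto simp: s_def)
  \<comment> \<open>The shifted sum stops one power short; this vanishing product supplies the
    missing top term.\<close>
  have top: "s t ^ card G * evsoul c' = 0"
    using nilpotent_mult[of "s t" "evsoul c'" G "card G" 1] sG c' G by auto
  let ?n = "card G" and ?b = "evbody (c t)" and ?b' = "evbody c'"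
  have "((\<lambda>t. \<Sum>k\<le>?n. f k (evbody (c t)) *\<^sub>R s t ^ k) has_vector_derivative
      (\<Sum>k\<le>?n. f k ?b *\<^sub>R (of_nat k * s t ^ (k - 1) * evsoul c') + (real (Suc k) * f (Suc k) ?b * ?b') *\<^sub>R s t ^ k)) (at t)"
  proof (intro has_vector_derivative_sum has_vector_derivative_scaleR has_vector_derivative_ev_power s)
    fix k
    have "(f k has_real_derivative real (Suc k) * f (Suc k) ?b) (at ?b)"
      using f U by (simp add: taylor_on_def)
    from DERIV_chain2[OF this vector_derivative_body[OF c]]
    show "((\<lambda>t. f k (evbody (c t))) has_real_derivative real (Suc k) * f (Suc k) ?b * ?b') (at t)" .
  qed
  also have "(\<Sum>k\<le>?n. f k ?b *\<^sub>R (of_nat k * s t ^ (k - 1) * evsoul c') + (real (Suc k) * f (Suc k) ?b * ?b') *\<^sub>R s t ^ k)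
      = (\<Sum>k\<le>?n. (f k ?b * real k) *\<^sub>R (s t ^ (k - 1) * evsoul c')) + (\<Sum>k\<le>?n. (real (Suc k) * f (Suc k) ?b) *\<^sub>R (s t ^ k * of_real ?b'))"
    unfolding sum.distrib[symmetric]
    by (rule sum.cong) (simp_all add: scaleR_conv_of_real mult_ac)
  also have "(\<Sum>k\<le>?n. (f k ?b * real k) *\<^sub>R (s t ^ (k - 1) * evsoul c'))
      = (\<Sum>k<?n. (f (Suc k) ?b * real (Suc k)) *\<^sub>R (s t ^ k * evsoul c'))"
    by (simp add: lessThan_Suc_atMost[symmetric] sum.lessThan_Suc_shift del: sum.lessThan_Suc)
  also have "\<dots> = (\<Sum>k\<le>?n. (real (Suc k) * f (Suc k) ?b) *\<^sub>R (s t ^ k * evsoul c'))"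
    by (simp add: lessThan_Suc_atMost[symmetric] top top[unfolded mult.commute[of "s t ^ card G"]] mult_ac)
  also have "\<dots> + (\<Sum>k\<le>?n. (real (Suc k) * f (Suc k) ?b) *\<^sub>R (s t ^ k * of_real ?b'))
      = (\<Sum>k\<le>?n. (real (Suc k) * f (Suc k) ?b) *\<^sub>R s t ^ k) * c'"
    unfolding sum.distrib[symmetric] sum_distrib_right
  proof (rule sum.cong)
    fix k
    have "s t ^ k * evsoul c' + s t ^ k * of_real ?b' = s t ^ k * c'"
      by (simp add: evsoul_def right_diff_distrib)
    then show "(real (Suc k) * f (Suc k) ?b) *\<^sub>R (s t ^ k * evsoul c') + (real (Suc k) * f (Suc k) ?b) *\<^sub>R (s t ^ k * of_real ?b')
        = (real (Suc k) * f (Suc k) ?b) *\<^sub>R s t ^ k * c'"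
      by (simp only: scaleR_add_right[symmetric] mult_scaleR_left)
  qed simp
  also have "\<dots> = tser (\<lambda>k x. real (Suc k) * f (Suc k) x) (c t) * c'"
    using G by (subst tser_eq) (auto simp: s_def)
  finally show ?thesis
    using tser_eq[OF G(2,1), of f] by (simp add: s_def)
qed

text \<open>No remainder appears: the terms of the square beyond the triangle vanish, in the
  applications by nilpotency.\<close>

lemma cauchy_product_ev:
  fixes A B :: "nat \<Rightarrow> 'g::linorder ev"
  assumes "\<And>i j. n < i + j \<Longrightarrow> A i * B j = 0"
  shows "(\<Sum>i\<le>n. A i) * (\<Sum>j\<le>n. B j) = (\<Sum>m\<le>n. \<Sum>i\<le>m. A i * B (m - i))"
proof -
  have "(\<Sum>i\<le>n. A i) * (\<Sum>j\<le>n. B j) = (\<Sum>(i, j)\<in>{..n} \<times> {..n}. A i * B j)"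
    by (simp add: sum_product sum.cartesian_product)
  also have "\<dots> = (\<Sum>(i, j)\<in>{(i, j). i + j \<le> n}. A i * B j)"
    using assms by (intro sum.mono_neutral_right) (auto, meson not_le)
  also have "\<dots> = (\<Sum>m\<le>n. \<Sum>i\<le>m. A i * B (m - i))"
    using sum.triangle_reindex_eq[of "\<lambda>i j. A i * B j" n] by simp
  finally show ?thesis .
qed

section \<open>Exponential and real powers of even elements\<close>

definition evexp :: "'g::linorder ev \<Rightarrow> 'g ev" where
  "evexp = tser (\<lambda>k x. exp x / fact k)"

text \<open>The coefficients are those of the binomial series about the body, so this is the real
  power of an element with positive body.\<close>

definition evpow :: "real \<Rightarrow> 'g::linorder ev \<Rightarrow> 'g ev" where
  "evpow \<alpha> = tser (\<lambda>k x. (\<alpha> gchoose k) * x powr (\<alpha> - real k))"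

lemma gr_evexp: "gr (evexp a) = gext exp (gr a)"
proof -
  have *: "(deriv ^^ k) (exp :: real \<Rightarrow> real) = exp" for k
  proof (induction k)
    case (Suc k)
    have "deriv (exp :: real \<Rightarrow> real) = exp"
      by (rule ext, rule DERIV_imp_deriv[OF DERIV_exp])
    with Suc show ?case by simp
  qed simp
  have "evsoul a ^ k \<noteq> 0 \<longleftrightarrow> soul (gr a) ^ k \<noteq> 0" for k
    by (metis gr_evsoul gr_inject gr_power gr_simps(6))
  then show ?thesis
    by (simp add: evexp_def tser_def gext_def gr_sum gr_simps gr_power gr_evsoul body_gr *)
qed

lemma evbody_evexp [simp]: "evbody (evexp a) = exp (evbody a)"
  by (simp add: evexp_def)

lemma evbody_evpow: "evbody (evpow \<alpha> a) = evbody a powr \<alpha>"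
  by (simp add: evpow_def)

lemma common_evG:
  obtains G where "finite G" "a \<in> evG G" "b \<in> evG G"
proof -
  obtain G1 G2 where "finite G1" "a \<in> evG G1" "finite G2" "b \<in> evG G2"
    by (metis Ev_cases evG_def mem_Collect_eq)
  then show ?thesis
    by (intro that[of "G1 \<union> G2"]) (auto intro: evG_mono)
qed

lemma of_nat_scaleR: "of_nat n * a = real n *\<^sub>R (a :: 'g::linorder ev)"
  by (simp add: scaleR_conv_of_real)

lemma evexp_add: "evexp (a + b) = evexp a * evexp b"
proof -
  obtain G where G: "finite G" "a \<in> evG G" "b \<in> evG G" by (rule common_evG)
  let ?A = "\<lambda>k. (1 / fact k) *\<^sub>R evsoul a ^ k" and ?B = "\<lambda>k. (1 / fact k) *\<^sub>R evsoul b ^ k"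
  have e: "evexp c = exp (evbody c) *\<^sub>R (\<Sum>k\<le>card G. (1 / fact k) *\<^sub>R evsoul c ^ k)" if "c \<in> evG G" for c
    unfolding evexp_def using tser_eq[OF that G(1)] by (simp add: scaleR_sum_right)
  have "(\<Sum>k\<le>card G. ?A k) * (\<Sum>k\<le>card G. ?B k) = (\<Sum>m\<le>card G. \<Sum>i\<le>m. ?A i * ?B (m - i))"
    using G by (intro cauchy_product_ev) (auto intro!: nilpotent_mult)
  also have "\<dots> = (\<Sum>m\<le>card G. (1 / fact m) *\<^sub>R (evsoul a + evsoul b) ^ m)"
  proof (rule sum.cong)
    fix m
    have "(1 / fact m) *\<^sub>R (evsoul a + evsoul b) ^ m =
        (\<Sum>i\<le>m. (real (m choose i) / fact m) *\<^sub>R (evsoul a ^ i * evsoul b ^ (m - i)))"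
      unfolding binomial_ring scaleR_sum_right
      by (intro sum.cong) (simp_all add: of_nat_scaleR mult.assoc)
    also have "\<dots> = (\<Sum>i\<le>m. ?A i * ?B (m - i))"
      by (intro sum.cong) (auto simp: binomial_fact)
    finally show "(\<Sum>i\<le>m. ?A i * ?B (m - i)) = (1 / fact m) *\<^sub>R (evsoul a + evsoul b) ^ m" ..
  qed simp
  finally show ?thesis
    using G by (simp add: e evG_simps evsoul_simps exp_add)
qed

lemma evexp_of_real: "evexp (of_real r) = of_real (exp r)"
  by (simp add: evexp_def tser_of_real)

lemma evexp_0 [simp]: "evexp 0 = 1"
  by (subst of_real_0[symmetric], subst evexp_of_real) simp

text \<open>Vandermonde's identity for generalized binomial coefficients, applied degree by
  degree.\<close>

lemma evpow_add:
  assumes "evbody a > 0"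
  shows "evpow \<alpha> a * evpow \<beta> a = evpow (\<alpha> + \<beta>) a"
proof -
  obtain G where G: "finite G" "a \<in> evG G" by (rule common_evG)
  define x where "x = evbody a"
  have x: "x > 0" using assms by (simp add: x_def)
  let ?A = "\<lambda>\<alpha> k. ((\<alpha> gchoose k) * x powr (\<alpha> - real k)) *\<^sub>R evsoul a ^ k"
  have e: "evpow \<alpha> a = (\<Sum>k\<le>card G. ?A \<alpha> k)" for \<alpha>
    unfolding evpow_def using tser_eq[OF G(2,1)] by (simp add: x_def)
  have "evpow \<alpha> a * evpow \<beta> a = (\<Sum>m\<le>card G. \<Sum>i\<le>m. ?A \<alpha> i * ?A \<beta> (m - i))"
    unfolding e using G by (intro cauchy_product_ev) (auto intro!: nilpotent_mult)
  also have "\<dots> = (\<Sum>m\<le>card G. ?A (\<alpha> + \<beta>) m)"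
  proof (rule sum.cong)
    fix m
    have "(\<Sum>i\<le>m. ?A \<alpha> i * ?A \<beta> (m - i)) =
       (\<Sum>i\<le>m. ((\<alpha> gchoose i) * (\<beta> gchoose (m - i)) * x powr (\<alpha> + \<beta> - real m)) *\<^sub>R evsoul a ^ m)"
    proof (rule sum.cong)
      fix i assume i: "i \<in> {..m}"
      then have "x powr (\<alpha> - real i) * x powr (\<beta> - real (m - i)) = x powr (\<alpha> + \<beta> - real m)"
        by (simp add: powr_add[symmetric] of_nat_diff algebra_simps)
      moreover have "evsoul a ^ i * evsoul a ^ (m - i) = evsoul a ^ m"
        using i by (simp add: power_add[symmetric])
      ultimately show "?A \<alpha> i * ?A \<beta> (m - i) = ((\<alpha> gchoose i) * (\<beta> gchoose (m - i)) * x powr (\<alpha> + \<beta> - real m)) *\<^sub>R evsoul a ^ m"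
        by (simp add: mult_ac)
    qed simp
    also have "\<dots> = ?A (\<alpha> + \<beta>) m"
      using gbinomial_Vandermonde[of \<alpha> \<beta> m]
      by (simp add: scaleR_sum_left[symmetric] sum_distrib_right[symmetric] atMost_atLeast0)
    finally show "(\<Sum>i\<le>m. ?A \<alpha> i * ?A \<beta> (m - i)) = ?A (\<alpha> + \<beta>) m" .
  qed simp
  finally show ?thesis by (simp add: e)
qed

lemma evpow_0 [simp]: "evbody a > 0 \<Longrightarrow> evpow 0 a = 1"
proof -
  assume a: "evbody a > 0"
  obtain G where G: "finite G" "a \<in> evG G" by (rule common_evG)
  have "evpow 0 a = (\<Sum>k\<le>card G. if k = 0 then 1 else 0)"
    unfolding evpow_def tser_eq[OF G(2,1)] using a
    by (intro sum.cong) (auto simp: gbinomial_0 gr0_conv_Suc)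
  then show ?thesis by simp
qed

lemma evpow_1 [simp]: "evbody a > 0 \<Longrightarrow> evpow 1 a = a"
proof -
  assume a: "evbody a > 0"
  obtain G where G: "finite G" "a \<in> evG G" by (rule common_evG)
  \<comment> \<open>Enlarging \<open>G\<close> makes its cardinality positive, so that the Taylor
    sum reaches the linear term.\<close>
  have G': "finite (insert undefined G)" "a \<in> evG (insert undefined G)"
    using G evG_mono[OF G(2)] by auto
  obtain n where n: "card (insert undefined G) = Suc n"
    using G by (metis card_Suc_Diff1 finite_insert insertI1)
  have g: "(1::real) gchoose k = (if k \<le> 1 then 1 else 0)" for k
  proof -
    have "(1::real) gchoose k = real (1 choose k)"
      using binomial_gbinomial[of 1 k, where 'a = real] by simp
    then show ?thesis by (cases "k = 0"; cases "k = 1") (simp_all add: binomial_eq_0)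
  qed
  have "evpow 1 a = (\<Sum>k\<le>Suc n. if k \<in> {0, 1} then (if k = 0 then of_real (evbody a) else evsoul a) else 0)"
    unfolding evpow_def tser_eq[OF G'(2,1)] n using a
    by (intro sum.cong) (auto simp: g scaleR_conv_of_real)
  also have "\<dots> = (\<Sum>k\<in>{0, 1::nat}. if k = 0 then of_real (evbody a) else evsoul a)"
    by (rule sum.mono_neutral_cong_right) auto
  finally show ?thesis by (simp add: evsoul_def)
qed

lemma evpow_evG [intro]: "a \<in> evG G \<Longrightarrow> finite G \<Longrightarrow> evpow \<alpha> a \<in> evG G"
  by (auto simp: evpow_def)

lemma evexp_evG [intro]: "a \<in> evG G \<Longrightarrow> finite G \<Longrightarrow> evexp a \<in> evG G"
  by (auto simp: evexp_def)

lemma ev_unit_cancel: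
  assumes "evbody a > 0" "a * b = 0"
  shows "b = 0"
proof -
  have "evpow (-1) a * a = 1"
    using evpow_add[of a "-1" 1] assms by simp
  then show ?thesis
    by (metis assms(2) mult.assoc mult.left_neutral mult_zero_right)
qed

text \<open>The sum \<open>a + b\<close> has positive body and can be cancelled from
  \<open>(a + b) * (a - b) = 0\<close>. Identities between square roots are checked by squaring from
  here on.\<close>

lemma ev_square_unique:
  assumes "a ^ 2 = b ^ 2" "evbody a > 0" "evbody b > 0"
  shows "a = b"
proof -
  have "(a + b) * (a - b) = 0"
    using assms(1) by (simp add: power2_eq_square algebra_simps)
  then have "a - b = 0" by (rule ev_unit_cancel[rotated]) (use assms in auto)
  then show ?thesis by simp
qed

lemma evpow_half_square:
  assumes "evbody a > 0"
  shows "evpow (1/2) a ^ 2 = a"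
  using evpow_add[OF assms, of "1/2" "1/2"] assms by (simp add: power2_eq_square)

lemma evpow_half_of_square:
  assumes "evbody a > 0"
  shows "evpow (1/2) (a ^ 2) = a"
proof (rule ev_square_unique)
  show "evpow (1/2) (a ^ 2) ^ 2 = a ^ 2"
    using assms by (intro evpow_half_square) simp
qed (use assms in \<open>auto simp: evbody_evpow\<close>)

lemma gchoose_Suc_mult: "real (Suc k) * (\<alpha> gchoose Suc k) = \<alpha> * ((\<alpha> - 1) gchoose k)"
  by (rule gbinomial_absorption)

lemma evpow_chain:
  assumes c: "(c has_vector_derivative c') (at t)" "finite G" "\<And>t. c t \<in> evG G" "evbody (c t) > 0"
  shows "((\<lambda>t. evpow \<alpha> (c t)) has_vector_derivative \<alpha> *\<^sub>R evpow (\<alpha> - 1) (c t) * c') (at t)"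
proof -
  let ?f = "\<lambda>k x. (\<alpha> gchoose k) * x powr (\<alpha> - real k)"
  have "taylor_on {0<..} ?f"
    unfolding taylor_on_def
  proof (intro allI ballI)
    fix k and x :: real assume x: "x \<in> {0<..}"
    have "(?f k has_real_derivative (\<alpha> gchoose k) * ((\<alpha> - real k) * x powr (\<alpha> - real k - 1))) (at x)"
      using x by (auto intro!: derivative_eq_intros)
    also have "(\<alpha> gchoose k) * ((\<alpha> - real k) * x powr (\<alpha> - real k - 1)) =
        ((\<alpha> - real k) * (\<alpha> gchoose k)) * x powr (\<alpha> - real (Suc k))"
      by (simp add: mult_ac diff_diff_add add.commute)
    also have "\<dots> = real (Suc k) * ?f (Suc k) x"
      by (simp only: gbinomial_absorb_comp gchoose_Suc_mult[symmetric] mult.assoc)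
    finally show "(?f k has_real_derivative real (Suc k) * ?f (Suc k) x) (at x)" .
  qed
  from tser_chain[OF this c(1-3)] c(4)
  have "((\<lambda>t. evpow \<alpha> (c t)) has_vector_derivative tser (\<lambda>k x. real (Suc k) * ?f (Suc k) x) (c t) * c') (at t)"
    by (simp add: evpow_def)
  moreover have "tser (\<lambda>k x. real (Suc k) * ?f (Suc k) x) a = \<alpha> *\<^sub>R evpow (\<alpha> - 1) a" for a :: "'a ev"
  proof -
    have "real (Suc k) * ?f (Suc k) x = \<alpha> * (((\<alpha> - 1) gchoose k) * x powr (\<alpha> - 1 - real k))" for k x
    proof -
      have "\<alpha> - real (Suc k) = \<alpha> - 1 - real k" by simp
      then show ?thesis by (simp only: mult.assoc[symmetric] gchoose_Suc_mult)
    qed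
    then show ?thesis
      unfolding evpow_def tser_def by (simp only: scaleR_sum_right scaleR_scaleR)
  qed
  ultimately show ?thesis by simp
qed

lemma evexp_chain:
  assumes c: "(c has_vector_derivative c') (at t)" "finite G" "\<And>t. c t \<in> evG G"
  shows "((\<lambda>t. evexp (c t)) has_vector_derivative evexp (c t) * c') (at t)"
proof -
  let ?f = "\<lambda>k x :: real. exp x / fact k"
  have e: "real (Suc k) * ?f (Suc k) x = ?f k x" for k x
    by (simp add: field_simps del: of_nat_Suc)
  have "taylor_on UNIV ?f"
    unfolding taylor_on_def e by (auto intro!: derivative_eq_intros)
  from tser_chain[OF this c] show ?thesis
    unfolding e by (simp add: evexp_def)
qed

section \<open>Growth bounds and measurability\<close>

lemma norm_tser_le:
  assumes "a \<in> evG G" "finite G"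
  shows "norm (tser f a) \<le> (\<Sum>k\<le>card G. \<bar>f k (evbody a)\<bar>) * (1 + 2 * norm a) ^ card G"
proof -
  have "norm (tser f a) \<le> (\<Sum>k\<le>card G. \<bar>f k (evbody a)\<bar> * norm (evsoul a) ^ k)"
    unfolding tser_eq[OF assms]
    by (intro order_trans[OF norm_sum] sum_mono) (auto intro!: mult_left_mono norm_power_ineq)
  also have "\<dots> \<le> (\<Sum>k\<le>card G. \<bar>f k (evbody a)\<bar> * (1 + 2 * norm a) ^ card G)"
  proof (intro sum_mono mult_left_mono)
    fix k assume k: "k \<in> {..card G}"
    have "norm (evsoul a) ^ k \<le> (1 + 2 * norm a) ^ k"
      using norm_evsoul[of a] by (intro power_mono) auto
    also have "\<dots> \<le> (1 + 2 * norm a) ^ card G"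
      using k by (intro power_increasing) auto
    finally show "norm (evsoul a) ^ k \<le> (1 + 2 * norm a) ^ card G" .
  qed auto
  finally show ?thesis by (simp add: sum_distrib_right)
qed

lemma norm_evexp_le:
  assumes "a \<in> evG G" "finite G"
  shows "norm (evexp a) \<le> exp (evbody a) * (real (card G) + 1) * (1 + 2 * norm a) ^ card G"
proof -
  have "(\<Sum>k\<le>card G. \<bar>exp (evbody a) / fact k\<bar>) \<le> (\<Sum>k\<le>card G. exp (evbody a))"
    by (intro sum_mono) (simp add: divide_le_eq mult_le_cancel_left1)
  then show ?thesis
    unfolding evexp_def
    by (intro order_trans[OF norm_tser_le[OF assms]] mult_right_mono) (auto simp: algebra_simps)
qed

text \<open>With \<open>\<alpha> \<le> 1\<close> every exponent \<open>\<alpha> - k\<close> is at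
  most one, so on bodies above \<open>\<delta>\<close> each Taylor coefficient grows at most
  linearly.\<close>

lemma norm_evpow_le:
  assumes "finite G" "\<delta> > 0" "\<alpha> \<le> 1"
  shows "\<exists>C\<ge>0. \<forall>a\<in>evG G. evbody a \<ge> \<delta> \<longrightarrow> norm (evpow \<alpha> a) \<le> C * (1 + 2 * norm a) ^ Suc (card G)"
proof -
  have powr: "x powr e \<le> (1 + x) * (1 + \<delta> powr e)" if "x \<ge> \<delta>" "e \<le> 1" for x e :: real
  proof (cases "x \<ge> 1")
    case True
    then have "x powr e \<le> x powr 1" using that by (intro powr_mono) auto
    then have "x powr e \<le> 1 + x" using True by simp
    also have "\<dots> \<le> (1 + x) * (1 + \<delta> powr e)" using True by (simp add: mult_le_cancel_left1)
    finally show ?thesis .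
  next
    case False
    have "x powr e \<le> 1 + \<delta> powr e"
    proof (cases "e \<ge> 0")
      case True
      then have "x powr e \<le> 1 powr e" using False that assms by (intro powr_mono2) auto
      then show ?thesis by (simp add: add_increasing2)
    next
      case e: False
      then have "x powr e \<le> \<delta> powr e" using that assms by (intro powr_mono2') auto
      then show ?thesis by simp
    qed
    also have "\<dots> \<le> (1 + x) * (1 + \<delta> powr e)"
      using that assms powr_ge_zero[of \<delta> e] mult_right_mono[of 1 "1 + x" "1 + \<delta> powr e"] by simp
    finally show ?thesis .
  qed
  define C where "C = (\<Sum>k\<le>card G. \<bar>\<alpha> gchoose k\<bar> * (1 + \<delta> powr (\<alpha> - real k)))"
  have "C \<ge> 0" unfolding C_def by (intro sum_nonneg) (auto intro: add_nonneg_nonneg)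
  moreover have "norm (evpow \<alpha> a) \<le> C * (1 + 2 * norm a) ^ Suc (card G)" if a: "a \<in> evG G" "evbody a \<ge> \<delta>" for a :: "'a ev"
  proof -
    have "(\<Sum>k\<le>card G. \<bar>(\<alpha> gchoose k) * evbody a powr (\<alpha> - real k)\<bar>)
        \<le> (\<Sum>k\<le>card G. \<bar>\<alpha> gchoose k\<bar> * ((1 + evbody a) * (1 + \<delta> powr (\<alpha> - real k))))"
      using a assms unfolding abs_mult by (intro sum_mono mult_left_mono) (auto intro!: powr)
    also have "\<dots> = C * (1 + evbody a)"
      unfolding C_def sum_distrib_right by (intro sum.cong) auto
    also have "\<dots> \<le> C * (1 + 2 * norm a)"
      using abs_evbody_le[of a] \<open>C \<ge> 0\<close> by (intro mult_left_mono) auto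
    finally have "norm (evpow \<alpha> a) \<le> C * (1 + 2 * norm a) * (1 + 2 * norm a) ^ card G"
      unfolding evpow_def
      by (intro order_trans[OF norm_tser_le[OF a(1) assms(1)]] mult_right_mono) auto
    then show ?thesis by (simp add: mult_ac)
  qed
  ultimately show ?thesis by blast
qed

section \<open>Measurability, coefficient by coefficient\<close>

definition evm :: "'x measure \<Rightarrow> ('x \<Rightarrow> 'g::linorder ev) \<Rightarrow> bool" where
  "evm M f \<longleftrightarrow> (\<forall>S. (\<lambda>x. evcoeff (f x) S) \<in> borel_measurable M)"

lemma evmD: "evm M f \<Longrightarrow> (\<lambda>x. evcoeff (f x) S) \<in> borel_measurable M"
  by (simp add: evm_def)

lemma evm_const [intro, simp]: "evm M (\<lambda>_. a)"
  by (simp add: evm_def)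

lemma evm_of_real [intro]: "f \<in> borel_measurable M \<Longrightarrow> evm M (\<lambda>x. of_real (f x))"
  unfolding evm_def evcoeff_of_real by simp

lemma evm_add [intro]: "evm M f \<Longrightarrow> evm M g \<Longrightarrow> evm M (\<lambda>x. f x + g x)"
  unfolding evm_def evcoeff_simps evcoeff_sum by (intro allI borel_measurable_add) blast+

lemma evm_diff [intro]: "evm M f \<Longrightarrow> evm M g \<Longrightarrow> evm M (\<lambda>x. f x - g x)"
  unfolding evm_def evcoeff_simps evcoeff_sum by (intro allI borel_measurable_diff) blast+

lemma evm_minus [intro]: "evm M f \<Longrightarrow> evm M (\<lambda>x. - f x)"
  unfolding evm_def evcoeff_simps evcoeff_sum by (intro allI borel_measurable_uminus) blast+

lemma evm_mult [intro]: "evm M f \<Longrightarrow> evm M g \<Longrightarrow> evm M (\<lambda>x. f x * g x)"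
  unfolding evm_def evcoeff_mult by (intro allI borel_measurable_sum borel_measurable_times borel_measurable_const) blast+

lemma evm_scaleR [intro]: "r \<in> borel_measurable M \<Longrightarrow> evm M f \<Longrightarrow> evm M (\<lambda>x. r x *\<^sub>R f x)"
  unfolding evm_def evcoeff_simps evcoeff_sum by (intro allI borel_measurable_times) blast+

lemma evm_power [intro]: "evm M f \<Longrightarrow> evm M (\<lambda>x. f x ^ k)"
  by (induction k) (simp_all add: evm_mult)

lemma evm_sum [intro]: "(\<And>i. i \<in> I \<Longrightarrow> evm M (f i)) \<Longrightarrow> evm M (\<lambda>x. \<Sum>i\<in>I. f i x)"
  unfolding evm_def evcoeff_simps evcoeff_sum by (intro allI borel_measurable_sum) blast+

lemma evm_prod [intro]: "(\<And>i. i \<in> I \<Longrightarrow> evm M (f i)) \<Longrightarrow> evm M (\<lambda>x. \<Prod>i\<in>I. f i x)"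
  by (induction I rule: infinite_finite_induct) (simp_all add: evm_mult)

lemma evm_body: "evm M f \<Longrightarrow> (\<lambda>x. evbody (f x)) \<in> borel_measurable M"
  by (simp add: evm_def evbody_def)

lemma evm_tser:
  assumes "evm M g" "\<And>x. x \<in> space M \<Longrightarrow> g x \<in> evG G" "finite G" "\<And>k. f k \<in> borel_measurable borel"
  shows "evm M (\<lambda>x. tser f (g x))"
proof -
  have "evm M (\<lambda>x. \<Sum>k\<le>card G. f k (evbody (g x)) *\<^sub>R evsoul (g x) ^ k)"
    unfolding evsoul_def
    by (intro evm_sum evm_scaleR evm_power evm_diff evm_of_real evm_body assms
        measurable_compose[OF evm_body assms(4)])
  moreover have "evcoeff (\<Sum>k\<le>card G. f k (evbody (g x)) *\<^sub>R evsoul (g x) ^ k) S = evcoeff (tser f (g x)) S"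
    if "x \<in> space M" for x S
    using tser_eq[OF assms(2)[OF that] assms(3)] by simp
  ultimately show ?thesis
    unfolding evm_def by (metis (no_types, lifting) measurable_cong)
qed

lemma evm_evexp: "evm M g \<Longrightarrow> (\<And>x. x \<in> space M \<Longrightarrow> g x \<in> evG G) \<Longrightarrow> finite G \<Longrightarrow> evm M (\<lambda>x. evexp (g x))"
  unfolding evexp_def by (rule evm_tser) auto

lemma evm_evpow: "evm M g \<Longrightarrow> (\<And>x. x \<in> space M \<Longrightarrow> g x \<in> evG G) \<Longrightarrow> finite G \<Longrightarrow> evm M (\<lambda>x. evpow \<alpha> (g x))"
  unfolding evpow_def by (rule evm_tser) auto

section \<open>Integration over the plane\<close>

text \<open>The body of \<open>z\<close> for a spin at \<open>p\<close>, which is the hyperbolic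
  cosine of its distance from the origin of the hyperboloid. Its inverse fourth power is the
  integrable majorant used throughout.\<close>

definition hyp :: "real \<times> real \<Rightarrow> real" where
  "hyp p = sqrt (1 + (fst p)\<^sup>2 + (snd p)\<^sup>2)"

lemma hyp_ge_1: "hyp p \<ge> 1"
  by (simp add: hyp_def)

lemma hyp_pos: "hyp p > 0"
  using hyp_ge_1[of p] by linarith

lemma hyp_square: "hyp p ^ 2 = 1 + (fst p)\<^sup>2 + (snd p)\<^sup>2"
  by (simp add: hyp_def add_nonneg_nonneg)

lemma abs_le_hyp: "\<bar>fst p\<bar> \<le> hyp p" "\<bar>snd p\<bar> \<le> hyp p"
  by (auto simp: hyp_def intro!: real_le_rsqrt)

lemma borel_measurable_hyp [measurable]: "hyp \<in> borel_measurable borel"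
  unfolding hyp_def by (intro borel_measurable_continuous_onI) (auto intro!: continuous_intros)

lemma FTC_integrable:
  fixes f :: "real \<Rightarrow> real"
  assumes "set_integrable lborel {a..b} f" "a \<le> b" "\<And>x. a \<le> x \<Longrightarrow> x \<le> b \<Longrightarrow> (F has_real_derivative f x) (at x)"
  shows "(LINT x:{a..b}|lborel. f x) = F b - F a"
proof -
  have "(f has_integral (F b - F a)) {a..b}"
    using assms(3) by (intro fundamental_theorem_of_calculus assms(2))
      (auto simp: has_real_derivative_iff_has_vector_derivative[symmetric] intro: has_field_derivative_at_within)
  then show ?thesis
    using set_borel_integral_eq_integral(2)[OF assms(1)] by (simp add: integral_unique)
qed

lemma integral_exhaust:
  fixes f :: "real \<Rightarrow> real"
  assumes f: "integrable lborel f" and A: "\<And>n. A n \<in> sets borel" "\<And>x. eventually (\<lambda>n. x \<in> A n) sequentially"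
  shows "(\<lambda>n. LINT x:A n|lborel. f x) \<longlonglongrightarrow> (\<integral>x. f x \<partial>lborel)"
  unfolding set_lebesgue_integral_def
proof (rule integral_dominated_convergence)
  show "integrable lborel (\<lambda>x. norm (f x))" using f by simp
  show "AE x in lborel. (\<lambda>n. indicat_real (A n) x *\<^sub>R f x) \<longlonglongrightarrow> f x"
  proof (rule AE_I2)
    fix x
    show "(\<lambda>n. indicat_real (A n) x *\<^sub>R f x) \<longlonglongrightarrow> f x"
      by (rule tendsto_eventually, rule eventually_mono[OF A(2)[of x]]) simp
  qed
qed (use f A in \<open>auto simp: indicator_def\<close>)

lemma line_integral_derivative_zero:
  fixes f :: "real \<Rightarrow> real"
  assumes f: "integrable lborel f" and F: "\<And>x. (F has_real_derivative f x) (at x)"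
    and lim: "(F \<longlongrightarrow> 0) at_top" "(F \<longlongrightarrow> 0) at_bot"
  shows "(\<integral>x. f x \<partial>lborel) = 0"
proof -
  have "(\<lambda>n. LINT x:{- real n..real n}|lborel. f x) \<longlonglongrightarrow> (\<integral>x. f x \<partial>lborel)"
  proof (rule integral_exhaust[OF f])
    fix x
    show "eventually (\<lambda>n. x \<in> {- real n..real n}) sequentially"
      using eventually_ge_at_top[of "nat \<lceil>\<bar>x\<bar>\<rceil>"] by eventually_elim auto
  qed auto
  moreover have "(LINT x:{- real n..real n}|lborel. f x) = F (real n) - F (- real n)" for n
    by (intro FTC_integrable F) (auto simp: set_integrable_def simp del: real_scaleR_def intro!: integrable_mult_indicator f)
  moreover have "(\<lambda>n. F (real n) - F (- real n)) \<longlonglongrightarrow> 0 - 0"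
    by (intro tendsto_diff filterlim_compose[OF lim(1)] filterlim_compose[OF lim(2)] filterlim_real_sequentially
        filterlim_compose[OF filterlim_uminus_at_bot_at_top])
  ultimately show ?thesis using LIMSEQ_unique by fastforce
qed

section \<open>Radial integrals in the plane\<close>

lemma borel_measurable_sq_norm [measurable]:
  "(\<lambda>p :: real \<times> real. (fst p)\<^sup>2 + (snd p)\<^sup>2) \<in> borel_measurable borel"
  by (intro borel_measurable_continuous_onI) (auto intro!: continuous_intros)

lemma emeasure_disc: "emeasure lborel {p :: real \<times> real. (fst p)\<^sup>2 + (snd p)\<^sup>2 < r} = ennreal (pi * max 0 r)"
proof (cases "r > 0")
  case True
  have "{p :: real \<times> real. (fst p)\<^sup>2 + (snd p)\<^sup>2 < r} = ball 0 (sqrt r)"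
    by (auto simp: norm_prod_def)
  then show ?thesis
    using True by (simp add: emeasure_ball unit_ball_vol_2)
next
  case False
  then have "{p :: real \<times> real. (fst p)\<^sup>2 + (snd p)\<^sup>2 < r} = {}"
    by (auto simp: not_less intro: order_trans)
  then show ?thesis using False by (simp add: max_def)
qed

text \<open>The area of a disc is linear in its squared radius, so the squared norm carries planar
  measure to \<open>pi\<close> times Lebesgue measure on the half-line. This takes the place of
  polar coordinates.\<close>

lemma distr_sq_norm:
  "distr lborel borel (\<lambda>p :: real \<times> real. (fst p)\<^sup>2 + (snd p)\<^sup>2) = density lborel (\<lambda>r. ennreal (pi * indicator {0..} r))"
  (is "?M = ?N")
proof (rule measure_eqI_generator_eq[where E = "range lessThan" and \<Omega> = UNIV and A = "\<lambda>n. {..<real n}"])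
  have m: "(\<lambda>p :: real \<times> real. (fst p)\<^sup>2 + (snd p)\<^sup>2) \<in> borel_measurable lborel"
    by measurable
  have M: "emeasure ?M {..<r} = ennreal (pi * max 0 r)" for r
    using emeasure_disc[of r] by (subst emeasure_distr[OF m]) (auto simp: vimage_def)
  have N: "emeasure ?N {..<r} = ennreal (pi * max 0 r)" for r
  proof -
    have "emeasure ?N {..<r} = (\<integral>\<^sup>+x. ennreal pi * indicator {0..<r} x \<partial>lborel)"
      by (subst emeasure_density) (auto intro!: nn_integral_cong simp: indicator_def)
    also have "\<dots> = ennreal pi * emeasure lborel {0..<r}"
      by (subst nn_integral_cmult_indicator) auto
    also have "\<dots> = ennreal (pi * max 0 r)"
      by (cases "r \<ge> 0") (auto simp: ennreal_mult' max_def)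
    finally show ?thesis .
  qed
  show "emeasure ?M X = emeasure ?N X" if "X \<in> range lessThan" for X
    using that M N by auto
  show "Int_stable (range (lessThan :: real \<Rightarrow> _))"
  proof -
    have "{..<a} \<inter> {..<b} = {..<min a b}" for a b :: real by auto
    then show ?thesis by (auto simp: Int_stable_def)
  qed
  show "sets ?M = sigma_sets UNIV (range lessThan)" "sets ?N = sigma_sets UNIV (range lessThan)"
    by (auto simp: borel_Iio)
  show "(\<Union>i. {..<real i}) = UNIV"
    by (auto simp: reals_Archimedean2)
  show "emeasure ?M {..<real i} \<noteq> \<infinity>" for i
    unfolding M by simp
qed auto

lemma radial_integrable_iff:
  fixes g :: "real \<Rightarrow> real"
  assumes "g \<in> borel_measurable borel"
  shows "integrable lborel (\<lambda>p :: real \<times> real. g ((fst p)\<^sup>2 + (snd p)\<^sup>2)) \<longleftrightarrow> set_integrable lborel {0..} g"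
proof -
  have "integrable lborel (\<lambda>p :: real \<times> real. g ((fst p)\<^sup>2 + (snd p)\<^sup>2)) \<longleftrightarrow>
      integrable (distr lborel borel (\<lambda>p :: real \<times> real. (fst p)\<^sup>2 + (snd p)\<^sup>2)) g"
    using assms by (subst integrable_distr_eq) auto
  also have "\<dots> \<longleftrightarrow> integrable lborel (\<lambda>r. (pi * indicator {0..} r) *\<^sub>R g r)"
    unfolding distr_sq_norm using assms by (intro integrable_density) auto
  also have "\<dots> \<longleftrightarrow> set_integrable lborel {0..} g"
    by (simp add: set_integrable_def mult.assoc)
  finally show ?thesis .
qed

lemma radial_integral:
  fixes g :: "real \<Rightarrow> real"
  assumes "g \<in> borel_measurable borel"
  shows "(\<integral>p. g ((fst p)\<^sup>2 + (snd p)\<^sup>2) \<partial>(lborel :: (real \<times> real) measure)) = pi * (LINT r:{0..}|lborel. g r)"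
proof -
  have "(\<integral>p. g ((fst p)\<^sup>2 + (snd p)\<^sup>2) \<partial>(lborel :: (real \<times> real) measure)) =
      integral\<^sup>L (distr lborel borel (\<lambda>p :: real \<times> real. (fst p)\<^sup>2 + (snd p)\<^sup>2)) g"
    using assms by (subst integral_distr) auto
  also have "\<dots> = (\<integral>r. (pi * indicator {0..} r) *\<^sub>R g r \<partial>lborel)"
    unfolding distr_sq_norm using assms by (intro integral_density) auto
  finally show ?thesis
    by (simp add: set_lebesgue_integral_def mult.assoc)
qed

text \<open>In terms of \<open>r = x^2 + y^2\<close> the function is \<open>1 / (1 + r)^2\<close>,
  with primitive \<open>- 1 / (1 + r)\<close>.\<close>

lemma integrable_hyp_power: "integrable lborel (\<lambda>p. 1 / hyp p ^ 4)"
proof -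
  define g where "g r = 1 / (1 + r)\<^sup>2" for r :: real
  have [measurable]: "g \<in> borel_measurable borel" unfolding g_def by measurable
  have "(\<integral>\<^sup>+x. ennreal (g x) * indicator {0..} x \<partial>lborel) = ennreal (0 - (- 1 / (1 + 0)))"
  proof (rule nn_integral_FTC_atLeast[where F = "\<lambda>x. - 1 / (1 + x)"])
    fix x :: real assume "0 \<le> x"
    then show "((\<lambda>x. - 1 / (1 + x)) has_real_derivative g x) (at x)"
      unfolding g_def by (auto intro!: derivative_eq_intros simp: power2_eq_square field_simps)
  next
    show "((\<lambda>x::real. - 1 / (1 + x)) \<longlongrightarrow> 0) at_top"
      by (intro tendsto_divide_0[OF tendsto_const] filterlim_at_top_imp_at_infinity filterlim_tendsto_add_at_top[OF tendsto_const] filterlim_ident)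
  qed (auto simp: g_def)
  moreover have "ennreal (g x) * indicator {0..} x = ennreal (indicator {0..} x *\<^sub>R g x)" for x
    by (auto simp: indicator_def)
  ultimately have "(\<integral>\<^sup>+x. ennreal (indicator {0..} x *\<^sub>R g x) \<partial>lborel) < \<infinity>"
    by (simp only: ennreal_less_top infinity_ennreal_def)
  moreover have "(\<lambda>x. indicator {0..} x *\<^sub>R g x) \<in> borel_measurable lborel" by measurable
  ultimately have "set_integrable lborel {0..} g"
    unfolding set_integrable_def by (intro integrableI_nonneg) (auto simp: g_def)
  then have "integrable lborel (\<lambda>p :: real \<times> real. g ((fst p)\<^sup>2 + (snd p)\<^sup>2))"
    by (subst radial_integrable_iff) auto
  moreover have "g ((fst p)\<^sup>2 + (snd p)\<^sup>2) = 1 / hyp p ^ 4" for p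
    using power_mult[of "hyp p" 2 2] by (simp add: g_def hyp_square add.assoc)
  ultimately show ?thesis by simp
qed

text \<open>With \<open>s = sqrt (1 + r)\<close> the integrand is the \<open>r\<close>-derivative of
  \<open>2 * h s\<close>. The lower limit \<open>r = 0\<close> gives \<open>s = 1\<close>, and
  \<open>pi\<close> comes from the area of the disc.\<close>

lemma radial_divergence:
  fixes h h' :: "real \<Rightarrow> real"
  assumes h: "\<And>s. s > 0 \<Longrightarrow> (h has_real_derivative h' s) (at s)" and h'[measurable]: "h' \<in> borel_measurable borel"
    and int: "integrable lborel (\<lambda>p. h' (hyp p) / hyp p)" and lim: "(h \<longlongrightarrow> 0) at_top"
  shows "(\<integral>p. h' (hyp p) / hyp p \<partial>lborel) = - (2 * pi * h 1)"
proof -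
  define g where "g r = h' (sqrt (1 + r)) / sqrt (1 + r)" for r
  have gm: "g \<in> borel_measurable borel" unfolding g_def by measurable
  have gh: "h' (hyp p) / hyp p = g ((fst p)\<^sup>2 + (snd p)\<^sup>2)" for p
    by (simp add: g_def hyp_def add.assoc)
  have si: "set_integrable lborel {0..} g"
    using int unfolding gh by (simp add: radial_integrable_iff[OF gm])
  have "(\<lambda>n. LINT x:{..real n}|lborel. indicator {0..} x *\<^sub>R g x) \<longlonglongrightarrow> (\<integral>x. indicator {0..} x *\<^sub>R g x \<partial>lborel)"
  proof (rule integral_exhaust)
    fix x :: real
    show "eventually (\<lambda>n. x \<in> {..real n}) sequentially"
      using eventually_ge_at_top[of "nat \<lceil>\<bar>x\<bar>\<rceil>"] by eventually_elim auto
  qed (use si in \<open>auto simp: set_integrable_def\<close>)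
  moreover have "(LINT x:{..real n}|lborel. indicator {0..} x *\<^sub>R g x) = 2 * h (sqrt (1 + real n)) - 2 * h (sqrt (1 + 0))" for n
  proof -
    have "(LINT x:{..real n}|lborel. indicator {0..} x *\<^sub>R g x) = (LINT x:{0..real n}|lborel. g x)"
      unfolding set_lebesgue_integral_def by (intro Bochner_Integration.integral_cong) (auto simp: indicator_def)
    also have "\<dots> = 2 * h (sqrt (1 + real n)) - 2 * h (sqrt (1 + 0))"
    proof (rule FTC_integrable[where F = "\<lambda>r. 2 * h (sqrt (1 + r))"])
      show "set_integrable lborel {0..real n} g"
        by (rule set_integrable_subset[OF si]) auto
      fix x :: real assume "0 \<le> x"
      then show "((\<lambda>r. 2 * h (sqrt (1 + r))) has_real_derivative g x) (at x)"
        unfolding g_def by (auto intro!: derivative_eq_intros DERIV_chain2[OF h] simp: field_simps)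
    qed auto
    finally show ?thesis .
  qed
  moreover have "(\<lambda>n. 2 * h (sqrt (1 + real n)) - 2 * h (sqrt (1 + 0))) \<longlonglongrightarrow> 2 * 0 - 2 * h (sqrt (1 + 0))"
    by (intro tendsto_diff tendsto_mult tendsto_const filterlim_compose[OF lim]
        filterlim_compose[OF sqrt_at_top] filterlim_tendsto_add_at_top[OF tendsto_const] filterlim_real_sequentially)
  ultimately have "(\<integral>x. indicator {0..} x *\<^sub>R g x \<partial>lborel) = - 2 * h 1"
    using LIMSEQ_unique by fastforce
  then show ?thesis
    unfolding gh radial_integral[OF gm] by (simp add: set_lebesgue_integral_def)
qed

section \<open>Integrals of divergences\<close>

lemma tendsto_bounded_hyp:
  fixes f :: "real \<Rightarrow> real"
  assumes "\<And>x. \<bar>f x\<bar> \<le> C / hyp (g x) ^ 4" "\<And>x. \<bar>x\<bar> \<le> hyp (g x)"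
  shows "(f \<longlongrightarrow> 0) at_top" "(f \<longlongrightarrow> 0) at_bot"
proof -
  have C: "C \<ge> 0"
    using order_trans[OF abs_ge_zero assms(1)[of 0]] hyp_pos[of "g 0"] by (simp add: zero_le_divide_iff)
  have b: "norm (f x) \<le> C / \<bar>x\<bar>" if "x \<noteq> 0" for x
  proof -
    have "\<bar>f x\<bar> \<le> C / hyp (g x) ^ 4" by (rule assms)
    also have "\<dots> \<le> C / hyp (g x) ^ 1"
      using C hyp_ge_1[of "g x"] by (intro divide_left_mono power_increasing) (auto simp: hyp_pos)
    also have "\<dots> \<le> C / \<bar>x\<bar>"
      using C assms(2)[of x] that by (intro divide_left_mono) (auto simp: hyp_pos)
    finally show ?thesis by simp
  qed
  have "((\<lambda>x::real. C / \<bar>x\<bar>) \<longlongrightarrow> 0) at_top"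
    by (intro tendsto_divide_0[OF tendsto_const] filterlim_at_top_imp_at_infinity filterlim_abs_real)
  moreover from this have "((\<lambda>x::real. C / \<bar>x\<bar>) \<longlongrightarrow> 0) at_bot"
    by (simp add: filterlim_at_bot_mirror)
  ultimately show "(f \<longlongrightarrow> 0) at_top" "(f \<longlongrightarrow> 0) at_bot"
    by (auto intro!: Lim_null_comparison[where g = "\<lambda>x. C / \<bar>x\<bar>"] eventually_mono[OF eventually_gt_at_top[of 0]]
        eventually_mono[OF eventually_gt_at_bot[of 0]] b)
qed

text \<open>By Fubini the differentiated coordinate can be integrated first, and each line integral
  vanishes because \<open>Y\<close> tends to zero at both ends.\<close>

lemma plane_divergence:
  fixes y Y :: "real \<times> real \<Rightarrow> real"
  assumes int: "integrable lborel y"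
    and bound: "\<And>p. \<bar>Y p\<bar> \<le> C / hyp p ^ 4"
    and d: "(\<forall>a b. ((\<lambda>a. Y (a, b)) has_real_derivative y (a, b)) (at a)) \<or>
            (\<forall>a b. ((\<lambda>b. Y (a, b)) has_real_derivative y (a, b)) (at b))"
  shows "(\<integral>p. y p \<partial>lborel) = 0"
proof -
  have int': "integrable (lborel \<Otimes>\<^sub>M lborel) (case_prod (\<lambda>a b. y (a, b)))"
    using int by (simp add: lborel_prod)
  have 1: "(\<integral>p. y p \<partial>lborel) = (\<integral>a. (\<integral>b. y (a, b) \<partial>lborel) \<partial>lborel)"
    using lborel_pair.integral_fst[OF int'] by (simp add: lborel_prod)
  have 2: "(\<integral>p. y p \<partial>lborel) = (\<integral>b. (\<integral>a. y (a, b) \<partial>lborel) \<partial>lborel)"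
    using lborel_pair.integral_snd[OF int'] by (simp add: lborel_prod)
  show ?thesis using d
  proof
    assume d: "\<forall>a b. ((\<lambda>a. Y (a, b)) has_real_derivative y (a, b)) (at a)"
    have "(\<integral>a. y (a, b) \<partial>lborel) = 0" for b
    \<comment> \<open>A slice that is not integrable has integral 0 by convention, so exceptional
      lines satisfy the claim as well.\<close>
    proof (cases "integrable lborel (\<lambda>a. y (a, b))")
      case True
      have "((\<lambda>a. Y (a, b)) \<longlongrightarrow> 0) at_top" "((\<lambda>a. Y (a, b)) \<longlongrightarrow> 0) at_bot"
        by (rule tendsto_bounded_hyp[where g = "\<lambda>a. (a, b)" and C = C], use abs_le_hyp(1)[of "(_, b)"] in \<open>simp_all add: bound\<close>)+
      then show ?thesis
        using True d by (intro line_integral_derivative_zero[where F = "\<lambda>a. Y (a, b)"]) auto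
    qed (rule not_integrable_integral_eq)
    then show ?thesis unfolding 2 by simp
  next
    assume d: "\<forall>a b. ((\<lambda>b. Y (a, b)) has_real_derivative y (a, b)) (at b)"
    have "(\<integral>b. y (a, b) \<partial>lborel) = 0" for a
    proof (cases "integrable lborel (\<lambda>b. y (a, b))")
      case True
      have "((\<lambda>b. Y (a, b)) \<longlongrightarrow> 0) at_top" "((\<lambda>b. Y (a, b)) \<longlongrightarrow> 0) at_bot"
        by (rule tendsto_bounded_hyp[where g = "\<lambda>b. (a, b)" and C = C], use abs_le_hyp(2)[of "(a, _)"] in \<open>simp_all add: bound\<close>)+
      then show ?thesis
        using True d by (intro line_integral_derivative_zero[where F = "\<lambda>b. Y (a, b)"]) auto
    qed (rule not_integrable_integral_eq)
    then show ?thesis unfolding 1 by simp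
  qed
qed

text \<open>The difference of the endpoint values is an integral over \<open>t\<close>, which Fubini
  exchanges with the integral over the plane; for each \<open>t\<close> the inner integral is then
  that of a divergence. This avoids differentiation under the integral sign, and the bounds uniform
  in \<open>t\<close> give the integrability that Fubini asks for.\<close>

lemma path_divergence:
  fixes j Y1 Y2 y1 y2 :: "real \<Rightarrow> real \<times> real \<Rightarrow> real"
  assumes dj: "\<And>t p. 0 \<le> t \<Longrightarrow> t \<le> 1 \<Longrightarrow> ((\<lambda>t. j t p) has_real_derivative y1 t p + y2 t p) (at t)"
    and d1: "\<And>t a b. 0 \<le> t \<Longrightarrow> t \<le> 1 \<Longrightarrow> ((\<lambda>a. Y1 t (a, b)) has_real_derivative y1 t (a, b)) (at a)"
    and d2: "\<And>t a b. 0 \<le> t \<Longrightarrow> t \<le> 1 \<Longrightarrow> ((\<lambda>b. Y2 t (a, b)) has_real_derivative y2 t (a, b)) (at b)"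
    and b1: "\<And>t p. 0 \<le> t \<Longrightarrow> t \<le> 1 \<Longrightarrow> \<bar>y1 t p\<bar> \<le> C1 / hyp p ^ 4"
    and b2: "\<And>t p. 0 \<le> t \<Longrightarrow> t \<le> 1 \<Longrightarrow> \<bar>y2 t p\<bar> \<le> C2 / hyp p ^ 4"
    and B1: "\<And>t p. 0 \<le> t \<Longrightarrow> t \<le> 1 \<Longrightarrow> \<bar>Y1 t p\<bar> \<le> C3 / hyp p ^ 4"
    and B2: "\<And>t p. 0 \<le> t \<Longrightarrow> t \<le> 1 \<Longrightarrow> \<bar>Y2 t p\<bar> \<le> C4 / hyp p ^ 4"
    and m1: "(\<lambda>(t, p). y1 t p) \<in> borel_measurable (lborel \<Otimes>\<^sub>M lborel)"
    and m2: "(\<lambda>(t, p). y2 t p) \<in> borel_measurable (lborel \<Otimes>\<^sub>M lborel)"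
    and int: "integrable lborel (j 0)" "integrable lborel (j 1)"
  shows "(\<integral>p. j 1 p \<partial>lborel) = (\<integral>p. j 0 p \<partial>lborel)"
proof -
  define f where "f t p = indicator {0..1} t * (y1 t p + y2 t p)" for t p
  have m: "case_prod f \<in> borel_measurable (lborel \<Otimes>\<^sub>M lborel)"
  proof -
    have "case_prod f = (\<lambda>z. indicator {0..1} (fst z) * ((\<lambda>(t, p). y1 t p) z + (\<lambda>(t, p). y2 t p) z))"
      by (auto simp: f_def fun_eq_iff)
    moreover have "(\<lambda>z :: real \<times> real \<times> real. indicator {0..1} (fst z) :: real) \<in> borel_measurable (lborel \<Otimes>\<^sub>M lborel)"
      by measurable
    ultimately show ?thesis
      by (simp only:) (intro borel_measurable_times borel_measurable_add m1 m2)
  qed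
  have slice: "y t \<in> borel_measurable borel" if "(\<lambda>(t, p). y t p) \<in> borel_measurable (lborel \<Otimes>\<^sub>M lborel)"
    for y :: "real \<Rightarrow> real \<times> real \<Rightarrow> real" and t
    using measurable_compose[OF measurable_Pair1' that, of t] by simp
  have iy1: "integrable lborel (y1 t)" if "0 \<le> t" "t \<le> 1" for t
    by (rule Bochner_Integration.integrable_bound[OF integrable_mult_right[OF integrable_hyp_power, of C1]])
      (use b1[OF that] slice[OF m1] in \<open>auto intro!: AE_I2 order_trans[OF _ divide_right_mono[OF abs_ge_self]] simp del: split_paired_All\<close>)
  have iy2: "integrable lborel (y2 t)" if "0 \<le> t" "t \<le> 1" for t
    by (rule Bochner_Integration.integrable_bound[OF integrable_mult_right[OF integrable_hyp_power, of C2]])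
      (use b2[OF that] slice[OF m2] in \<open>auto intro!: AE_I2 order_trans[OF _ divide_right_mono[OF abs_ge_self]] simp del: split_paired_All\<close>)
  have z: "(\<integral>p. f t p \<partial>lborel) = 0" for t
  proof (cases "t \<in> {0..1}")
    case True
    have "(\<integral>p. y1 t p \<partial>lborel) = 0"
      using True d1 iy1 B1 by (intro plane_divergence[where Y = "Y1 t"]) auto
    moreover have "(\<integral>p. y2 t p \<partial>lborel) = 0"
      using True d2 iy2 B2 by (intro plane_divergence[where Y = "Y2 t"]) auto
    ultimately
    show ?thesis using True iy1 iy2 by (simp add: f_def)
  qed (simp add: f_def)
  have bf: "\<bar>f t p\<bar> \<le> indicator {0..1} t * ((C1 + C2) / hyp p ^ 4)" for t p
    using b1[of t p] b2[of t p] by (auto simp: f_def indicator_def add_divide_distrib)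
  have fint: "integrable (lborel \<Otimes>\<^sub>M lborel) (case_prod f)"
  proof (rule lborel_pair.Fubini_integrable[OF m])
    have ip: "integrable lborel (f t)" for t
      using iy1 iy2 by (cases "t \<in> {0..1}") (auto simp: f_def[abs_def])
    then show "AE x in lborel. integrable lborel (\<lambda>y. case (x, y) of (x, xa) \<Rightarrow> f x xa)" by simp
    show "integrable lborel (\<lambda>x. \<integral>y. norm (case (x, y) of (x, xa) \<Rightarrow> f x xa) \<partial>lborel)"
    proof (rule Bochner_Integration.integrable_bound)
      show "integrable lborel (\<lambda>t :: real. indicator {0..1} t * (\<integral>p. (C1 + C2) / hyp p ^ 4 \<partial>lborel))"
        by (intro integrable_mult_left) auto
      show "(\<lambda>x. \<integral>y. norm (case (x, y) of (x, xa) \<Rightarrow> f x xa) \<partial>lborel) \<in> borel_measurable lborel"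
        using m by measurable
      show "AE x in lborel. norm (\<integral>y. norm (case (x, y) of (x, xa) \<Rightarrow> f x xa) \<partial>lborel)
          \<le> norm (indicat_real {0..1} x * (\<integral>p. (C1 + C2) / hyp p ^ 4 \<partial>lborel))"
      proof (rule AE_I2)
        fix t :: real
        have "(\<integral>p. \<bar>f t p\<bar> \<partial>lborel) \<le> (\<integral>p. indicator {0..1} t * ((C1 + C2) / hyp p ^ 4) \<partial>lborel)"
        proof (rule integral_mono)
          show "integrable lborel (\<lambda>p. \<bar>f t p\<bar>)" using ip[of t] by simp
          show "integrable lborel (\<lambda>p. indicator {0..1} t * ((C1 + C2) / hyp p ^ 4))"
            using integrable_mult_right[OF integrable_hyp_power, of "C1 + C2"] by (intro integrable_mult_right) simp
        qed (rule bf)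
        moreover have "0 \<le> (\<integral>p. \<bar>f t p\<bar> \<partial>lborel)"
          by (rule Bochner_Integration.integral_nonneg_AE) simp
        ultimately have "norm (\<integral>p. \<bar>f t p\<bar> \<partial>lborel) \<le> norm (\<integral>p. indicator {0..1} t * ((C1 + C2) / hyp p ^ 4) \<partial>lborel)"
          by simp
        then show "norm (\<integral>y. norm (case (t, y) of (x, xa) \<Rightarrow> f x xa) \<partial>lborel)
          \<le> norm (indicat_real {0..1} t * (\<integral>p. (C1 + C2) / hyp p ^ 4 \<partial>lborel))"
          by (simp only: Bochner_Integration.integral_mult_right_zero prod.case real_norm_def)
      qed
    qed
  qed
  have j: "j 1 p - j 0 p = (\<integral>t. f t p \<partial>lborel)" for p
  proof -
    have pm: "(\<lambda>t. y1 t p) \<in> borel_measurable borel" "(\<lambda>t. y2 t p) \<in> borel_measurable borel"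
      using measurable_compose[OF measurable_Pair2' m1, of p] measurable_compose[OF measurable_Pair2' m2, of p] by simp_all
    have "set_integrable lborel {0..1} (\<lambda>t. y1 t p + y2 t p)"
      unfolding set_integrable_def
    proof (rule Bochner_Integration.integrable_bound)
      show "integrable lborel (\<lambda>t :: real. indicator {0..1} t * ((C1 + C2) / hyp p ^ 4))"
        by (intro integrable_mult_left) auto
      show "AE x in lborel. norm (indicat_real {0..1} x *\<^sub>R (y1 x p + y2 x p)) \<le> norm (indicat_real {0..1} x * ((C1 + C2) / hyp p ^ 4))"
      proof (rule AE_I2)
        fix t :: real
        have "norm (indicat_real {0..1} t *\<^sub>R (y1 t p + y2 t p)) = \<bar>f t p\<bar>"
          by (simp add: f_def)
        also have "\<dots> \<le> \<bar>indicat_real {0..1} t * ((C1 + C2) / hyp p ^ 4)\<bar>"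
          by (rule order_trans[OF bf abs_ge_self])
        finally show "norm (indicat_real {0..1} t *\<^sub>R (y1 t p + y2 t p)) \<le> norm (indicat_real {0..1} t * ((C1 + C2) / hyp p ^ 4))"
          by simp
      qed
    qed (use pm in measurable)
    from FTC_integrable[OF this, of "\<lambda>t. j t p"] dj
    show ?thesis by (simp add: set_lebesgue_integral_def f_def)
  qed
  have "(\<integral>p. j 1 p \<partial>lborel) - (\<integral>p. j 0 p \<partial>lborel) = (\<integral>p. (\<integral>t. f t p \<partial>lborel) \<partial>lborel)"
    using int by (subst Bochner_Integration.integral_diff[symmetric]) (auto simp: j)
  also have "\<dots> = (\<integral>t. (\<integral>p. f t p \<partial>lborel) \<partial>lborel)"
    by (rule lborel_pair.Fubini_integral[OF fint])
  finally show ?thesis by (simp add: z)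
qed

section \<open>Localization of a superintegral over one spin\<close>

text \<open>The single term of order \<open>K + n\<close> of the exponential series is a sufficient
  lower bound for \<open>exp (\<epsilon> * s)\<close>.\<close>

lemma power_exp_decay:
  assumes "\<epsilon> > 0" "C \<ge> 0"
  shows "\<exists>C'\<ge>0. \<forall>s\<ge>(1::real). C * s ^ K * exp (- \<epsilon> * s) \<le> C' / s ^ n"
proof -
  have e: "x ^ k / fact k \<le> exp x" if "x \<ge> 0" for x :: real and k
  proof -
    have "(\<Sum>i\<in>{k}. x ^ i /\<^sub>R fact i) \<le> (\<Sum>i. x ^ i /\<^sub>R fact i)"
      using that by (intro sum_le_suminf summable_exp_generic) auto
    then show ?thesis by (simp add: exp_def divide_inverse mult.commute)
  qed
  let ?D = "C * fact (K + n) / \<epsilon> ^ (K + n)"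
  have "C * s ^ K * exp (- \<epsilon> * s) \<le> ?D / s ^ n" if s: "s \<ge> 1" for s
  proof -
    have "(\<epsilon> * s) ^ (K + n) \<le> fact (K + n) * exp (\<epsilon> * s)"
      using e[of "\<epsilon> * s" "K + n"] assms s by (simp add: divide_le_eq mult.commute)
    then have "s ^ K * s ^ n * exp (- (\<epsilon> * s)) \<le> fact (K + n) / \<epsilon> ^ (K + n)"
      using assms by (simp add: power_mult_distrib power_add exp_minus field_simps)
    then have "C * (s ^ K * s ^ n * exp (- (\<epsilon> * s))) \<le> C * (fact (K + n) / \<epsilon> ^ (K + n))"
      by (rule mult_left_mono) (rule assms)
    then have "C * s ^ K * exp (- \<epsilon> * s) * s ^ n \<le> ?D" by (simp add: mult_ac)
    moreover have "s ^ n > 0" using s by simp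
    ultimately show ?thesis by (simp only: pos_le_divide_eq)
  qed
  moreover have "?D \<ge> 0" using assms by simp
  ultimately show ?thesis by blast
qed

text \<open>A calculus of polynomial bounds in a scale \<open>s\<close>. Because of
  \<open>s \<ge> 1\<close> any two bounds have a common one. The scale will be \<open>hyp\<close>,
  then \<open>1 + 2 * norm q\<close>, then the product of \<open>hyp\<close> over all
  vertices.\<close>

locale growth =
  fixes G :: "'g::linorder set" and X :: "'x set" and s :: "'x \<Rightarrow> real"
  assumes finite_G: "finite G" and s_ge_1: "\<And>x. x \<in> X \<Longrightarrow> s x \<ge> 1"
begin

definition pb :: "('x \<Rightarrow> 'g ev) \<Rightarrow> bool" where
  "pb f \<longleftrightarrow> (\<forall>x\<in>X. f x \<in> evG G) \<and> (\<exists>C\<ge>0. \<exists>K. \<forall>x\<in>X. norm (f x) \<le> C * s x ^ K)"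

lemma pbI: "(\<And>x. x \<in> X \<Longrightarrow> f x \<in> evG G) \<Longrightarrow> C \<ge> 0 \<Longrightarrow> (\<And>x. x \<in> X \<Longrightarrow> norm (f x) \<le> C * s x ^ K) \<Longrightarrow> pb f"
  by (auto simp: pb_def)

lemma pb_evG: "pb f \<Longrightarrow> x \<in> X \<Longrightarrow> f x \<in> evG G"
  by (auto simp: pb_def)

lemma pb_bound: "pb f \<Longrightarrow> \<exists>C\<ge>0. \<exists>K. \<forall>x\<in>X. norm (f x) \<le> C * s x ^ K"
  by (simp add: pb_def)

lemma pb_const: "a \<in> evG G \<Longrightarrow> pb (\<lambda>_. a)"
  by (rule pbI[where C = "norm a" and K = 0]) auto

lemma pb_of_real: "C \<ge> 0 \<Longrightarrow> (\<And>x. x \<in> X \<Longrightarrow> \<bar>r x\<bar> \<le> C * s x ^ K) \<Longrightarrow> pb (\<lambda>x. of_real (r x))"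
  by (rule pbI[where C = C and K = K]) auto

lemma pb_mult:
  assumes "pb f" "pb g"
  shows "pb (\<lambda>x. f x * g x)"
proof -
  obtain C K where f: "C \<ge> 0" "\<And>x. x \<in> X \<Longrightarrow> norm (f x) \<le> C * s x ^ K" using pb_bound[OF assms(1)] by blast
  obtain D L where g: "D \<ge> 0" "\<And>x. x \<in> X \<Longrightarrow> norm (g x) \<le> D * s x ^ L" using pb_bound[OF assms(2)] by blast
  show ?thesis
  proof (rule pbI)
    fix x assume x: "x \<in> X"
    have "norm (f x * g x) \<le> norm (f x) * norm (g x)" by (rule norm_mult_ineq)
    also have "\<dots> \<le> (C * s x ^ K) * (D * s x ^ L)"
      using f g x s_ge_1[OF x] by (intro mult_mono) auto
    finally show "norm (f x * g x) \<le> (C * D) * s x ^ (K + L)"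
      by (simp add: power_add mult_ac)
    show "f x * g x \<in> evG G" using assms x by (auto intro: pb_evG)
  qed (use f g in auto)
qed

lemma pb_add:
  assumes "pb f" "pb g"
  shows "pb (\<lambda>x. f x + g x)"
proof -
  obtain C K where f: "C \<ge> 0" "\<And>x. x \<in> X \<Longrightarrow> norm (f x) \<le> C * s x ^ K" using pb_bound[OF assms(1)] by blast
  obtain D L where g: "D \<ge> 0" "\<And>x. x \<in> X \<Longrightarrow> norm (g x) \<le> D * s x ^ L" using pb_bound[OF assms(2)] by blast
  show ?thesis
  proof (rule pbI)
    fix x assume x: "x \<in> X"
    have "norm (f x + g x) \<le> C * s x ^ K + D * s x ^ L"
      using norm_triangle_ineq[of "f x" "g x"] f(2)[OF x] g(2)[OF x] by linarith
    also have "\<dots> \<le> C * s x ^ (K + L) + D * s x ^ (K + L)"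
      using f g s_ge_1[OF x] by (intro add_mono mult_left_mono power_increasing) auto
    finally show "norm (f x + g x) \<le> (C + D) * s x ^ (K + L)"
      by (simp add: algebra_simps)
    show "f x + g x \<in> evG G" using assms x by (auto intro: pb_evG)
  qed (use f g in auto)
qed

lemma pb_minus: "pb f \<Longrightarrow> pb (\<lambda>x. - f x)"
  unfolding pb_def by (auto simp: evG_simps)

lemma pb_diff: "pb f \<Longrightarrow> pb g \<Longrightarrow> pb (\<lambda>x. f x - g x)"
  using pb_add[OF _ pb_minus, of f g] by simp

lemma pb_power: "pb f \<Longrightarrow> pb (\<lambda>x. f x ^ k)"
proof (induction k)
  case 0
  show ?case using pb_const[of 1] by auto
qed (auto intro: pb_mult)

lemma pb_sum: "(\<And>i. i \<in> I \<Longrightarrow> pb (f i)) \<Longrightarrow> pb (\<lambda>x. \<Sum>i\<in>I. f i x)"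
proof (induction I rule: infinite_finite_induct)
  case (insert i I)
  then show ?case by (auto intro: pb_add)
qed (use pb_const[of 0] in auto)

lemma pb_prod: "(\<And>i. i \<in> I \<Longrightarrow> pb (f i)) \<Longrightarrow> pb (\<lambda>x. \<Prod>i\<in>I. f i x)"
proof (induction I rule: infinite_finite_induct)
  case (insert i I)
  then show ?case by (auto intro: pb_mult)
qed (use pb_const[of 1] in auto)

lemma pb_scaleR: "pb f \<Longrightarrow> pb (\<lambda>x. c *\<^sub>R f x)"
  using pb_mult[OF pb_const[of "of_real c"], of f] by (auto simp: scaleR_conv_of_real)

lemma pb_one_plus_norm:
  assumes "pb f"
  shows "\<exists>C\<ge>0. \<exists>K. \<forall>x\<in>X. (1 + 2 * norm (f x)) ^ n \<le> C * s x ^ K"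
proof -
  obtain C K where f: "C \<ge> 0" "\<And>x. x \<in> X \<Longrightarrow> norm (f x) \<le> C * s x ^ K" using pb_bound[OF assms] by blast
  have "(1 + 2 * norm (f x)) ^ n \<le> (1 + 2 * C) ^ n * s x ^ (K * n)" if x: "x \<in> X" for x
  proof -
    have "1 + 2 * norm (f x) \<le> s x ^ K + 2 * (C * s x ^ K)"
      using f(2)[OF x] s_ge_1[OF x] one_le_power[of "s x" K] by linarith
    then have "(1 + 2 * norm (f x)) ^ n \<le> ((1 + 2 * C) * s x ^ K) ^ n"
      by (intro power_mono) (auto simp: algebra_simps)
    then show ?thesis by (simp add: power_mult_distrib power_mult)
  qed
  then show ?thesis using f(1) by (intro exI[of _ "(1 + 2 * C) ^ n"] exI[of _ "K * n"]) auto
qed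

lemma pb_evpow:
  assumes f: "pb f" and d: "\<delta> > 0" "\<And>x. x \<in> X \<Longrightarrow> evbody (f x) \<ge> \<delta>" "\<alpha> \<le> 1"
  shows "pb (\<lambda>x. evpow \<alpha> (f x))"
proof -
  obtain C where C: "C \<ge> 0"
    "\<And>a. a \<in> evG G \<Longrightarrow> evbody a \<ge> \<delta> \<Longrightarrow> norm (evpow \<alpha> a) \<le> C * (1 + 2 * norm a) ^ Suc (card G)"
    using norm_evpow_le[OF finite_G d(1,3)] by blast
  obtain D K where D: "D \<ge> 0" "\<And>x. x \<in> X \<Longrightarrow> (1 + 2 * norm (f x)) ^ Suc (card G) \<le> D * s x ^ K"
    using pb_one_plus_norm[OF f] by blast
  show ?thesis
  proof (rule pbI)
    fix x assume x: "x \<in> X"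
    show "evpow \<alpha> (f x) \<in> evG G" using pb_evG[OF f x] finite_G by auto
    have "norm (evpow \<alpha> (f x)) \<le> C * (1 + 2 * norm (f x)) ^ Suc (card G)"
      by (rule C(2)[OF pb_evG[OF f x] d(2)[OF x]])
    also have "\<dots> \<le> C * (D * s x ^ K)"
      using D(2)[OF x] C(1) by (intro mult_left_mono)
    finally show "norm (evpow \<alpha> (f x)) \<le> (C * D) * s x ^ K" by (simp add: mult_ac)
  qed (use C D in auto)
qed

text \<open>The exponential of the soul is a polynomial in it, so only the exponential of the body,
  split off here, can grow faster than a power.\<close>

lemma pb_evexp:
  assumes f: "pb f"
  shows "pb (\<lambda>x. exp (- evbody (f x)) *\<^sub>R evexp (f x))"
proof -
  obtain D K where D: "D \<ge> 0" "\<And>x. x \<in> X \<Longrightarrow> (1 + 2 * norm (f x)) ^ card G \<le> D * s x ^ K"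
    using pb_one_plus_norm[OF f] by blast
  show ?thesis
  proof (rule pbI)
    fix x assume x: "x \<in> X"
    show "exp (- evbody (f x)) *\<^sub>R evexp (f x) \<in> evG G" using pb_evG[OF f x] finite_G by auto
    have "norm (exp (- evbody (f x)) *\<^sub>R evexp (f x)) \<le>
        exp (- evbody (f x)) * (exp (evbody (f x)) * (real (card G) + 1) * (1 + 2 * norm (f x)) ^ card G)"
      using norm_evexp_le[OF pb_evG[OF f x] finite_G] by simp
    also have "\<dots> = (real (card G) + 1) * (1 + 2 * norm (f x)) ^ card G"
      by (simp add: exp_minus)
    also have "\<dots> \<le> (real (card G) + 1) * (D * s x ^ K)"
      using D(2)[OF x] by (intro mult_left_mono) auto
    finally show "norm (exp (- evbody (f x)) *\<^sub>R evexp (f x)) \<le> ((real (card G) + 1) * D) * s x ^ K"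
      by (simp add: mult_ac)
  qed (use D in auto)
qed

lemmas pb_intros = pb_const pb_add pb_diff pb_minus pb_mult pb_power pb_sum pb_scaleR

end

lemma deriv_of_real_ev:
  "((\<lambda>t. of_real (t\<^sup>2) :: 'g::linorder ev) has_vector_derivative of_real (2 * t)) (at t)"
  "((\<lambda>t. of_real (t * a) :: 'g ev) has_vector_derivative of_real a) (at t)"
  "((\<lambda>t. of_real (a * t) :: 'g ev) has_vector_derivative of_real a) (at t)"
  by (rule has_vector_derivative_of_real_ev, auto intro!: derivative_eq_intros)+

lemma deriv_hyp:
  "((\<lambda>x. hyp (x, y)) has_real_derivative x / hyp (x, y)) (at x)"
  "((\<lambda>y. hyp (x, y)) has_real_derivative y / hyp (x, y)) (at y)"
proof -
  have pos: "1 + x\<^sup>2 + y\<^sup>2 > 0" by (simp add: add_pos_nonneg)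
  show "((\<lambda>x. hyp (x, y)) has_real_derivative x / hyp (x, y)) (at x)"
    unfolding hyp_def fst_conv snd_conv
    by (rule DERIV_cong, rule DERIV_chain2[where f = sqrt and g = "\<lambda>x. 1 + x\<^sup>2 + y\<^sup>2", OF DERIV_real_sqrt[OF pos]], (rule derivative_eq_intros refl)+)
      (simp add: field_simps)
  show "((\<lambda>y. hyp (x, y)) has_real_derivative y / hyp (x, y)) (at y)"
    unfolding hyp_def fst_conv snd_conv
    by (rule DERIV_cong, rule DERIV_chain2[where f = sqrt and g = "\<lambda>y. 1 + x\<^sup>2 + y\<^sup>2", OF DERIV_real_sqrt[OF pos]], (rule derivative_eq_intros refl)+)
      (simp add: field_simps)
qed

lemmas deriv_hyp_ev = deriv_hyp[THEN has_vector_derivative_of_real_ev]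

text \<open>The algebra behind \<open>deriv_J\<close>: \<open>S\<close> and \<open>I\<close> stand
  for \<open>hyp\<close> and its inverse, \<open>c\<close> and \<open>k\<close> for
  \<open>c t\<close> and \<open>ic t\<close>, \<open>Z\<close> for the \<open>t\<close>-derivative
  of \<open>Q\<close>, and \<open>f1\<close>, \<open>f2\<close>, \<open>f3\<close> for values of the
  derivatives of \<open>F\<close>. The coefficients of the three are compared one by one.\<close>

lemma path_identity:
  fixes S I x y t b1 b2 c k \<theta> d f1 f2 f3 :: "'a::comm_ring_1"
  assumes SI: "S * I = 1" and ck: "c * k = 1" and tt: "\<theta> * \<theta> = 0" and d: "d = b1 ^ 2 + b2 ^ 2 + 2 * \<theta>"
  defines "Z \<equiv> S * (t * d * k) - x * b1 - y * b2"
  shows "I ^ 3 * (f1 * Z) - (I ^ 2 * c * (f2 * Z) + I ^ 2 * (t * d * k) * f1) +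
     (t ^ 2 * (I * \<theta> * (f3 * Z)) + 2 * t * (I * \<theta> * f2)) =
     (- b1 * (x * I ^ 3 * f1 + (t ^ 2 * \<theta> * k * f3 - I * f2) * (x * I * c - t * b1))) +
     (- b2 * (y * I ^ 3 * f1 + (t ^ 2 * \<theta> * k * f3 - I * f2) * (y * I * c - t * b2)))"
proof -
  let ?X = "x * b1 + y * b2" and ?B = "b1 ^ 2 + b2 ^ 2"
  have "I ^ 3 * Z - I ^ 2 * (t * d * k) = I ^ 2 * (S * I) * (t * d * k) - I ^ 3 * ?X - I ^ 2 * (t * d * k)"
    unfolding Z_def by (simp add: algebra_simps power2_eq_square power3_eq_cube)
  then have 1: "I ^ 3 * Z - I ^ 2 * (t * d * k) = - (I ^ 3 * ?X)" by (simp add: SI)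
  \<comment> \<open>The term \<open>2 * t * I * \<theta>\<close>, from differentiating
    \<open>t^2\<close>, cancels the contribution of \<open>2 * \<theta>\<close> in
    \<open>d\<close>.\<close>
  have "2 * t * I * \<theta> - I ^ 2 * c * Z = 2 * t * I * \<theta> - (S * I) * (c * k) * (I * t * d) + I ^ 2 * c * ?X"
    unfolding Z_def by (simp add: algebra_simps power2_eq_square)
  then have 2: "2 * t * I * \<theta> - I ^ 2 * c * Z = I ^ 2 * c * ?X - I * t * ?B"
    unfolding SI ck d by (simp add: algebra_simps)
  \<comment> \<open>Here the part \<open>2 * \<theta>\<close> of \<open>d\<close> drops out against
    the factor \<open>\<theta>\<close>.\<close>
  have "t ^ 2 * I * \<theta> * Z = t ^ 2 * \<theta> * ((S * I) * (t * ?B * k)) + 2 * t ^ 2 * (S * I) * t * k * (\<theta> * \<theta>) - t ^ 2 * I * \<theta> * ((c * k) * ?X)"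
    unfolding Z_def d ck by (simp add: algebra_simps power2_eq_square)
  then have 3: "t ^ 2 * I * \<theta> * Z = t ^ 2 * \<theta> * (t * ?B * k) - t ^ 2 * I * \<theta> * (c * k * ?X)"
    unfolding SI tt by simp
  have "I ^ 3 * (f1 * Z) - (I ^ 2 * c * (f2 * Z) + I ^ 2 * (t * d * k) * f1) +
     (t ^ 2 * (I * \<theta> * (f3 * Z)) + 2 * t * (I * \<theta> * f2)) =
     f1 * (I ^ 3 * Z - I ^ 2 * (t * d * k)) + f2 * (2 * t * I * \<theta> - I ^ 2 * c * Z) + f3 * (t ^ 2 * I * \<theta> * Z)"
    by (simp add: algebra_simps)
  also have "\<dots> = (- b1 * (x * I ^ 3 * f1 + (t ^ 2 * \<theta> * k * f3 - I * f2) * (x * I * c - t * b1))) +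
     (- b2 * (y * I ^ 3 * f1 + (t ^ 2 * \<theta> * k * f3 - I * f2) * (y * I * c - t * b2)))"
    unfolding 1 2 3 by (simp add: algebra_simps power2_eq_square power3_eq_cube)
  finally show ?thesis .
qed

text \<open>
  \<open>F i\<close> is the \<open>i\<close>-th derivative of \<open>F 0\<close>. Measurability is stated for each type of domain that
  occurs below because locale assumptions are monomorphic.
\<close>

locale super_fun =
  fixes G :: "'g::linorder set" and F :: "nat \<Rightarrow> 'g ev \<Rightarrow> 'g ev"
  assumes fin: "finite G"
    and F_evG: "\<And>i q. q \<in> evG G \<Longrightarrow> F i q \<in> evG G"
    and F_chain: "\<And>i q q' t. i < 3 \<Longrightarrow> (q has_vector_derivative q') (at t) \<Longrightarrow> (\<And>t. q t \<in> evG G) \<Longrightarrow>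
      evbody (q t) > 0 \<Longrightarrow> ((\<lambda>t. F i (q t)) has_vector_derivative F (Suc i) (q t) * q') (at t)"
    and F_bound: "\<And>i. i \<le> 3 \<Longrightarrow> \<exists>C\<ge>0. \<exists>K. \<forall>q\<in>evG G. evbody q > 0 \<longrightarrow> norm (F i q) \<le> C * (1 + 2 * norm q) ^ K * exp (- evbody q)"
    and F_evm: "\<And>i (M :: (real \<times> real \<times> real) measure) q. evm M q \<Longrightarrow> (\<And>x. q x \<in> evG G) \<Longrightarrow> evm M (\<lambda>x. F i (q x))"
    and F_evm2: "\<And>i (M :: (real \<times> real) measure) q. evm M q \<Longrightarrow> (\<And>x. q x \<in> evG G) \<Longrightarrow> evm M (\<lambda>x. F i (q x))"
    and F_evm1: "\<And>i (M :: real measure) q. evm M q \<Longrightarrow> (\<And>x. q x \<in> evG G) \<Longrightarrow> evm M (\<lambda>x. F i (q x))"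

text \<open>
  In the field \<open>b = (b1, b2, b3, \<beta>1, \<beta>2)\<close> the odd components enter through \<open>\<theta> = \<beta>1 \<beta>2\<close> only. The path
  \<open>(t b1, t b2, c t, t \<beta>1, t \<beta>2)\<close> joins \<open>(0, 0, m, 0, 0)\<close> to \<open>b\<close>, and \<open>c\<close> is chosen such that the inner
  square \<open>- m\<^sup>2\<close> stays constant. \<open>Q\<close> is the body part, with respect to \<open>\<xi>\<close> and \<open>\<eta>\<close>, of \<open>- \<langle>v, b\<rangle>\<close>, and \<open>J\<close> is the
  Berezin derivative of \<open>F (- \<langle>v, b\<rangle>) / z\<close> (see \<open>single_spin\<close>). Along the path, \<open>J\<close> changes by a total
  divergence (\<open>deriv_J\<close>).
\<close>

locale super_path = super_fun G F
  for G :: "'g::linorder set" and F +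
  fixes b1 b2 b3 \<theta> m :: "'g ev"
  assumes evG: "b1 \<in> evG G" "b2 \<in> evG G" "b3 \<in> evG G" "\<theta> \<in> evG G" "m \<in> evG G"
    and m_square: "m ^ 2 = b3 ^ 2 - b1 ^ 2 - b2 ^ 2 - 2 * \<theta>"
    and theta_square: "\<theta> * \<theta> = 0"
    and body_pos: "evbody b3 > 0" "evbody m > 0"
begin

text \<open>The inner square of the field without its third component; constancy of the full inner
  square then reads \<open>c t ^ 2 - t ^ 2 * d = m ^ 2\<close>.\<close>

definition "d = b1 ^ 2 + b2 ^ 2 + 2 * \<theta>"
definition "\<rho> t = m ^ 2 + of_real (t ^ 2) * d"
definition "c t = evpow (1/2) (\<rho> t)"
definition "ic t = evpow (-1/2) (\<rho> t)"
definition "Q t p = of_real (hyp p) * c t - of_real (t * fst p) * b1 - of_real (t * snd p) * b2"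
definition I :: "real \<times> real \<Rightarrow> 'g ev" where "I p = of_real (1 / hyp p)"
definition "J t p = I p ^ 3 * F 0 (Q t p) - I p ^ 2 * c t * F 1 (Q t p) + of_real (t ^ 2) * (I p * \<theta> * F 2 (Q t p))"
text \<open>The planar vector field \<open>(- b1 * V, - b2 * V)\<close> has the
  \<open>t\<close>-derivative of \<open>J\<close> as its divergence. \<open>DV\<close> is the
  derivative of \<open>V\<close> in the coordinate with value \<open>r\<close> and field component
  \<open>b\<close>.\<close>

definition "V t p = of_real (t ^ 2) * \<theta> * ic t * F 2 (Q t p) - I p * F 1 (Q t p)"
definition "DV t p r b = of_real r * I p ^ 3 * F 1 (Q t p) +
   (of_real (t ^ 2) * \<theta> * ic t * F 3 (Q t p) - I p * F 2 (Q t p)) * (of_real r * I p * c t - of_real t * b)"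

lemma body_theta: "evbody \<theta> = 0"
  using arg_cong[OF theta_square, of evbody] by simp

lemma body_rho: "evbody (\<rho> t) = evbody m ^ 2 + t ^ 2 * (evbody b1 ^ 2 + evbody b2 ^ 2)"
  by (simp add: \<rho>_def d_def body_theta)

lemma body_rho_ge: "evbody (\<rho> t) \<ge> evbody m ^ 2"
  by (simp add: body_rho)

lemma body_rho_pos: "evbody (\<rho> t) > 0"
  using body_rho_ge[of t] body_pos(2) by (meson less_le_trans zero_less_power)

lemma evG_d: "d \<in> evG G" "2 \<in> evG G"
proof -
  show "2 \<in> evG G" using evG_simps(3)[of 2 G] by simp
  then show "d \<in> evG G" using evG unfolding d_def by (intro evG_simps evG_power)
qed

lemma evG_rho: "\<rho> t \<in> evG G"
  using evG evG_d unfolding \<rho>_def by (intro evG_simps evG_power)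

lemma evG_c: "c t \<in> evG G" "ic t \<in> evG G"
  using evG_rho fin unfolding c_def ic_def by auto

lemma evG_Q: "Q t p \<in> evG G"
  using evG evG_c unfolding Q_def by (intro evG_simps)

lemma c_ic: "c t * ic t = 1"
  unfolding c_def ic_def evpow_add[OF body_rho_pos] using body_rho_pos[of t] by simp

lemma c_0: "c 0 = m"
  using evpow_half_of_square[OF body_pos(2)] by (simp add: c_def \<rho>_def)

lemma c_1: "c 1 = b3"
  using evpow_half_of_square[OF body_pos(1)] by (simp add: c_def \<rho>_def d_def m_square)

lemma deriv_c: "(c has_vector_derivative of_real t * d * ic t) (at t)"
proof -
  have "(\<rho> has_vector_derivative of_real (2 * t) * d) (at t)"
    unfolding \<rho>_def
    by (rule has_vector_derivative_eq_rhs, (rule has_vector_derivative_add has_vector_derivative_mult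
        has_vector_derivative_const deriv_of_real_ev)+) simp
  from evpow_chain[OF this fin evG_rho body_rho_pos, of "1/2"]
  have "(c has_vector_derivative (1/2) *\<^sub>R evpow (1/2 - 1) (\<rho> t) * (of_real (2 * t) * d)) (at t)"
    unfolding c_def .
  moreover have "(1/2) *\<^sub>R evpow (1/2 - 1) (\<rho> t) * (of_real (2 * t) * d) = of_real t * d * ic t"
    by (simp add: ic_def scaleR_conv_of_real mult_ac flip: of_real_mult mult.assoc)
  ultimately show ?thesis by simp
qed

text \<open>Cauchy-Schwarz for the planar components, together with
  \<open>norm p \<le> hyp p\<close>.\<close>

lemma body_Q_ge:
  "evbody (Q t p) \<ge> hyp p * (sqrt (evbody m ^ 2 + t ^ 2 * (evbody b1 ^ 2 + evbody b2 ^ 2)) - \<bar>t\<bar> * sqrt (evbody b1 ^ 2 + evbody b2 ^ 2))"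
proof -
  let ?B = "sqrt (evbody b1 ^ 2 + evbody b2 ^ 2)"
  have "fst p * evbody b1 + snd p * evbody b2 = (fst p, snd p) \<bullet> (evbody b1, evbody b2)" by (cases p) simp
  then have "\<bar>fst p * evbody b1 + snd p * evbody b2\<bar> \<le> norm (fst p, snd p) * norm (evbody b1, evbody b2)"
    by (metis Cauchy_Schwarz_ineq2)
  also have "\<dots> \<le> hyp p * ?B"
    by (auto simp: norm_prod_def hyp_def intro!: mult_right_mono)
  finally have "\<bar>t\<bar> * \<bar>fst p * evbody b1 + snd p * evbody b2\<bar> \<le> \<bar>t\<bar> * (hyp p * ?B)"
    by (rule mult_left_mono) simp
  then have "t * (fst p * evbody b1 + snd p * evbody b2) \<le> \<bar>t\<bar> * (hyp p * ?B)"
    by (rule order_trans[OF abs_ge_self, of "t * (fst p * evbody b1 + snd p * evbody b2)", unfolded abs_mult])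
  moreover have "evbody (c t) = sqrt (evbody m ^ 2 + t ^ 2 * (evbody b1 ^ 2 + evbody b2 ^ 2))"
    unfolding c_def evbody_evpow body_rho by (rule powr_half_sqrt) simp
  ultimately show ?thesis
    by (simp add: Q_def algebra_simps)
qed

lemma body_Q_pos: "evbody (Q t p) > 0"
proof -
  have "\<bar>t\<bar> * sqrt (evbody b1 ^ 2 + evbody b2 ^ 2) = sqrt (t ^ 2 * (evbody b1 ^ 2 + evbody b2 ^ 2))"
    by (simp add: real_sqrt_mult)
  also have "\<dots> < sqrt (evbody m ^ 2 + t ^ 2 * (evbody b1 ^ 2 + evbody b2 ^ 2))"
    using body_pos by simp
  finally show ?thesis
    using body_Q_ge[of p t] hyp_pos[of p] by (smt (verit) mult_pos_pos)
qed

text \<open>Uniformity along the path turns the factor \<open>exp (- evbody q)\<close> of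
  \<open>F_bound\<close> into exponential decay in \<open>hyp p\<close>.\<close>

lemma body_Q_lower: "\<exists>\<epsilon>>0. \<forall>t\<in>{0..1}. \<forall>p. evbody (Q t p) \<ge> \<epsilon> * hyp p"
proof -
  define A where "A = evbody m ^ 2"
  define B where "B = evbody b1 ^ 2 + evbody b2 ^ 2"
  have AB: "A > 0" "B \<ge> 0" using body_pos by (auto simp: A_def B_def)
  \<comment> \<open>The difference of the two roots is
    \<open>(u^2 - v^2) / (u + v) = A / (u + v)\<close>, and the denominator is at most
    \<open>2 * sqrt (A + B)\<close> for \<open>t \<le> 1\<close>.\<close>
  define \<epsilon> where "\<epsilon> = A / (2 * sqrt (A + B))"
  have "\<epsilon> \<le> sqrt (A + t ^ 2 * B) - t * sqrt B" if t: "0 \<le> t" "t \<le> 1" for t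
  proof -
    let ?u = "sqrt (A + t ^ 2 * B)" and ?v = "t * sqrt B"
    have u: "?u > 0" "?v \<ge> 0" using AB t by (auto intro: add_pos_nonneg)
    have "t\<^sup>2 \<le> 1" using t by (simp add: power_le_one)
    then have "t\<^sup>2 * B \<le> 1 * B" using AB by (intro mult_right_mono) auto
    then have 1: "?u \<le> sqrt (A + B)" by simp
    have "?v = sqrt (t\<^sup>2 * B)" using t by (simp add: real_sqrt_mult)
    also have "\<dots> \<le> ?u" using AB by simp
    finally have 2: "?v \<le> ?u" .
    have "(?u - ?v) * (?u + ?v) = ?u\<^sup>2 - ?v\<^sup>2" by (simp add: algebra_simps power2_eq_square)
    also have "\<dots> = A" using AB by (simp add: power_mult_distrib)
    finally have "(?u - ?v) * (?u + ?v) = A" .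
    moreover have "?u + ?v > 0" using u by (rule add_pos_nonneg)
    ultimately have "?u - ?v = A / (?u + ?v)" by (simp add: eq_divide_eq)
    moreover have "?u + ?v \<le> 2 * sqrt (A + B)" using 1 2 by linarith
    moreover have "A / (2 * sqrt (A + B)) \<le> A / (?u + ?v)"
      using AB \<open>?u + ?v > 0\<close> \<open>?u + ?v \<le> 2 * sqrt (A + B)\<close> by (intro divide_left_mono mult_pos_pos) auto
    ultimately show ?thesis by (simp add: \<epsilon>_def)
  qed
  then have "evbody (Q t p) \<ge> \<epsilon> * hyp p" if "t \<in> {0..1}" for t p
    using body_Q_ge[of p t] that hyp_pos[of p]
    by (smt (verit) A_def B_def abs_of_nonneg atLeastAtMost_iff mult.commute mult_left_mono)
  moreover have "\<epsilon> > 0" using AB by (simp add: \<epsilon>_def)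
  ultimately show ?thesis by blast
qed

lemma deriv_inverse_hyp:
  "((\<lambda>x. 1 / hyp (x, y)) has_real_derivative - x * (1 / hyp (x, y)) ^ 3) (at x)"
  "((\<lambda>y. 1 / hyp (x, y)) has_real_derivative - y * (1 / hyp (x, y)) ^ 3) (at y)"
  using hyp_pos[of "(x, y)"]
  by (auto intro!: derivative_eq_intros deriv_hyp simp: power3_eq_cube)

lemma deriv_V:
  "((\<lambda>x. V t (x, y)) has_vector_derivative DV t (x, y) x b1) (at x)"
  "((\<lambda>y. V t (x, y)) has_vector_derivative DV t (x, y) y b2) (at y)"
proof -
  have I: "((\<lambda>x. I (x, y)) has_vector_derivative of_real (- x * (1 / hyp (x, y)) ^ 3)) (at x)"
    unfolding I_def by (rule has_vector_derivative_of_real_ev[OF deriv_inverse_hyp(1)])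
  have I': "((\<lambda>y. I (x, y)) has_vector_derivative of_real (- y * (1 / hyp (x, y)) ^ 3)) (at y)"
    unfolding I_def by (rule has_vector_derivative_of_real_ev[OF deriv_inverse_hyp(2)])
  have Q1: "((\<lambda>x. Q t (x, y)) has_vector_derivative of_real x * I (x, y) * c t - of_real t * b1) (at x)"
    unfolding Q_def fst_conv snd_conv
    by (rule has_vector_derivative_eq_rhs, (rule has_vector_derivative_diff has_vector_derivative_mult
        has_vector_derivative_const deriv_hyp_ev deriv_of_real_ev)+)
      (simp add: I_def divide_inverse)
  have Q2: "((\<lambda>y. Q t (x, y)) has_vector_derivative of_real y * I (x, y) * c t - of_real t * b2) (at y)"
    unfolding Q_def fst_conv snd_conv
    by (rule has_vector_derivative_eq_rhs, (rule has_vector_derivative_diff has_vector_derivative_mult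
        has_vector_derivative_const deriv_hyp_ev deriv_of_real_ev)+)
      (simp add: I_def divide_inverse)
  have F1: "((\<lambda>x. F 1 (Q t (x, y))) has_vector_derivative F 2 (Q t (x, y)) * (of_real x * I (x, y) * c t - of_real t * b1)) (at x)"
      "((\<lambda>x. F 2 (Q t (x, y))) has_vector_derivative F 3 (Q t (x, y)) * (of_real x * I (x, y) * c t - of_real t * b1)) (at x)"
    using F_chain[OF _ Q1 evG_Q body_Q_pos, of 1] F_chain[OF _ Q1 evG_Q body_Q_pos, of 2]
    by (simp_all add: numeral_2_eq_2 numeral_3_eq_3)
  have F2: "((\<lambda>y. F 1 (Q t (x, y))) has_vector_derivative F 2 (Q t (x, y)) * (of_real y * I (x, y) * c t - of_real t * b2)) (at y)"
      "((\<lambda>y. F 2 (Q t (x, y))) has_vector_derivative F 3 (Q t (x, y)) * (of_real y * I (x, y) * c t - of_real t * b2)) (at y)"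
    using F_chain[OF _ Q2 evG_Q body_Q_pos, of 1] F_chain[OF _ Q2 evG_Q body_Q_pos, of 2]
    by (simp_all add: numeral_2_eq_2 numeral_3_eq_3)
  show "((\<lambda>x. V t (x, y)) has_vector_derivative DV t (x, y) x b1) (at x)"
    unfolding V_def
    by (rule has_vector_derivative_eq_rhs, (rule F1 I has_vector_derivative_diff has_vector_derivative_mult
        has_vector_derivative_const)+) (simp add: DV_def I_def algebra_simps)
  show "((\<lambda>y. V t (x, y)) has_vector_derivative DV t (x, y) y b2) (at y)"
    unfolding V_def
    by (rule has_vector_derivative_eq_rhs, (rule F2 I' has_vector_derivative_diff has_vector_derivative_mult
        has_vector_derivative_const)+) (simp add: DV_def I_def algebra_simps)
qed

lemma deriv_J: "((\<lambda>t. J t p) has_vector_derivative (- b1 * DV t p (fst p) b1) + (- b2 * DV t p (snd p) b2)) (at t)"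
proof -
  define Qd where "Qd = of_real (hyp p) * (of_real t * d * ic t) - of_real (fst p) * b1 - of_real (snd p) * b2"
  have Q: "((\<lambda>t. Q t p) has_vector_derivative Qd) (at t)"
    unfolding Q_def Qd_def
    by (rule has_vector_derivative_eq_rhs, (rule has_vector_derivative_diff has_vector_derivative_mult
        has_vector_derivative_const deriv_of_real_ev deriv_c)+) simp
  have F: "((\<lambda>t. F 0 (Q t p)) has_vector_derivative F 1 (Q t p) * Qd) (at t)"
      "((\<lambda>t. F 1 (Q t p)) has_vector_derivative F 2 (Q t p) * Qd) (at t)"
      "((\<lambda>t. F 2 (Q t p)) has_vector_derivative F 3 (Q t p) * Qd) (at t)"
    using F_chain[OF _ Q evG_Q body_Q_pos, of 0] F_chain[OF _ Q evG_Q body_Q_pos, of 1] F_chain[OF _ Q evG_Q body_Q_pos, of 2]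
    by (simp_all add: numeral_2_eq_2 numeral_3_eq_3)
  let ?S = "of_real (hyp p)" and ?I = "I p" and ?t = "of_real t" and ?x = "of_real (fst p)" and ?y = "of_real (snd p)"
  have "((\<lambda>t. J t p) has_vector_derivative
     ?I ^ 3 * (F 1 (Q t p) * Qd) - (?I ^ 2 * c t * (F 2 (Q t p) * Qd) + ?I ^ 2 * (?t * d * ic t) * F 1 (Q t p)) +
     (?t ^ 2 * (?I * \<theta> * (F 3 (Q t p) * Qd)) + 2 * ?t * (?I * \<theta> * F 2 (Q t p)))) (at t)"
    unfolding J_def
    by (rule has_vector_derivative_eq_rhs, (rule F deriv_of_real_ev deriv_c has_vector_derivative_add has_vector_derivative_diff
        has_vector_derivative_mult has_vector_derivative_const)+) simp
  moreover have "?I ^ 3 * (f1 * Qd) - (?I ^ 2 * c t * (f2 * Qd) + ?I ^ 2 * (?t * d * ic t) * f1) +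
     (?t ^ 2 * (?I * \<theta> * (f3 * Qd)) + 2 * ?t * (?I * \<theta> * f2)) =
     (- b1 * (?x * ?I ^ 3 * f1 + (?t ^ 2 * \<theta> * ic t * f3 - ?I * f2) * (?x * ?I * c t - ?t * b1))) +
     (- b2 * (?y * ?I ^ 3 * f1 + (?t ^ 2 * \<theta> * ic t * f3 - ?I * f2) * (?y * ?I * c t - ?t * b2)))" for f1 f2 f3
  proof -
    have SI: "?S * ?I = 1" using hyp_pos[of p] by (simp add: I_def flip: of_real_mult)
    show ?thesis
      unfolding Qd_def by (rule path_identity[OF SI c_ic theta_square d_def])
  qed
  ultimately show ?thesis
    unfolding DV_def by simp
qed

end

context super_path
begin

section \<open>Decay and measurability along the path\<close>

interpretation g: growth G "{0..1} \<times> UNIV" "\<lambda>x :: real \<times> real \<times> real. hyp (snd x)"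
  by unfold_locales (auto simp: fin hyp_ge_1)

lemma pb_t: "g.pb (\<lambda>x. of_real (fst x))" "g.pb (\<lambda>x. of_real (fst x ^ 2))"
  by (rule g.pb_of_real[where C = 1 and K = 0]; simp add: mem_Times_iff power_le_one abs_le_iff)+

lemma pb_xy: "g.pb (\<lambda>x. of_real (fst (snd x)))" "g.pb (\<lambda>x. of_real (snd (snd x)))" "g.pb (\<lambda>x. of_real (hyp (snd x)))"
  by (rule g.pb_of_real[where C = 1 and K = 1]; simp add: abs_le_hyp hyp_pos less_imp_le del: split_paired_All)+

lemma pb_I: "g.pb (\<lambda>x. I (snd x))"
  unfolding I_def
proof (rule g.pb_of_real[where C = 1 and K = 0])
  fix x :: "real \<times> real \<times> real"
  show "\<bar>1 / hyp (snd x)\<bar> \<le> 1 * hyp (snd x) ^ 0"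
    using hyp_ge_1[of "snd x"] by simp
qed simp

lemma pb_rho: "g.pb (\<lambda>x. \<rho> (fst x))"
  using evG evG_d pb_t unfolding \<rho>_def by (intro g.pb_intros) auto

lemma pb_c: "g.pb (\<lambda>x. c (fst x))" "g.pb (\<lambda>x. ic (fst x))"
  unfolding c_def ic_def
  by (rule g.pb_evpow[OF pb_rho, of "evbody m ^ 2"], use body_rho_ge body_pos in auto)+

lemma pb_Q: "g.pb (\<lambda>x. Q (fst x) (snd x))"
  using evG unfolding Q_def of_real_mult by (intro g.pb_intros pb_t pb_xy pb_c) auto

text \<open>The bound required by \<open>path_divergence\<close>, with a constant that is uniform in
  \<open>t\<close>.\<close>

definition dec :: "(real \<Rightarrow> real \<times> real \<Rightarrow> 'g ev) \<Rightarrow> bool" where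
  "dec E \<longleftrightarrow> (\<exists>C. \<forall>t\<in>{0..1}. \<forall>p. norm (E t p) \<le> C / hyp p ^ 4)"

lemma dec_add: "dec E \<Longrightarrow> dec E' \<Longrightarrow> dec (\<lambda>t p. E t p + E' t p)"
  unfolding dec_def
  by (elim exE) (rename_tac C C', rule_tac x = "C + C'" in exI,
      auto simp: add_divide_distrib intro!: order_trans[OF norm_triangle_ineq] add_mono)

lemma dec_const_mult:
  assumes "dec E"
  shows "dec (\<lambda>t p. a * E t p)"
proof -
  obtain C where "\<forall>t\<in>{0..1}. \<forall>p. norm (E t p) \<le> C / hyp p ^ 4"
    using assms by (auto simp: dec_def)
  then have le: "norm (E t p) \<le> C / hyp p ^ 4" if "t \<in> {0..1}" for t p using that by blast
  have "norm (a * E t p) \<le> (norm a * C) / hyp p ^ 4" if "t \<in> {0..1}" for t p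
    using order_trans[OF norm_mult_ineq mult_left_mono[OF le[OF that] norm_ge_zero]] by simp
  then show ?thesis unfolding dec_def by blast
qed

lemma dec_diff: "dec E \<Longrightarrow> dec E' \<Longrightarrow> dec (\<lambda>t p. E t p - E' t p)"
  using dec_add[OF _ dec_const_mult, of E E' "-1"] by simp

text \<open>\<open>F\<close> decays exponentially in the body of \<open>Q\<close>, hence in
  \<open>hyp p\<close>, and this beats the polynomial growth of the prefactor and of
  \<open>norm (Q t p)\<close>.\<close>

lemma dec_F:
  assumes A: "g.pb (\<lambda>x. A (fst x) (snd x))" and i: "i \<le> 3"
  shows "dec (\<lambda>t p. A t p * F i (Q t p))"
proof -
  obtain Ca Ka where Ca: "Ca \<ge> 0" "\<And>x. x \<in> {0..1} \<times> UNIV \<Longrightarrow> norm (A (fst x) (snd x)) \<le> Ca * hyp (snd x) ^ Ka"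
    using g.pb_bound[OF A] by blast
  obtain Cf Kf where Cf: "Cf \<ge> 0" "\<And>q. q \<in> evG G \<Longrightarrow> evbody q > 0 \<Longrightarrow> norm (F i q) \<le> Cf * (1 + 2 * norm q) ^ Kf * exp (- evbody q)"
    using F_bound[OF i] by blast
  obtain Cq Kq where Cq: "Cq \<ge> 0" "\<And>x. x \<in> {0..1} \<times> UNIV \<Longrightarrow> (1 + 2 * norm (Q (fst x) (snd x))) ^ Kf \<le> Cq * hyp (snd x) ^ Kq"
    using g.pb_one_plus_norm[OF pb_Q, of Kf] by blast
  obtain \<epsilon> where \<epsilon>: "\<epsilon> > 0" "\<And>t p. t \<in> {0..1} \<Longrightarrow> evbody (Q t p) \<ge> \<epsilon> * hyp p"
    using body_Q_lower by blast
  obtain C where C: "C \<ge> 0" "\<And>s. s \<ge> 1 \<Longrightarrow> Ca * Cf * Cq * s ^ (Ka + Kq) * exp (- \<epsilon> * s) \<le> C / s ^ 4"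
    using power_exp_decay[OF \<epsilon>(1), of "Ca * Cf * Cq" "Ka + Kq" 4] Ca Cf Cq by auto
  have "norm (A t p * F i (Q t p)) \<le> C / hyp p ^ 4" if t: "t \<in> {0..1}" for t p
  proof -
    have "norm (A t p * F i (Q t p)) \<le> norm (A t p) * norm (F i (Q t p))" by (rule norm_mult_ineq)
    also have "\<dots> \<le> (Ca * hyp p ^ Ka) * (Cf * (Cq * hyp p ^ Kq) * exp (- \<epsilon> * hyp p))"
    proof (rule mult_mono)
      show "norm (A t p) \<le> Ca * hyp p ^ Ka" using Ca(2)[of "(t, p)"] t by simp
      have "norm (F i (Q t p)) \<le> Cf * (1 + 2 * norm (Q t p)) ^ Kf * exp (- evbody (Q t p))"
        by (rule Cf(2)[OF evG_Q body_Q_pos])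
      also have "\<dots> \<le> Cf * (Cq * hyp p ^ Kq) * exp (- \<epsilon> * hyp p)"
        using Cq(2)[of "(t, p)"] t \<epsilon>(2)[OF t, of p] Cf(1) Cq(1) hyp_pos[of p]
        by (intro mult_mono mult_left_mono) auto
      finally show "norm (F i (Q t p)) \<le> Cf * (Cq * hyp p ^ Kq) * exp (- \<epsilon> * hyp p)" .
    qed (use Ca hyp_pos[of p] in auto)
    also have "\<dots> = Ca * Cf * Cq * hyp p ^ (Ka + Kq) * exp (- \<epsilon> * hyp p)"
      by (simp add: power_add mult_ac)
    also have "\<dots> \<le> C / hyp p ^ 4" by (rule C(2)[OF hyp_ge_1])
    finally show ?thesis .
  qed
  then show ?thesis unfolding dec_def by blast
qed

lemma dec_J: "dec J"
proof -
  have "dec (\<lambda>t p. (I p ^ 3) * F 0 (Q t p) - (I p ^ 2 * c t) * F 1 (Q t p) + (of_real (t ^ 2) * I p * \<theta>) * F 2 (Q t p))"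
    using evG by (intro dec_add dec_diff dec_F g.pb_intros pb_I pb_c pb_t) auto
  moreover have "J = (\<lambda>t p. (I p ^ 3) * F 0 (Q t p) - (I p ^ 2 * c t) * F 1 (Q t p) + (of_real (t ^ 2) * I p * \<theta>) * F 2 (Q t p))"
    by (simp add: J_def fun_eq_iff mult_ac)
  ultimately show ?thesis by simp
qed

lemma dec_V: "dec V"
  unfolding V_def[abs_def] using evG by (intro dec_diff dec_F g.pb_intros pb_I pb_c pb_t) auto

lemma dec_DV:
  assumes r: "g.pb (\<lambda>x. of_real (r (snd x)))" and b: "b \<in> evG G"
  shows "dec (\<lambda>t p. DV t p (r p) b)"
proof -
  let ?Z = "\<lambda>t p. of_real (r p) * I p * c t - of_real t * b"
  have "dec (\<lambda>t p. (of_real (r p) * I p ^ 3) * F 1 (Q t p) +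
     ((of_real (t ^ 2) * \<theta> * ic t * ?Z t p) * F 3 (Q t p) - (I p * ?Z t p) * F 2 (Q t p)))"
    using evG b r by (intro dec_add dec_diff dec_F g.pb_intros pb_I pb_c pb_t) auto
  then show ?thesis
    by (simp add: DV_def algebra_simps)
qed

lemma evm_t:
  "evm lborel (\<lambda>x :: real \<times> real \<times> real. of_real (fst x))"
  "evm lborel (\<lambda>x :: real \<times> real \<times> real. of_real (fst x ^ 2))"
  "evm lborel (\<lambda>x :: real \<times> real \<times> real. of_real (fst (snd x)))"
  "evm lborel (\<lambda>x :: real \<times> real \<times> real. of_real (snd (snd x)))"
  "evm lborel (\<lambda>x :: real \<times> real \<times> real. of_real (hyp (snd x)))"
  "evm lborel (\<lambda>x :: real \<times> real \<times> real. I (snd x))"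
  unfolding I_def hyp_def
  by (rule evm_of_real, unfold measurable_lborel2, rule borel_measurable_continuous_onI,
      (auto intro!: continuous_intros simp: add_nonneg_eq_0_iff)[])+

lemma evm_rho: "evm lborel (\<lambda>x :: real \<times> real \<times> real. \<rho> (fst x))"
  unfolding \<rho>_def by (intro evm_add evm_mult evm_const evm_t)

lemma evm_c:
  "evm lborel (\<lambda>x :: real \<times> real \<times> real. c (fst x))"
  "evm lborel (\<lambda>x :: real \<times> real \<times> real. ic (fst x))"
  unfolding c_def ic_def
  by (rule evm_evpow[OF evm_rho evG_rho fin])+

lemma evm_Q: "evm lborel (\<lambda>x :: real \<times> real \<times> real. Q (fst x) (snd x))"
  unfolding Q_def of_real_mult by (intro evm_diff evm_mult evm_const evm_t evm_c)

lemma evm_F: "evm lborel (\<lambda>x :: real \<times> real \<times> real. F i (Q (fst x) (snd x)))"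
  by (rule F_evm[OF evm_Q evG_Q])

lemma evm_J: "evm lborel (\<lambda>x :: real \<times> real \<times> real. J (fst x) (snd x))"
  unfolding J_def by (intro evm_add evm_diff evm_mult evm_power evm_const evm_t evm_c evm_F)

lemma evm_DV:
  assumes "evm lborel (\<lambda>x :: real \<times> real \<times> real. of_real (r (snd x)) :: 'g ev)"
  shows "evm lborel (\<lambda>x :: real \<times> real \<times> real. - a * DV (fst x) (snd x) (r (snd x)) b)"
  unfolding DV_def by (intro evm_add evm_diff evm_mult evm_power evm_const evm_t evm_c evm_F assms)

lemma evm_slice:
  assumes "evm lborel (\<lambda>x :: real \<times> real \<times> real. E (fst x) (snd x))"
  shows "(\<lambda>p. evcoeff (E t p) S) \<in> borel_measurable lborel"
proof -
  have "(\<lambda>x :: real \<times> real \<times> real. evcoeff (E (fst x) (snd x)) S) \<in> borel_measurable (lborel \<Otimes>\<^sub>M lborel)"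
    using evmD[OF assms] by (simp add: lborel_prod)
  from measurable_compose[OF measurable_Pair1' this, of t] show ?thesis by simp
qed

lemma decD:
  assumes "dec E"
  shows "\<exists>C. \<forall>t p S. 0 \<le> t \<longrightarrow> t \<le> 1 \<longrightarrow> \<bar>evcoeff (E t p) S\<bar> \<le> C / hyp p ^ 4"
  using assms unfolding dec_def by (meson atLeastAtMost_iff evcoeff_le_norm order_trans)

lemma integrable_dec:
  assumes "dec E" "evm lborel (\<lambda>x :: real \<times> real \<times> real. E (fst x) (snd x))" "0 \<le> t" "t \<le> 1"
  shows "integrable lborel (\<lambda>p. evcoeff (E t p) S)"
proof -
  obtain C where C: "\<And>t p S. 0 \<le> t \<Longrightarrow> t \<le> 1 \<Longrightarrow> \<bar>evcoeff (E t p) S\<bar> \<le> C / hyp p ^ 4"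
    using decD[OF assms(1)] by blast
  show ?thesis
  proof (rule Bochner_Integration.integrable_bound)
    show "integrable lborel (\<lambda>p. C * (1 / hyp p ^ 4))"
      by (intro integrable_mult_right integrable_hyp_power)
    show "AE p in lborel. norm (evcoeff (E t p) S) \<le> norm (C * (1 / hyp p ^ 4))"
    proof (rule AE_I2)
      fix p
      have "\<bar>evcoeff (E t p) S\<bar> \<le> \<bar>C / hyp p ^ 4\<bar>"
        by (rule order_trans[OF C[OF assms(3,4)] abs_ge_self])
      then show "norm (evcoeff (E t p) S) \<le> norm (C * (1 / hyp p ^ 4))" by simp
    qed
  qed (rule evm_slice[OF assms(2)])
qed

lemma integral_J_invariant: "(\<integral>p. evcoeff (J 1 p) S \<partial>lborel) = (\<integral>p. evcoeff (J 0 p) S \<partial>lborel)"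
proof -
  obtain C1 where C1: "\<And>t p S. 0 \<le> t \<Longrightarrow> t \<le> 1 \<Longrightarrow> \<bar>evcoeff (- b1 * DV t p (fst p) b1) S\<bar> \<le> C1 / hyp p ^ 4"
    using decD[OF dec_const_mult[OF dec_DV[OF pb_xy(1) evG(1)]]] by blast
  obtain C2 where C2: "\<And>t p S. 0 \<le> t \<Longrightarrow> t \<le> 1 \<Longrightarrow> \<bar>evcoeff (- b2 * DV t p (snd p) b2) S\<bar> \<le> C2 / hyp p ^ 4"
    using decD[OF dec_const_mult[OF dec_DV[OF pb_xy(2) evG(2)]]] by blast
  obtain C3 where C3: "\<And>t p S. 0 \<le> t \<Longrightarrow> t \<le> 1 \<Longrightarrow> \<bar>evcoeff (- b1 * V t p) S\<bar> \<le> C3 / hyp p ^ 4"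
    using decD[OF dec_const_mult[OF dec_V]] by blast
  obtain C4 where C4: "\<And>t p S. 0 \<le> t \<Longrightarrow> t \<le> 1 \<Longrightarrow> \<bar>evcoeff (- b2 * V t p) S\<bar> \<le> C4 / hyp p ^ 4"
    using decD[OF dec_const_mult[OF dec_V]] by blast
  have mult: "((\<lambda>x. a * f x) has_vector_derivative a * f') (at x)"
    if "(f has_vector_derivative f') (at x)" for f f' and a :: "'g ev" and x :: real
    using has_vector_derivative_mult[OF has_vector_derivative_const that, of a] by simp
  show ?thesis
  proof (rule path_divergence[where j = "\<lambda>t p. evcoeff (J t p) S"
      and ?y1.0 = "\<lambda>t p. evcoeff (- b1 * DV t p (fst p) b1) S" and ?y2.0 = "\<lambda>t p. evcoeff (- b2 * DV t p (snd p) b2) S"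
      and ?Y1.0 = "\<lambda>t p. evcoeff (- b1 * V t p) S" and ?Y2.0 = "\<lambda>t p. evcoeff (- b2 * V t p) S"])
    show "((\<lambda>t. evcoeff (J t p) S) has_real_derivative
        evcoeff (- b1 * DV t p (fst p) b1) S + evcoeff (- b2 * DV t p (snd p) b2) S) (at t)" for t p
      using vector_derivative_coeff[OF deriv_J, where S = S] by (simp only: evcoeff_simps)
    show "((\<lambda>a. evcoeff (- b1 * V t (a, b)) S) has_real_derivative
        evcoeff (- b1 * DV t (a, b) (fst (a, b)) b1) S) (at a)" for t a b
      unfolding fst_conv by (rule vector_derivative_coeff[OF mult[OF deriv_V(1)]])
    show "((\<lambda>b. evcoeff (- b2 * V t (a, b)) S) has_real_derivative
        evcoeff (- b2 * DV t (a, b) (snd (a, b)) b2) S) (at b)" for t a b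
      unfolding snd_conv by (rule vector_derivative_coeff[OF mult[OF deriv_V(2)]])
    show "(\<lambda>(t, p). evcoeff (- b1 * DV t p (fst p) b1) S) \<in> borel_measurable (lborel \<Otimes>\<^sub>M lborel)"
      using evmD[OF evm_DV[OF evm_t(3), of b1 b1], of S] by (simp add: lborel_prod split_beta)
    show "(\<lambda>(t, p). evcoeff (- b2 * DV t p (snd p) b2) S) \<in> borel_measurable (lborel \<Otimes>\<^sub>M lborel)"
      using evmD[OF evm_DV[OF evm_t(4), of b2 b2], of S] by (simp add: lborel_prod split_beta)
    show "integrable lborel (\<lambda>p. evcoeff (J 0 p) S)" "integrable lborel (\<lambda>p. evcoeff (J 1 p) S)"
      by (auto intro: integrable_dec[OF dec_J evm_J])
  qed (fact C1 C2 C3 C4)+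
qed

text \<open>At \<open>t = 0\<close> the field has neither planar nor odd part, so \<open>J 0\<close>
  is radial: it is \<open>- h' (hyp p) / hyp p\<close> with \<open>h s = F 0 (s * m) / s\<close>.
  Only the boundary value \<open>h 1\<close> survives.\<close>

lemma integral_J_0: "(\<integral>p. evcoeff (J 0 p) S \<partial>lborel) = 2 * pi * evcoeff (F 0 m) S"
proof -
  define h where "h s = evcoeff (of_real (1 / s) * F 0 (of_real s * m)) S" for s :: real
  define h' where "h' = (\<lambda>s. evcoeff (of_real (1 / s) * (F 1 (of_real s * m) * m) + of_real (- ((1 / s) ^ 2)) * F 0 (of_real s * m)) S)"
  have Q0: "Q 0 p = of_real (hyp p) * m" for p
    by (simp add: Q_def c_0)
  have J0: "evcoeff (J 0 p) S = - (h' (hyp p) / hyp p)" for p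
  proof -
    have "J 0 p = - ((1 / hyp p) *\<^sub>R (of_real (1 / hyp p) * (F 1 (of_real (hyp p) * m) * m) + of_real (- ((1 / hyp p) ^ 2)) * F 0 (of_real (hyp p) * m)))"
      unfolding J_def Q0 c_0 I_def scaleR_conv_of_real of_real_minus of_real_power
      by (simp add: algebra_simps power2_eq_square power3_eq_cube)
    then show ?thesis by (simp add: h'_def)
  qed
  have mq: "of_real s * m \<in> evG G" for s using evG by auto
  have h: "(h has_real_derivative h' s) (at s)" if s: "s > 0" for s
  proof -
    have 1: "((\<lambda>s. of_real s * m) has_vector_derivative m) (at s)"
      using has_vector_derivative_mult[OF has_vector_derivative_of_real_ev[OF DERIV_ident] has_vector_derivative_const, of m s] by simp
    have "((\<lambda>s. F 0 (of_real s * m)) has_vector_derivative F 1 (of_real s * m) * m) (at s)"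
      using F_chain[OF _ 1 mq, of 0] s body_pos by simp
    moreover have "((\<lambda>s. of_real (1 / s) :: 'g ev) has_vector_derivative of_real (- ((1 / s) ^ 2))) (at s)"
      using s by (intro has_vector_derivative_of_real_ev) (auto intro!: derivative_eq_intros simp: power2_eq_square)
    ultimately show ?thesis
      unfolding h_def[abs_def] h'_def by (intro vector_derivative_coeff has_vector_derivative_mult)
  qed
  have evm_m: "evm borel (\<lambda>s :: real. of_real s * m)" by (intro evm_mult evm_of_real evm_const) auto
  have h'm: "h' \<in> borel_measurable borel"
    unfolding h'_def
    by (intro evmD evm_add evm_mult evm_const F_evm1[OF evm_m mq] evm_of_real) measurable
  have int: "integrable lborel (\<lambda>p. h' (hyp p) / hyp p)"
    using integrable_minus[OF integrable_dec[OF dec_J evm_J, of 0 S]] by (simp add: J0)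
  have "dec (\<lambda>t p. I p * F 0 (Q t p))" by (rule dec_F[OF pb_I]) simp
  from decD[OF this] obtain C where C: "\<And>t p S. 0 \<le> t \<Longrightarrow> t \<le> 1 \<Longrightarrow> \<bar>evcoeff (I p * F 0 (Q t p)) S\<bar> \<le> C / hyp p ^ 4"
    by blast
  have lim: "(h \<longlongrightarrow> 0) at_top"
  proof (rule Lim_null_comparison)
    show "eventually (\<lambda>s. norm (h s) \<le> C / s ^ 4) at_top"
      using eventually_ge_at_top[of 1]
    proof eventually_elim
      case (elim s)
      \<comment> \<open>A point with \<open>hyp p = s\<close>, at which the decay bound in the plane
        becomes one for \<open>h s\<close>.\<close>
      define p where "p = (sqrt (s\<^sup>2 - 1), 0 :: real)"
      have "s\<^sup>2 \<ge> 1" using elim by simp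
      then have "hyp p = s" using elim by (simp add: hyp_def p_def)
      then show ?case using C[of 0 p S] by (simp add: h_def I_def Q0)
    qed
    show "((\<lambda>s. C / s ^ 4) \<longlongrightarrow> 0) at_top"
      by (intro tendsto_divide_0[OF tendsto_const] filterlim_at_top_imp_at_infinity filterlim_pow_at_top filterlim_ident) auto
  qed
  have "(\<integral>p. evcoeff (J 0 p) S \<partial>lborel) = - (\<integral>p. h' (hyp p) / hyp p \<partial>lborel)"
    unfolding J0 by simp
  also have "\<dots> = 2 * pi * h 1"
    using radial_divergence[OF h h'm int lim] by simp
  finally show ?thesis by (simp add: h_def)
qed

theorem localization:
  fixes S :: "'g set"
  defines "q \<equiv> \<lambda>p. of_real (hyp p) * b3 - of_real (fst p) * b1 - of_real (snd p) * b2"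
  defines "j \<equiv> \<lambda>p. of_real ((1 / hyp p) ^ 3) * F 0 (q p) - of_real ((1 / hyp p) ^ 2) * b3 * F 1 (q p) + of_real (1 / hyp p) * \<theta> * F 2 (q p)"
  shows "integrable lborel (\<lambda>p. evcoeff (j p) S)" "(\<integral>p. evcoeff (j p) S \<partial>lborel) = 2 * pi * evcoeff (F 0 m) S"
proof -
  have "j = J 1"
    by (simp add: j_def q_def J_def Q_def c_1 I_def fun_eq_iff mult_ac)
  then show "integrable lborel (\<lambda>p. evcoeff (j p) S)" "(\<integral>p. evcoeff (j p) S \<partial>lborel) = 2 * pi * evcoeff (F 0 m) S"
    using integral_J_invariant[of S] integral_J_0[of S] integrable_dec[OF dec_J evm_J, of 1 S] by auto
qed

end

text \<open>The derivatives of \<open>F q = exp (- q - sqrt (\<kappa> + \<omega> q))\<close> up to order three.\<close>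

definition sq_root :: "'g::linorder ev \<Rightarrow> real \<Rightarrow> real \<Rightarrow> 'g ev \<Rightarrow> 'g ev" where
  "sq_root \<kappa> \<omega> \<alpha> q = evpow \<alpha> (\<kappa> + of_real \<omega> * q)"

definition sq_exp :: "'g::linorder ev \<Rightarrow> real \<Rightarrow> 'g ev \<Rightarrow> 'g ev" where
  "sq_exp \<kappa> \<omega> q = evexp (- q - sq_root \<kappa> \<omega> (1/2) q)"

definition sq_fun :: "'g::linorder ev \<Rightarrow> real \<Rightarrow> nat \<Rightarrow> 'g ev \<Rightarrow> 'g ev" where
  "sq_fun \<kappa> \<omega> i q =
    (let L = 1 + (\<omega> / 2) *\<^sub>R sq_root \<kappa> \<omega> (-1/2) q; L1 = (- \<omega>\<^sup>2 / 4) *\<^sub>R sq_root \<kappa> \<omega> (-3/2) q;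
         L2 = (3 * \<omega> ^ 3 / 8) *\<^sub>R sq_root \<kappa> \<omega> (-5/2) q
     in sq_exp \<kappa> \<omega> q * (if i = 0 then 1 else if i = 1 then - L else if i = 2 then L ^ 2 - L1
          else 3 *\<^sub>R (L * L1) - L ^ 3 - L2))"

lemma sq_root_chain:
  assumes "finite G" "\<kappa> \<in> evG G" "evbody \<kappa> > 0" "\<omega> \<ge> 0"
    and q: "(q has_vector_derivative q') (at t)" "\<And>t. q t \<in> evG G" "evbody (q t) > 0"
  shows "((\<lambda>t. sq_root \<kappa> \<omega> \<alpha> (q t)) has_vector_derivative (\<alpha> * \<omega>) *\<^sub>R sq_root \<kappa> \<omega> (\<alpha> - 1) (q t) * q') (at t)"
proof -
  have "((\<lambda>t. \<kappa> + of_real \<omega> * q t) has_vector_derivative 0 + (of_real \<omega> * q' + 0 * q t)) (at t)"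
    by (intro has_vector_derivative_add has_vector_derivative_mult has_vector_derivative_const q)
  from evpow_chain[OF this assms(1), of \<alpha>]
  have "((\<lambda>t. sq_root \<kappa> \<omega> \<alpha> (q t)) has_vector_derivative \<alpha> *\<^sub>R sq_root \<kappa> \<omega> (\<alpha> - 1) (q t) * (0 + (of_real \<omega> * q' + 0 * q t))) (at t)"
    using assms by (auto simp: sq_root_def add_pos_nonneg intro!: evG_simps)
  then show ?thesis
    by (simp add: scaleR_conv_of_real mult_ac)
qed

lemma sq_root_evG: "finite G \<Longrightarrow> \<kappa> \<in> evG G \<Longrightarrow> q \<in> evG G \<Longrightarrow> sq_root \<kappa> \<omega> \<alpha> q \<in> evG G"
  unfolding sq_root_def by (intro evpow_evG evG_simps)

lemma sq_exp_evG: "finite G \<Longrightarrow> \<kappa> \<in> evG G \<Longrightarrow> q \<in> evG G \<Longrightarrow> sq_exp \<kappa> \<omega> q \<in> evG G"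
  unfolding sq_exp_def by (intro evexp_evG evG_simps sq_root_evG)

lemma sq_fun_evG:
  assumes "finite G" "\<kappa> \<in> evG G" "q \<in> evG G"
  shows "sq_fun \<kappa> \<omega> i q \<in> evG G"
  using sq_root_evG[OF assms] sq_exp_evG[OF assms] by (auto simp: sq_fun_def Let_def intro!: evG_simps evG_power)

lemma sq_fun_evm:
  assumes "finite G" "\<kappa> \<in> evG G" "evm M q" "\<And>x. q x \<in> evG G"
  shows "evm M (\<lambda>x. sq_fun \<kappa> \<omega> i (q x))"
proof -
  have r: "evm M (\<lambda>x. sq_root \<kappa> \<omega> \<alpha> (q x))" for \<alpha>
    unfolding sq_root_def using assms
    by (intro evm_evpow[where G = G] evm_add evm_mult evm_const evG_simps)
  have e: "evm M (\<lambda>x. sq_exp \<kappa> \<omega> (q x))"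
    unfolding sq_exp_def using assms r
    by (intro evm_evexp[where G = G] evm_diff evm_minus evG_simps sq_root_evG)
  show ?thesis
    unfolding sq_fun_def Let_def
    by (cases "i = 0"; cases "i = 1"; cases "i = 2")
      (simp_all add: e, (intro evm_mult evm_diff evm_minus evm_add evm_power evm_const evm_scaleR e r borel_measurable_const)+)
qed

text \<open>\<open>L\<close> is minus the logarithmic derivative of \<open>F\<close>, and
  \<open>L1\<close>, \<open>L2\<close> are the first two derivatives of \<open>L\<close>. Repeated
  use of \<open>F' = - L * F\<close> produces the brackets in \<open>sq_fun\<close>.\<close>

lemma sq_fun_chain:
  assumes "finite G" "\<kappa> \<in> evG G" "evbody \<kappa> > 0" "\<omega> \<ge> 0"
    and q: "(q has_vector_derivative q') (at t)" "\<And>t. q t \<in> evG G" "evbody (q t) > 0" and i: "i < 3"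
  shows "((\<lambda>t. sq_fun \<kappa> \<omega> i (q t)) has_vector_derivative sq_fun \<kappa> \<omega> (Suc i) (q t) * q') (at t)"
proof -
  define L where "L q = 1 + (\<omega> / 2) *\<^sub>R sq_root \<kappa> \<omega> (-1/2) q" for q
  define L1 where "L1 q = (- \<omega>\<^sup>2 / 4) *\<^sub>R sq_root \<kappa> \<omega> (-3/2) q" for q
  define L2 where "L2 q = (3 * \<omega> ^ 3 / 8) *\<^sub>R sq_root \<kappa> \<omega> (-5/2) q" for q
  define E where "E = sq_exp \<kappa> \<omega>"
  note r = sq_root_chain[OF assms(1-4) q]
  have sc: "((\<lambda>t. c *\<^sub>R f t) has_vector_derivative c *\<^sub>R f') (at t)"
    if "(f has_vector_derivative f') (at t)" for f f' and c :: real
    by (rule bounded_linear.has_vector_derivative[OF bounded_linear_scaleR_right that])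
  have dL: "((\<lambda>t. L (q t)) has_vector_derivative L1 (q t) * q') (at t)"
    unfolding L_def
    by (rule has_vector_derivative_eq_rhs, (rule has_vector_derivative_add has_vector_derivative_const sc r)+)
      (simp add: L1_def power2_eq_square)
  have dL1: "((\<lambda>t. L1 (q t)) has_vector_derivative L2 (q t) * q') (at t)"
    unfolding L1_def
    by (rule has_vector_derivative_eq_rhs, (rule sc r)+)
      (simp add: L2_def power2_eq_square power3_eq_cube)
  have "((\<lambda>t. - q t - sq_root \<kappa> \<omega> (1/2) (q t)) has_vector_derivative - (L (q t) * q')) (at t)"
    by (rule has_vector_derivative_eq_rhs, (rule has_vector_derivative_diff has_vector_derivative_minus q r)+)
      (simp add: L_def algebra_simps)
  from evexp_chain[OF this assms(1)]
  have dE: "((\<lambda>t. E (q t)) has_vector_derivative - (E (q t) * L (q t) * q')) (at t)"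
    unfolding E_def sq_exp_def using sq_root_evG[OF assms(1,2) q(2)] q(2) by (auto simp: mult.assoc intro!: evG_simps)
  have F: "sq_fun \<kappa> \<omega> 0 = E" "sq_fun \<kappa> \<omega> (Suc 0) = (\<lambda>q. - (E q * L q))" "sq_fun \<kappa> \<omega> (Suc (Suc 0)) = (\<lambda>q. E q * (L q * L q - L1 q))"
    "sq_fun \<kappa> \<omega> (Suc (Suc (Suc 0))) = (\<lambda>q. E q * (3 *\<^sub>R (L q * L1 q) - L q * L q * L q - L2 q))"
    by (simp_all add: fun_eq_iff sq_fun_def Let_def L_def L1_def L2_def E_def power2_eq_square power3_eq_cube)
  note D = dE dL dL1 has_vector_derivative_minus has_vector_derivative_diff has_vector_derivative_mult
  have three: "3 *\<^sub>R a = a + a + a" for a :: "'a ev"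
    by (simp add: scaleR_conv_of_real)
  consider "i = 0" | "i = Suc 0" | "i = Suc (Suc 0)" using i by (auto simp: numeral_3_eq_3 less_Suc_eq)
  then show ?thesis
  proof cases
    case 1
    then show ?thesis using dE by (simp add: F mult.assoc)
  next
    case 2
    show ?thesis unfolding 2 F
      by (rule has_vector_derivative_eq_rhs, (rule D)+) (simp add: algebra_simps)
  next
    case 3
    show ?thesis unfolding 3 F
      by (rule has_vector_derivative_eq_rhs, (rule D)+) (simp add: algebra_simps three)
  qed
qed

text \<open>The root has nonnegative body, so the body of the exponent is at most
  \<open>- evbody q\<close>. The other factors are built from powers of a radicand with body at
  least \<open>evbody \<kappa>\<close> and grow polynomially in
  \<open>1 + 2 * norm q\<close>.\<close>

lemma sq_fun_bound:
  assumes "finite G" "\<kappa> \<in> evG G" "evbody \<kappa> > 0" "\<omega> \<ge> 0"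
  shows "\<exists>C\<ge>0. \<exists>K. \<forall>q\<in>evG G. evbody q > 0 \<longrightarrow> norm (sq_fun \<kappa> \<omega> i q) \<le> C * (1 + 2 * norm q) ^ K * exp (- evbody q)"
proof -
  interpret g: growth G "{q \<in> evG G. evbody q > 0}" "\<lambda>q. 1 + 2 * norm q"
    by unfold_locales (auto simp: assms)
  have q: "g.pb (\<lambda>q. q)"
    by (rule g.pbI[where C = 1 and K = 1]) auto
  have r: "g.pb (\<lambda>q. sq_root \<kappa> \<omega> \<alpha> q)" if "\<alpha> \<le> 1" for \<alpha>
    unfolding sq_root_def using assms that
    by (intro g.pb_evpow[where \<delta> = "evbody \<kappa>"] g.pb_add g.pb_mult g.pb_const q) auto
  let ?f = "\<lambda>q. - q - sq_root \<kappa> \<omega> (1/2) q"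
  have e: "g.pb (\<lambda>q. exp (- evbody (?f q)) *\<^sub>R evexp (?f q))"
    by (intro g.pb_evexp g.pb_diff g.pb_minus q r) simp
  define P where "P q = exp (- evbody (?f q)) *\<^sub>R sq_fun \<kappa> \<omega> i q" for q
  have "g.pb (\<lambda>q. (exp (- evbody (?f q)) *\<^sub>R evexp (?f q)) *
     (if i = 0 then 1 else if i = 1 then - (1 + (\<omega> / 2) *\<^sub>R sq_root \<kappa> \<omega> (-1/2) q)
      else if i = 2 then (1 + (\<omega> / 2) *\<^sub>R sq_root \<kappa> \<omega> (-1/2) q) ^ 2 - (- \<omega>\<^sup>2 / 4) *\<^sub>R sq_root \<kappa> \<omega> (-3/2) q
      else 3 *\<^sub>R ((1 + (\<omega> / 2) *\<^sub>R sq_root \<kappa> \<omega> (-1/2) q) * ((- \<omega>\<^sup>2 / 4) *\<^sub>R sq_root \<kappa> \<omega> (-3/2) q)) -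
        (1 + (\<omega> / 2) *\<^sub>R sq_root \<kappa> \<omega> (-1/2) q) ^ 3 - (3 * \<omega> ^ 3 / 8) *\<^sub>R sq_root \<kappa> \<omega> (-5/2) q))"
    by (cases "i = 0"; cases "i = 1"; cases "i = 2"; simp only: if_True if_False simp_thms;
        intro g.pb_mult[OF e] g.pb_intros r evG_simps; simp)
  then have "g.pb P"
    by (simp only: P_def[abs_def] sq_fun_def Let_def sq_exp_def mult_scaleR_left)
  then obtain C K where C: "C \<ge> 0" "\<And>q. q \<in> evG G \<Longrightarrow> evbody q > 0 \<Longrightarrow> norm (P q) \<le> C * (1 + 2 * norm q) ^ K"
    using g.pb_bound[of P] by blast
  have "norm (sq_fun \<kappa> \<omega> i q) \<le> C * (1 + 2 * norm q) ^ K * exp (- evbody q)" if h: "q \<in> evG G" "evbody q > 0" for q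
  proof -
    have "sq_fun \<kappa> \<omega> i q = exp (evbody (?f q)) *\<^sub>R P q"
      unfolding P_def scaleR_scaleR exp_add[symmetric] by simp
    then have "norm (sq_fun \<kappa> \<omega> i q) = exp (evbody (?f q)) * norm (P q)" by simp
    also have "\<dots> \<le> exp (- evbody q) * (C * (1 + 2 * norm q) ^ K)"
      using C(2)[OF h] by (intro mult_mono) (auto simp: sq_root_def evbody_evpow)
    finally show ?thesis by (simp add: mult_ac)
  qed
  with C(1) show ?thesis by blast
qed

lemma super_fun_sq_fun:
  assumes "finite G" "\<kappa> \<in> evG G" "evbody \<kappa> > 0" "\<omega> \<ge> 0"
  shows "super_fun G (sq_fun \<kappa> \<omega>)"
  using assms by unfold_locales (blast intro: sq_fun_evG sq_fun_chain sq_fun_bound sq_fun_evm)+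

section \<open>Berezin derivatives\<close>

lemma gderiv_add: "gderiv g (a + b) = gderiv g a + gderiv g b"
  by (rule grassmann_eqI) (simp add: gcoeff_gderiv algebra_simps)

lemma gderiv_scaleR: "gderiv g (r *\<^sub>R a) = r *\<^sub>R gderiv g a"
  by (rule grassmann_eqI) (simp add: gcoeff_gderiv)

lemma gderiv_minus: "gderiv g (- a) = - gderiv g a"
  using gderiv_scaleR[of g "-1" a] by simp

lemma gderiv_diff: "gderiv g (a - b) = gderiv g a - gderiv g b"
  using gderiv_add[of g a "- b"] by (simp add: gderiv_minus)

lemma gderiv_free: "a \<in> galg (- {g}) \<Longrightarrow> gderiv g a = 0"
  by (rule gderiv_eqI[where \<omega>0 = a]) (auto intro: galg_intros)

lemma gderiv_gvar_mult: "a \<in> galg (- {g}) \<Longrightarrow> gderiv g (gvar g * a) = a"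
  by (rule gderiv_eqI[OF _ galg_0]) auto

lemma gderiv_galg: "gderiv g a \<in> galg (- {g})"
  by (auto simp: galg_def gcoeff_gderiv)

lemma gderiv_decomp: "a = (a - gvar g * gderiv g a) + gvar g * gderiv g a" "a - gvar g * gderiv g a \<in> galg (- {g})"
proof -
  have "g \<notin> S" if "gcoeff (a - gvar g * gderiv g a) S \<noteq> 0" for S
  proof
    assume g: "g \<in> S"
    have "finite S" using that gcoeff_infinite by blast
    with g that show False
      by (simp add: gcoeff_gvar_mult gcoeff_gderiv insert_absorb)
  qed
  then show "a - gvar g * gderiv g a \<in> galg (- {g})" by (auto simp: galg_def)
qed simp

lemma gderiv_mult_even:
  assumes "c \<in> geven" "c \<in> galg (- {g})"
  shows "gderiv g (c * a) = c * gderiv g a"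
proof (rule gderiv_eqI)
  show "c * gderiv g a \<in> galg (- {g})" "c * (a - gvar g * gderiv g a) \<in> galg (- {g})"
    by (intro galg_mult gderiv_decomp(2) gderiv_galg assms)+
  have "c * (gvar g * gderiv g a) = gvar g * (c * gderiv g a)"
    using geven_commute[OF assms(1), of "gvar g"] by (simp flip: mult.assoc)
  then show "c * a = c * (a - gvar g * gderiv g a) + gvar g * (c * gderiv g a)"
    by (simp add: algebra_simps)
qed

text \<open>Both orders read off the coefficient of the same monomial; only the sign of moving one
  of the two generators past the other differs.\<close>

lemma gderiv_anticommute:
  assumes "g \<noteq> h"
  shows "gderiv g (gderiv h a) = - gderiv h (gderiv g a)"
proof (rule grassmann_eqI)
  fix S :: "'a set" assume S: "finite S"
  show "gcoeff (gderiv g (gderiv h a)) S = gcoeff (- gderiv h (gderiv g a)) S"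
  proof (cases "g \<in> S \<or> h \<in> S")
    case False
    have swap: "gsign {g} {h} = - gsign {h} {g}"
      using gsign_swap[of "{h}" "{g}"] assms by simp
    have "gsign {h} (insert g S) = gsign {h} {g} * gsign {h} S" "gsign {g} (insert h S) = gsign {g} {h} * gsign {g} S"
      using S False gsign_Un_right[of "{h}" "{g}" S] gsign_Un_right[of "{g}" "{h}" S] by simp_all
    then show ?thesis
      using False assms by (simp add: gcoeff_gderiv swap insert_commute)
  qed (use assms in \<open>auto simp: gcoeff_gderiv\<close>)
qed

definition vderiv :: "'v::linorder \<Rightarrow> 'v gen grassmann \<Rightarrow> 'v gen grassmann" where
  "vderiv j = gderiv (Xi j) \<circ> gderiv (Eta j)"

text \<open>Exchanging two pairs takes four anticommutations, so no sign remains.\<close>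

lemma vderiv_commute: "vderiv i (vderiv j a) = vderiv j (vderiv i a)"
proof (cases "i = j")
  case False
  have "gderiv (Xi i) (gderiv (Eta i) (gderiv (Xi j) (gderiv (Eta j) a)))
      = gderiv (Xi j) (gderiv (Eta j) (gderiv (Xi i) (gderiv (Eta i) a)))"
    using False
    by (simp add: gderiv_anticommute[of "Eta i" "Xi j"] gderiv_anticommute[of "Eta i" "Eta j"]
        gderiv_anticommute[of "Xi i" "Xi j"] gderiv_anticommute[of "Xi i" "Eta j"] gderiv_minus)
  then show ?thesis by (simp add: vderiv_def)
qed simp

lemma vderiv_mult_even: "c \<in> geven \<Longrightarrow> c \<in> galg (- {Xi j, Eta j}) \<Longrightarrow> vderiv j (c * a) = c * vderiv j a"
proof -
  assume c: "c \<in> geven" "c \<in> galg (- {Xi j, Eta j})"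
  have "c \<in> galg (- {Xi j})" "c \<in> galg (- {Eta j})" using c(2) by (auto intro: galg_mono)
  then show ?thesis using c(1) by (simp add: vderiv_def gderiv_mult_even)
qed

section \<open>The superintegral over one spin\<close>

lift_definition gint :: "'x measure \<Rightarrow> ('x \<Rightarrow> 'g grassmann) \<Rightarrow> 'g grassmann"
  is "\<lambda>M f S. \<integral>x. gcoeff (f x) S \<partial>M"
  by (simp add: gcoeff_infinite)

definition gintegrable :: "'x measure \<Rightarrow> ('x \<Rightarrow> 'g grassmann) \<Rightarrow> bool" where
  "gintegrable M f \<longleftrightarrow> (\<forall>S. integrable M (\<lambda>x. gcoeff (f x) S))"

lemma gint_mult:
  assumes "gintegrable M f"
  shows "gintegrable M (\<lambda>x. c * f x)" "gint M (\<lambda>x. c * f x) = c * gint M f"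
  using assms by (auto simp: gintegrable_def gint.rep_eq times_grassmann.rep_eq intro!: grassmann_eqI)

lemma gint_gderiv:
  assumes "gintegrable M f"
  shows "gintegrable M (\<lambda>x. gderiv g (f x))" "gint M (\<lambda>x. gderiv g (f x)) = gderiv g (gint M f)"
proof -
  have "integrable M (\<lambda>x. gcoeff (gderiv g (f x)) S)" for S
    using assms by (cases "g \<in> S") (auto simp: gintegrable_def gcoeff_gderiv)
  then show "gintegrable M (\<lambda>x. gderiv g (f x))" by (simp add: gintegrable_def)
  show "gint M (\<lambda>x. gderiv g (f x)) = gderiv g (gint M f)"
  proof (rule grassmann_eqI)
    fix S
    show "gcoeff (gint M (\<lambda>x. gderiv g (f x))) S = gcoeff (gderiv g (gint M f)) S"
      by (cases "g \<in> S") (auto simp: gint.rep_eq gcoeff_gderiv)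
  qed
qed

lemma gint_vderiv:
  assumes "gintegrable M f"
  shows "gintegrable M (\<lambda>x. vderiv g (f x))" "gint M (\<lambda>x. vderiv g (f x)) = vderiv g (gint M f)"
  using assms by (auto simp: vderiv_def gint_gderiv)

definition inv_z :: "'v::linorder \<Rightarrow> real \<times> real \<Rightarrow> 'v gen grassmann" where
  "inv_z j p = gext (\<lambda>t. 1 / t) (spin_z j p)"

lemma spin_z_hyp: "spin_z j p = of_real (hyp p) + (1 / hyp p) *\<^sub>R (gvar (Xi j) * gvar (Eta j))"
  by (cases p) (simp add: spin_z_eq hyp_def)

lemma inv_z_eq: "inv_z j p = of_real (1 / hyp p) - ((1 / hyp p) ^ 3) *\<^sub>R (gvar (Xi j) * gvar (Eta j))"
proof -
  let ?n = "(1 / hyp p) *\<^sub>R (gvar (Xi j) * gvar (Eta j))"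
  have 1: "body ?n = 0" "?n * ?n = 0"
    by (simp_all add: body_def gcoeff_gvar_gvar gvar_gvar_square)
  have "deriv (\<lambda>t. 1 / t) (hyp p) = - (1 / (hyp p) ^ 2)"
    using hyp_pos[of p] by (intro DERIV_imp_deriv) (auto intro!: derivative_eq_intros simp: power2_eq_square)
  then show ?thesis
    unfolding inv_z_def spin_z_hyp gext_square_zero[OF 1]
    by (simp add: power2_eq_square power3_eq_cube)
qed

section \<open>Inner products as even elements and the superintegral over one spin\<close>

definition evs :: "'g::linorder svec \<Rightarrow> 'g svec \<Rightarrow> 'g ev" where
  "evs u v = Ev (sinner u v)"

lemma sinner_galg:
  assumes "u \<in> H32 G" "v \<in> H32 G"
  shows "sinner u v \<in> galg G" "sinner u v \<in> geven"
proof -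
  obtain x y z a b where u: "u = (x, y, z, a, b)" by (metis prod_cases5)
  obtain x' y' z' a' b' where v: "v = (x', y', z', a', b')" by (metis prod_cases5)
  have uv: "x \<in> geven" "y \<in> geven" "z \<in> geven" "x' \<in> geven" "y' \<in> geven" "z' \<in> geven"
      "a \<in> godd" "b \<in> godd" "a' \<in> godd" "b' \<in> godd"
    using assms by (auto simp: H32_def Let_def u v)
  show "sinner u v \<in> galg G"
    using assms by (auto simp: H32_def Let_def u v intro!: galg_intros)
  show "sinner u v \<in> geven"
    unfolding u v sinner.simps by (intro geven_add geven_diff geven_mult[OF uv(1,4)] geven_mult[OF uv(2,5)]
      geven_mult[OF uv(3,6)] godd_mult[OF uv(7,10)] godd_mult[OF uv(8,9)])
qed

lemma H32_mono: "u \<in> H32 G \<Longrightarrow> G \<subseteq> G' \<Longrightarrow> u \<in> H32 G'"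
  by (auto simp: H32_def Let_def intro: galg_mono)

lemma gr_evs:
  assumes "u \<in> H32 G" "v \<in> H32 G'" "finite G" "finite G'"
  shows "gr (evs u v) = sinner u v"
proof -
  have "u \<in> H32 (G \<union> G')" "v \<in> H32 (G \<union> G')"
    by (rule H32_mono[OF assms(1)], simp) (rule H32_mono[OF assms(2)], simp)
  then have "sinner u v \<in> galg (G \<union> G')" "sinner u v \<in> geven"
    by (rule sinner_galg)+
  then show ?thesis unfolding evs_def using assms(3,4) by (intro Ev_inverse) auto
qed

lemma gr_Ev: "a \<in> geven \<Longrightarrow> a \<in> galg G \<Longrightarrow> finite G \<Longrightarrow> gr (Ev a) = a"
  by (rule Ev_inverse) auto

lemma gr_eq_iff: "gr a = gr b \<longleftrightarrow> a = b"
  by (rule gr_inject)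

lemma gr_zero_iff: "gr a = 0 \<longleftrightarrow> a = 0"
  using gr_eq_iff[of a 0] by (simp add: gr_simps)

lemma spin_H32: "spin j p \<in> H32 {Xi j, Eta j}"
  using spin_in_H22[of j p] by (simp add: H22_def)

text \<open>\<open>super_fun\<close> offers no series for \<open>F\<close>, only a chain rule. So a
  curve \<open>H\<close> is built that equals the expansion at \<open>t = 0\<close> and
  \<open>F 0 (q - n)\<close> at \<open>t = 1\<close>; its derivative is a multiple of
  \<open>n ^ 3\<close> and vanishes.\<close>

lemma super_taylor:
  assumes "super_fun G F" and q: "q \<in> evG G" "n \<in> evG G" "evbody q > 0" "evbody n = 0" "n ^ 3 = 0"
  shows "F 0 (q - n) = F 0 q - F 1 q * n + (1/2) *\<^sub>R (F 2 q * n ^ 2)"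
proof -
  interpret super_fun G F by fact
  define P where "P t = q - of_real t * n" for t
  have PG: "P t \<in> evG G" for t using q unfolding P_def by (intro evG_simps)
  have Pb: "evbody (P t) > 0" for t using q by (simp add: P_def)
  have dP: "(P has_vector_derivative - n) (at t)" for t
  proof -
    have "((\<lambda>t. of_real (1 * t) * n) has_vector_derivative of_real 1 * 0 + of_real 1 * n) (at t)" for t
      by (rule has_vector_derivative_eq_rhs, rule has_vector_derivative_mult, rule deriv_of_real_ev, rule has_vector_derivative_const) simp
    from has_vector_derivative_diff[OF has_vector_derivative_const this, of q] show ?thesis
      by (simp add: P_def[abs_def])
  qed
  have F: "((\<lambda>t. F 0 (P t)) has_vector_derivative F 1 (P t) * - n) (at t)"
      "((\<lambda>t. F 1 (P t)) has_vector_derivative F 2 (P t) * - n) (at t)"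
      "((\<lambda>t. F 2 (P t)) has_vector_derivative F 3 (P t) * - n) (at t)" for t
    using F_chain[OF _ dP PG Pb, of 0] F_chain[OF _ dP PG Pb, of 1] F_chain[OF _ dP PG Pb, of 2]
    by (simp_all add: numeral_2_eq_2 numeral_3_eq_3)
  define H where "H t = F 0 (P t) - of_real (1 - t) * F 1 (P t) * n + of_real ((1 - t) ^ 2) * F 2 (P t) * (of_real (1/2) * n ^ 2)" for t
  have r: "((\<lambda>t. of_real (1 - t) :: 'a ev) has_vector_derivative of_real (- 1)) (at t)"
     "((\<lambda>t. of_real ((1 - t)\<^sup>2) :: 'a ev) has_vector_derivative of_real (- 2 * (1 - t))) (at t)" for t
    by (rule has_vector_derivative_of_real_ev, (auto intro!: derivative_eq_intros)[1])+
  have n3: "n * n ^ 2 = 0" using q(5) by (simp add: power2_eq_square power3_eq_cube mult.assoc)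
  have two: "of_real 2 * of_real (1/2) = (1 :: 'a ev)" unfolding of_real_mult[symmetric] by simp
  have "(H has_vector_derivative 0) (at t)" for t
  proof -
    let ?t = "of_real (1 - t) :: 'a ev"
    have "(H has_vector_derivative F 1 (P t) * - n - (?t * F 1 (P t) * 0 + (?t * (F 2 (P t) * - n) + of_real (- 1) * F 1 (P t)) * n) +
       (of_real ((1 - t) ^ 2) * F 2 (P t) * 0 + (of_real ((1 - t) ^ 2) * (F 3 (P t) * - n) + of_real (- 2 * (1 - t)) * F 2 (P t)) * (of_real (1/2) * n ^ 2))) (at t)"
      unfolding H_def[abs_def]
      by (intro has_vector_derivative_add has_vector_derivative_diff has_vector_derivative_mult has_vector_derivative_const F r)
    moreover have "f1 * - n - (?t * f1 * 0 + (?t * (f2 * - n) + of_real (- 1) * f1) * n) +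
       (of_real ((1 - t) ^ 2) * f2 * 0 + (of_real ((1 - t) ^ 2) * (f3 * - n) + of_real (- 2 * (1 - t)) * f2) * (of_real (1/2) * n ^ 2))
       = ?t * f2 * n ^ 2 * (1 - of_real 2 * of_real (1/2)) - of_real ((1 - t) ^ 2) * f3 * of_real (1/2) * (n * n ^ 2)" for f1 f2 f3
      by (simp add: algebra_simps power2_eq_square)
    ultimately show ?thesis by (simp only: two n3) simp
  qed
  then have "((\<lambda>t. evcoeff (H t) S) has_real_derivative 0) (at t)" for t S
    using vector_derivative_coeff[of H 0 t UNIV S] by simp
  then have "evcoeff (H 0) S = evcoeff (H 1) S" for S
    using DERIV_isconst_all[of "\<lambda>t. evcoeff (H t) S" 0 1] by blast
  then have "H 0 = H 1" by (rule ev_eqI)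
  then show ?thesis
    by (simp add: H_def P_def scaleR_conv_of_real algebra_simps)
qed

text \<open>\<open>- \<langle>v, b\<rangle>\<close> is \<open>q p - n\<close> with
  \<open>n ^ 3 = 0\<close>. After Taylor expansion, the coefficient of \<open>\<xi> \<eta>\<close>
  in the product with \<open>1 / z\<close> is minus the integrand of \<open>localization\<close>.
  The expansion takes place over \<open>G\<close> with \<open>\<xi>\<close>, \<open>\<eta>\<close>
  adjoined, the localization over \<open>G\<close>, hence the two instances of
  \<open>super_fun\<close>.\<close>

lemma single_spin:
  fixes j :: "'v::linorder" and G :: "'v gen set"
  assumes F: "super_fun G F" "super_fun (G \<union> {Xi j, Eta j}) F"
    and G: "finite G" "Xi j \<notin> G" "Eta j \<notin> G"
    and b: "b1 \<in> evG G" "b2 \<in> evG G" "b3 \<in> evG G" "m \<in> evG G"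
    and \<gamma>: "\<gamma>1 \<in> galg G" "\<gamma>1 \<in> godd" "\<gamma>2 \<in> galg G" "\<gamma>2 \<in> godd"
    and m: "m ^ 2 = b3 ^ 2 - b1 ^ 2 - b2 ^ 2 - 2 * Ev (\<gamma>1 * \<gamma>2)" "evbody b3 > 0" "evbody m > 0"
  defines "f \<equiv> \<lambda>p. vderiv j (inv_z j p * gr (F 0 (- evs (spin j p) (gr b1, gr b2, gr b3, \<gamma>1, \<gamma>2))))"
  shows "gintegrable lborel f" "gint lborel f = (2 * pi) *\<^sub>R gr (F 0 m)"
proof -
  let ?\<xi> = "gvar (Xi j)" and ?\<eta> = "gvar (Eta j)" and ?G' = "G \<union> {Xi j, Eta j}"
  interpret F: super_fun G F by fact
  define \<theta> where "\<theta> = Ev (\<gamma>1 * \<gamma>2)"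
  define e1 where "e1 = Ev (?\<xi> * \<gamma>2)"
  define e2 where "e2 = Ev (?\<eta> * \<gamma>1)"
  define e3 where "e3 = Ev (?\<xi> * ?\<eta>)"
  have fin: "finite ?G'" using G by simp
  have \<gamma>': "\<gamma>1 \<in> galg ?G'" "\<gamma>2 \<in> galg ?G'" using \<gamma> by (auto intro: galg_mono)
  have vars: "?\<xi> \<in> galg ?G'" "?\<eta> \<in> galg ?G'" by (auto intro: galg_gvar)
  have gr_e: "gr \<theta> = \<gamma>1 * \<gamma>2" "gr e1 = ?\<xi> * \<gamma>2" "gr e2 = ?\<eta> * \<gamma>1" "gr e3 = ?\<xi> * ?\<eta>"
    unfolding \<theta>_def e1_def e2_def e3_def
    by (rule gr_Ev[OF _ _ fin]; use \<gamma> \<gamma>' vars in \<open>auto intro!: godd_mult godd_gvar galg_mult\<close>)+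
  have \<theta>G: "\<theta> \<in> evG G" using \<gamma> by (auto simp: evG_def gr_e intro: galg_mult)
  have eG: "e1 \<in> evG ?G'" "e2 \<in> evG ?G'" "e3 \<in> evG ?G'"
    using \<gamma>' vars by (auto simp: evG_def gr_e intro: galg_mult)
  have bG: "b1 \<in> evG ?G'" "b2 \<in> evG ?G'" "b3 \<in> evG ?G'" using b by (auto intro: evG_mono)
  have anti: "a * ?\<xi> = - (?\<xi> * a)" "a * ?\<eta> = - (?\<eta> * a)" if "a \<in> godd" for a
    using godd_anticommute[OF that godd_gvar] by blast+
  have anti2: "\<gamma>2 * \<gamma>1 = - (\<gamma>1 * \<gamma>2)" by (rule godd_anticommute) fact+
  have sq: "\<gamma>1 * \<gamma>1 = 0" "\<gamma>2 * \<gamma>2 = 0" using \<gamma> by (auto intro: godd_square)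
  have e_prods: "\<theta> * \<theta> = 0" "e1 * e1 = 0" "e2 * e2 = 0" "e1 * e2 = e3 * \<theta>" "e1 * e3 = 0" "e2 * e3 = 0" "e3 * e3 = 0"
  proof -
    have ac: "(a * b) * (c * d) = a * (b * c) * d" for a b c d :: "'v gen grassmann"
      by (simp add: mult.assoc)
    have s1: "?\<xi> * ?\<xi> * a = 0" "?\<eta> * ?\<eta> * a = 0" for a by simp_all
    have "gr (\<theta> * \<theta>) = - (\<gamma>1 * \<gamma>1 * (\<gamma>2 * \<gamma>2))"
      unfolding gr_simps gr_e ac anti2 by (simp add: mult.assoc)
    then show "\<theta> * \<theta> = 0" unfolding sq by (simp add: gr_zero_iff)
    have "gr (e1 * e1) = - (?\<xi> * ?\<xi> * (\<gamma>2 * \<gamma>2))"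
      unfolding gr_simps gr_e ac anti(1)[OF \<gamma>(4)] by (simp add: mult.assoc)
    then show "e1 * e1 = 0" unfolding sq by (simp add: gr_zero_iff)
    have "gr (e2 * e2) = - (?\<eta> * ?\<eta> * (\<gamma>1 * \<gamma>1))"
      unfolding gr_simps gr_e ac anti(2)[OF \<gamma>(2)] by (simp add: mult.assoc)
    then show "e2 * e2 = 0" unfolding sq by (simp add: gr_zero_iff)
    have "gr (e1 * e2) = - (?\<xi> * ?\<eta> * (\<gamma>2 * \<gamma>1))"
      unfolding gr_simps gr_e ac anti(2)[OF \<gamma>(4)] by (simp add: mult.assoc)
    also have "\<dots> = gr (e3 * \<theta>)"
      unfolding anti2 gr_simps gr_e by simp
    finally show "e1 * e2 = e3 * \<theta>" by (simp add: gr_eq_iff)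
    have "gr (e1 * e3) = - (?\<xi> * ?\<xi> * (\<gamma>2 * ?\<eta>))"
      unfolding gr_simps gr_e ac anti(1)[OF \<gamma>(4)] by (simp add: mult.assoc)
    then show "e1 * e3 = 0" unfolding s1 by (simp add: gr_zero_iff)
    have "gr (e2 * e3) = - (?\<eta> * ?\<xi> * (\<gamma>1 * ?\<eta>))"
      unfolding gr_simps gr_e ac anti(1)[OF \<gamma>(2)] by (simp add: mult.assoc)
    also have "\<dots> = - (?\<xi> * (?\<eta> * ?\<eta>) * \<gamma>1)"
      unfolding anti(2)[OF \<gamma>(2)] gvar_anticommute[of "Eta j" "Xi j"] by (simp only: mult_minus_left mult_minus_right mult.assoc minus_minus)
    finally show "e2 * e3 = 0" by (simp add: gr_zero_iff)
    have "gr (e3 * e3) = 0" unfolding gr_simps gr_e by (rule gvar_gvar_square)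
    then show "e3 * e3 = 0" by (simp add: gr_zero_iff)
  qed
  have m': "m ^ 2 = b3 ^ 2 - b1 ^ 2 - b2 ^ 2 - 2 * \<theta>" unfolding \<theta>_def by (rule m(1))
  interpret sp: super_path G F b1 b2 b3 \<theta> m
    by unfold_locales (fact b \<theta>G m' e_prods(1) m(2,3))+
  define q where "q p = of_real (hyp p) * b3 - of_real (fst p) * b1 - of_real (snd p) * b2" for p
  define jj where "jj p = of_real ((1 / hyp p) ^ 3) * F 0 (q p) - of_real ((1 / hyp p) ^ 2) * b3 * F 1 (q p) + of_real (1 / hyp p) * \<theta> * F 2 (q p)" for p
  have f: "f p = gr (jj p)" for p
  proof -
    let ?s = "of_real (1 / hyp p) :: 'v gen ev"
    \<comment> \<open>The terms of \<open>\<langle>v, b\<rangle>\<close> containing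
      \<open>\<xi>\<close> or \<open>\<eta>\<close>; the last one comes from the nilpotent part of
      \<open>z\<close>.\<close>
    define n where "n = e1 - e2 - ?s * b3 * e3"
    have qG: "q p \<in> evG G" unfolding q_def using b by (intro evG_simps)
    have qpos: "evbody (q p) > 0"
      using sp.body_Q_pos[of 1 p] by (simp add: sp.Q_def sp.c_1 q_def)
    have n2: "n ^ 2 = - (2 * (e3 * \<theta>))"
    proof -
      have "n ^ 2 = e1 * e1 + e2 * e2 - 2 * (e1 * e2) + ?s * b3 * (?s * b3 * (e3 * e3) - 2 * (e1 * e3) + 2 * (e2 * e3))"
        unfolding n_def by (simp add: power2_eq_square algebra_simps)
      then show ?thesis by (simp add: e_prods)
    qed
    have "n ^ 3 = n ^ 2 * n" by (simp add: power2_eq_square power3_eq_cube)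
    also have "\<dots> = - (2 * \<theta> * (e1 * e3 - e2 * e3 - ?s * b3 * (e3 * e3)))"
      unfolding n2 by (simp add: n_def algebra_simps)
    finally have n3: "n ^ 3 = 0" by (simp add: e_prods)
    have nb: "evbody n = 0"
      using arg_cong[OF n3, of evbody] by simp
    have nG: "n \<in> evG ?G'" unfolding n_def using eG bG by (intro evG_simps)
    have "spin j p \<in> H32 ?G'" by (rule H32_mono[OF spin_H32]) auto
    moreover have "(gr b1, gr b2, gr b3, \<gamma>1, \<gamma>2) \<in> H32 ?G'"
      using bG \<gamma> \<gamma>' by (auto simp: H32_def Let_def evG_def gr_even)
    ultimately have "gr (evs (spin j p) (gr b1, gr b2, gr b3, \<gamma>1, \<gamma>2)) = sinner (spin j p) (gr b1, gr b2, gr b3, \<gamma>1, \<gamma>2)"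
      by (rule gr_evs[OF _ _ fin fin])
    also have "\<dots> = gr (n - q p)"
      by (simp add: spin_def spin_z_hyp gr_simps gr_of_real gr_e q_def n_def scaleR_conv_of_real distrib_right)
        (simp add: geven_commute[OF gr_even] mult.assoc)
    finally have "- evs (spin j p) (gr b1, gr b2, gr b3, \<gamma>1, \<gamma>2) = q p - n"
      by (simp add: gr_eq_iff)
    then have arg: "F 0 (- evs (spin j p) (gr b1, gr b2, gr b3, \<gamma>1, \<gamma>2)) = F 0 (q p) - F 1 (q p) * n + (1/2) *\<^sub>R (F 2 (q p) * n ^ 2)"
      using super_taylor[OF F(2) evG_mono[OF qG] nG qpos nb n3] by auto
    have iz: "inv_z j p = gr (?s - of_real ((1 / hyp p) ^ 3) * e3)"
      unfolding inv_z_eq by (simp add: gr_simps gr_power gr_of_real gr_e scaleR_conv_of_real)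
    define A0 where "A0 = ?s * F 0 (q p)"
    define A1 where "A1 = - (?s * F 1 (q p))"
    have two: "(1/2) *\<^sub>R (a * - (2 * b)) = - (a * b)" for a b :: "'v gen ev"
    proof -
      have "2 * b = 2 *\<^sub>R b" by (simp add: scaleR_conv_of_real)
      then show ?thesis by simp
    qed
    \<comment> \<open>The last summand collects the products that vanish by
      \<open>e_prods\<close>.\<close>
    have "(?s - of_real ((1 / hyp p) ^ 3) * e3) * (F 0 (q p) - F 1 (q p) * n + (1/2) *\<^sub>R (F 2 (q p) * n ^ 2))
       = A0 + A1 * e1 - A1 * e2 - e3 * jj p
        + of_real ((1 / hyp p) ^ 3) * (F 1 (q p) * (e1 * e3 - e2 * e3 - ?s * b3 * (e3 * e3)) + F 2 (q p) * \<theta> * (e3 * e3))"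
      unfolding n2 two unfolding n_def A0_def A1_def jj_def of_real_power by (simp add: algebra_simps power2_eq_square power3_eq_cube)
    then have "inv_z j p * gr (F 0 (- evs (spin j p) (gr b1, gr b2, gr b3, \<gamma>1, \<gamma>2))) = gr (A0 + A1 * e1 - A1 * e2 - e3 * jj p)"
      unfolding iz arg by (simp add: e_prods gr_simps(4)[symmetric] del: gr_simps)
    also have "\<dots> = gr A0 + ?\<xi> * (gr A1 * \<gamma>2) - ?\<eta> * (gr A1 * \<gamma>1) - ?\<xi> * (?\<eta> * gr (jj p))"
    proof -
      have "gr A1 * (?\<xi> * a) = ?\<xi> * (gr A1 * a)" "gr A1 * (?\<eta> * a) = ?\<eta> * (gr A1 * a)" for a
        using geven_commute[OF gr_even, of A1 ?\<xi>] geven_commute[OF gr_even, of A1 ?\<eta>] by (simp_all flip: mult.assoc)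
      then show ?thesis by (simp add: gr_simps gr_e mult.assoc)
    qed
    finally have prod: "inv_z j p * gr (F 0 (- evs (spin j p) (gr b1, gr b2, gr b3, \<gamma>1, \<gamma>2))) =
      gr A0 + ?\<xi> * (gr A1 * \<gamma>2) - ?\<eta> * (gr A1 * \<gamma>1) - ?\<xi> * (?\<eta> * gr (jj p))" .
    have FG: "F i (q p) \<in> evG G" for i by (rule F.F_evG[OF qG])
    have A: "A0 \<in> evG G" "A1 \<in> evG G" "jj p \<in> evG G"
      unfolding A0_def A1_def jj_def using FG b \<theta>G by (auto intro!: evG_simps)
    have free: "a \<in> galg (- {Eta j})" "a \<in> galg (- {Xi j})" "?\<xi> * a \<in> galg (- {Eta j})" if "a \<in> galg G" for a
      using that G by (auto intro!: galg_mult galg_gvar intro: galg_mono)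
    have Ag: "gr A0 \<in> galg G" "gr A1 * \<gamma>2 \<in> galg G" "gr A1 * \<gamma>1 \<in> galg G" "gr (jj p) \<in> galg G"
      using A \<gamma> by (auto simp: evG_def intro: galg_mult)
    \<comment> \<open>The derivative in \<open>\<eta>\<close> acts first, so
      \<open>- \<xi> \<eta>\<close> is rewritten as \<open>\<eta> \<xi>\<close>; the two derivatives
      then give \<open>jj p\<close> with a plus sign.\<close>
    have "f p = gderiv (Xi j) (gderiv (Eta j) (gr A0 + ?\<xi> * (gr A1 * \<gamma>2) - ?\<eta> * (gr A1 * \<gamma>1) + ?\<eta> * (?\<xi> * gr (jj p))))"
      unfolding f_def prod vderiv_def comp_def
      using gvar_anticommute[of "Xi j" "Eta j"] by (simp flip: mult.assoc)
    also have "\<dots> = gderiv (Xi j) (- (gr A1 * \<gamma>1) + ?\<xi> * gr (jj p))"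
      by (simp add: gderiv_add gderiv_diff gderiv_free[OF free(1)[OF Ag(1)]] gderiv_free[OF free(3)[OF Ag(2)]]
          gderiv_gvar_mult[OF free(1)[OF Ag(3)]] gderiv_gvar_mult[OF free(3)[OF Ag(4)]])
    also have "\<dots> = gr (jj p)"
      by (simp add: gderiv_add gderiv_diff gderiv_minus gderiv_free[OF free(2)[OF Ag(3)]] gderiv_gvar_mult[OF free(2)[OF Ag(4)]])
    finally show ?thesis .
  qed
  show "gintegrable lborel f"
    using sp.localization(1) by (simp add: gintegrable_def f evcoeff_def[symmetric] jj_def q_def)
  show "gint lborel f = (2 * pi) *\<^sub>R gr (F 0 m)"
    using sp.localization(2) by (intro grassmann_eqI) (simp add: gint.rep_eq f evcoeff_def[symmetric] jj_def q_def)
qed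

section \<open>Bilinearity, cones and masses\<close>

lemma sinner_linear:
  fixes u u' v v' :: "'g::linorder svec"
  shows "sinner (u + u') v = sinner u v + sinner u' v" "sinner u (v + v') = sinner u v + sinner u v'"
  "sinner (r *\<^sub>R u) v = r *\<^sub>R sinner u v" "sinner u (r *\<^sub>R v) = r *\<^sub>R sinner u v"
  by (cases u rule: prod_cases5; cases u' rule: prod_cases5; cases v rule: prod_cases5; cases v' rule: prod_cases5;
      simp add: algebra_simps scaleR_right_distrib scaleR_right_diff_distrib)+

lemma sinner_zero: "sinner 0 v = 0" "sinner u 0 = 0"
  using sinner_linear(3)[where r = 0 and u = 0 and v = v] sinner_linear(4)[where r = 0 and u = u and v = 0] by simp_all

lemma sinner_sum: "sinner (sum f I) v = (\<Sum>i\<in>I. sinner (f i) v)" "sinner u (sum f I) = (\<Sum>i\<in>I. sinner u (f i))"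
  by (induction I rule: infinite_finite_induct) (simp_all add: sinner_linear sinner_zero)

lemma sinner_commute:
  assumes "u \<in> H32 G" "v \<in> H32 G'"
  shows "sinner u v = sinner v u"
proof -
  obtain x y z a b where u: "u = (x, y, z, a, b)" by (metis prod_cases5)
  obtain x' y' z' a' b' where v: "v = (x', y', z', a', b')" by (metis prod_cases5)
  have "x \<in> geven" "y \<in> geven" "z \<in> geven" "a \<in> godd" "b \<in> godd" "a' \<in> godd" "b' \<in> godd"
    using assms by (auto simp: H32_def Let_def u v)
  then show ?thesis
    using geven_commute[of x x'] geven_commute[of y y'] geven_commute[of z z'] godd_anticommute[of a b'] godd_anticommute[of b a']
    by (simp add: u v)
qed

lemma H32_add: "u \<in> H32 G \<Longrightarrow> v \<in> H32 G \<Longrightarrow> u + v \<in> H32 G"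
  by (cases u rule: prod_cases5; cases v rule: prod_cases5) (auto simp: H32_def Let_def intro: galg_add geven_add godd_add)

lemma H32_scaleR: "u \<in> H32 G \<Longrightarrow> r *\<^sub>R u \<in> H32 G"
  by (cases u rule: prod_cases5) (auto simp: H32_def Let_def intro: galg_scaleR geven_scaleR godd_scaleR)

lemma H32_zero: "0 \<in> H32 G"
  by (auto simp: H32_def Let_def zero_prod_def intro: galg_0 geven_0 godd_0)

lemma H32_sum: "(\<And>i. i \<in> I \<Longrightarrow> f i \<in> H32 G) \<Longrightarrow> sum f I \<in> H32 G"
  by (induction I rule: infinite_finite_induct) (auto intro: H32_add H32_zero)

lemma sorigin_H32: "sorigin \<in> H32 G"
  by (auto simp: sorigin_def H32_def Let_def intro: galg_0 galg_1 geven_0 geven_1 godd_0)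

lemma H32_components:
  assumes "c \<in> H32 G" "finite G"
  obtains b1 b2 b3 \<gamma>1 \<gamma>2 where "c = (gr b1, gr b2, gr b3, \<gamma>1, \<gamma>2)" "b1 \<in> evG G" "b2 \<in> evG G" "b3 \<in> evG G"
    "\<gamma>1 \<in> galg G" "\<gamma>1 \<in> godd" "\<gamma>2 \<in> galg G" "\<gamma>2 \<in> godd"
proof -
  obtain x y z a b where c: "c = (x, y, z, a, b)" by (metis prod_cases5)
  have m: "x \<in> galg G" "x \<in> geven" "y \<in> galg G" "y \<in> geven" "z \<in> galg G" "z \<in> geven"
      "a \<in> galg G" "a \<in> godd" "b \<in> galg G" "b \<in> godd"
    using assms by (auto simp: H32_def Let_def c)
  have "gr (Ev x) = x" "gr (Ev y) = y" "gr (Ev z) = z" using m assms(2) by (auto intro: gr_Ev)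
  then show ?thesis
    using m by (intro that[of "Ev x" "Ev y" "Ev z" a b]) (auto simp: c evG_def)
qed

text \<open>The planar and, in \<open>tpart\<close>, the time component of the body. Odd components
  have no body, so in these terms the cones are the light cones of real Minkowski space.\<close>

definition bpart :: "'g::linorder svec \<Rightarrow> real \<times> real" where
  "bpart c = (case c of (x, y, z, a, b) \<Rightarrow> (body x, body y))"

definition tpart :: "'g::linorder svec \<Rightarrow> real" where
  "tpart c = (case c of (x, y, z, a, b) \<Rightarrow> body z)"

lemma body_simps: "body (a + b) = body a + body b" "body (r *\<^sub>R a) = r * body a" "body 0 = 0"
  "body (of_real t) = t" "body 1 = 1" "body (gvar g) = 0"
  by (simp_all add: body_def gcoeff_of_real gcoeff_one gvar.rep_eq)

lemma bpart_linear: "bpart (u + v) = bpart u + bpart v" "bpart (r *\<^sub>R u) = r *\<^sub>R bpart u"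
  "tpart (u + v) = tpart u + tpart v" "tpart (r *\<^sub>R u) = r * tpart u"
  by (cases u rule: prod_cases5; cases v rule: prod_cases5; simp add: bpart_def tpart_def body_simps)+

lemma bpart_zero: "bpart 0 = 0" "tpart 0 = 0"
  by (simp_all add: bpart_def tpart_def zero_prod_def body_simps)

lemma bpart_spin: "bpart (spin j p) = p" "tpart (spin j p) = hyp p"
  by (cases p; simp add: bpart_def tpart_def spin_def body_simps spin_z_hyp)
    (simp add: body_def gcoeff_gvar_gvar spin_def tpart_def spin_z_hyp gcoeff_of_real)

lemma body_odd: "a \<in> godd \<Longrightarrow> body a = 0"
  by (auto simp: godd_def body_def)

lemma body_mult: "body (a * b) = body a * body b"
  by (simp add: body_def times_grassmann.rep_eq)

lemma body_sinner:
  assumes "u \<in> H32 G" "v \<in> H32 G'"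
  shows "body (sinner u v) = bpart u \<bullet> bpart v - tpart u * tpart v"
proof -
  have sub: "body (a - b) = body a - body b" for a b :: "'a grassmann" by (simp add: body_def)
  show ?thesis
    using assms by (cases u rule: prod_cases5; cases v rule: prod_cases5)
      (simp add: H32_def Let_def bpart_def tpart_def body_simps body_mult sub body_odd)
qed

lemma H32_plus_iff: "c \<in> H32_plus G \<longleftrightarrow> c \<in> H32 G \<and> norm (bpart c) < tpart c"
proof (cases "c \<in> H32 G")
  case True
  have "norm (bpart c) < tpart c \<longleftrightarrow> body (sinner c c) < 0 \<and> tpart c > 0"
    unfolding body_sinner[OF True True] dot_square_norm
    by (smt (verit) norm_ge_zero power2_eq_square power2_less_imp_less power_strict_mono zero_less_numeral)
  then show ?thesis
    using True by (auto simp: H32_plus_def tpart_def)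
qed (simp add: H32_plus_def)

lemma H32_plus0_iff: "c \<in> H32_plus0 G \<longleftrightarrow> c \<in> H32 G \<and> norm (bpart c) \<le> tpart c"
proof (cases "c \<in> H32 G")
  case True
  have "norm (bpart c) \<le> tpart c \<longleftrightarrow> body (sinner c c) \<le> 0 \<and> tpart c \<ge> 0"
    unfolding body_sinner[OF True True] dot_square_norm
    by (smt (verit) norm_ge_zero power2_eq_square power2_le_imp_le power_mono)
  then show ?thesis
    using True by (auto simp: H32_plus0_def tpart_def)
qed (simp add: H32_plus0_def)

lemma H32_plus0_add: "u \<in> H32_plus0 G \<Longrightarrow> v \<in> H32_plus0 G \<Longrightarrow> u + v \<in> H32_plus0 G"
  unfolding H32_plus0_iff bpart_linear by (auto intro: H32_add order_trans[OF norm_triangle_ineq])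

lemma H32_plus_add: "u \<in> H32_plus0 G \<Longrightarrow> v \<in> H32_plus G \<Longrightarrow> u + v \<in> H32_plus G"
  unfolding H32_plus0_iff H32_plus_iff bpart_linear by (auto intro: H32_add order.strict_trans1[OF norm_triangle_ineq])

lemma H32_plus0_scaleR: "u \<in> H32_plus0 G \<Longrightarrow> r \<ge> 0 \<Longrightarrow> r *\<^sub>R u \<in> H32_plus0 G"
  unfolding H32_plus0_iff bpart_linear by (auto intro: H32_scaleR mult_left_mono)

lemma H32_plus_scaleR: "u \<in> H32_plus G \<Longrightarrow> r > 0 \<Longrightarrow> r *\<^sub>R u \<in> H32_plus G"
  unfolding H32_plus_iff bpart_linear by (auto intro: H32_scaleR)

lemma H32_plus0_zero: "0 \<in> H32_plus0 G"
  by (simp add: H32_plus0_iff H32_zero bpart_zero)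

lemma H32_plus0_sum: "(\<And>i. i \<in> I \<Longrightarrow> f i \<in> H32_plus0 G) \<Longrightarrow> sum f I \<in> H32_plus0 G"
  by (induction I rule: infinite_finite_induct) (auto intro: H32_plus0_add H32_plus0_zero)

lemma H32_plus_mono: "u \<in> H32_plus G \<Longrightarrow> G \<subseteq> G' \<Longrightarrow> u \<in> H32_plus G'"
  "u \<in> H32_plus0 G \<Longrightarrow> G \<subseteq> G' \<Longrightarrow> u \<in> H32_plus0 G'"
  by (auto simp: H32_plus_iff H32_plus0_iff intro: H32_mono)

lemma H32_plus_plus0: "u \<in> H32_plus G \<Longrightarrow> u \<in> H32_plus0 G"
  by (auto simp: H32_plus_iff H32_plus0_iff)

lemma spin_H32_plus: "spin j p \<in> H32_plus {Xi j, Eta j}"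
proof -
  have "norm p < hyp p"
    by (simp add: hyp_def norm_prod_def)
  then show ?thesis by (simp add: H32_plus_iff bpart_spin spin_H32)
qed

lemma sinner_spin_self: "sinner (spin j p) (spin j p) = -1"
  using spin_in_H22[of j p] by (simp add: H22_def)

definition mass :: "'g::linorder svec \<Rightarrow> 'g ev" where
  "mass c = evpow (1/2) (- evs c c)"

lemma body_mass_square_pos: "c \<in> H32_plus G \<Longrightarrow> finite G \<Longrightarrow> evbody (- evs c c) > 0"
  using gr_evs[of c G c G] body_gr[of "evs c c"] by (auto simp: H32_plus_def)

lemma mass_evG:
  assumes "c \<in> H32 G" "finite G"
  shows "mass c \<in> evG G"
proof -
  have "evs c c \<in> evG G"
    using sinner_galg(1)[OF assms(1,1)] gr_evs[OF assms(1,1,2,2)] by (simp add: evG_def)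
  then show ?thesis unfolding mass_def using assms by auto
qed

lemma mass_square: "c \<in> H32_plus G \<Longrightarrow> finite G \<Longrightarrow> mass c ^ 2 = - evs c c"
  unfolding mass_def by (rule evpow_half_square[OF body_mass_square_pos])

lemma mass_pos: "c \<in> H32_plus G \<Longrightarrow> finite G \<Longrightarrow> evbody (mass c) > 0"
  using body_mass_square_pos[of c G] by (simp add: mass_def evbody_evpow)

lemma mass_scaleR:
  assumes "c \<in> H32_plus G" "finite G" "r > 0"
  shows "mass (r *\<^sub>R c) = r *\<^sub>R mass c"
proof (rule ev_square_unique)
  have rc: "r *\<^sub>R c \<in> H32_plus G" using assms by (intro H32_plus_scaleR)
  have H: "c \<in> H32 G" "r *\<^sub>R c \<in> H32 G" using assms rc by (auto simp: H32_plus_iff)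
  have "gr (evs (r *\<^sub>R c) (r *\<^sub>R c)) = gr ((r\<^sup>2) *\<^sub>R evs c c)"
    using assms H by (simp add: gr_evs[OF _ _ assms(2,2)] gr_simps sinner_linear power2_eq_square)
  then have "evs (r *\<^sub>R c) (r *\<^sub>R c) = (r\<^sup>2) *\<^sub>R evs c c" by (simp only: gr_eq_iff)
  then show "mass (r *\<^sub>R c) ^ 2 = (r *\<^sub>R mass c) ^ 2"
    using mass_square[OF rc assms(2)] mass_square[OF assms(1,2)]
    by (simp add: power2_eq_square)
  show "evbody (mass (r *\<^sub>R c)) > 0" by (rule mass_pos[OF rc assms(2)])
  show "evbody (r *\<^sub>R mass c) > 0" using mass_pos[OF assms(1,2)] assms(3) by simp
qed

text \<open>Localization evaluates the root at \<open>- \<langle>v, c\<rangle> = m\<close>, where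
  its argument \<open>W^2 + m^2 + 2 * W * m\<close> is the perfect square of
  \<open>W + m\<close>.\<close>

lemma single_sq_fun:
  fixes j :: "'v::linorder"
  assumes c: "c \<in> H32_plus G" and G: "finite G" "Xi j \<notin> G" "Eta j \<notin> G" and W: "W \<ge> 0"
  defines "\<kappa> \<equiv> of_real (W ^ 2) + mass c ^ 2"
  defines "f \<equiv> \<lambda>p. vderiv j (inv_z j p * gr (evexp (evs (spin j p) c - evpow (1/2) (\<kappa> - of_real (2 * W) * evs (spin j p) c))))"
  shows "gintegrable lborel f" "gint lborel f = (2 * pi) *\<^sub>R gr (evexp (- mass c - (of_real W + mass c)))"
proof -
  have cH: "c \<in> H32 G" using c by (simp add: H32_plus_iff)
  obtain b1 b2 b3 \<gamma>1 \<gamma>2 where b: "c = (gr b1, gr b2, gr b3, \<gamma>1, \<gamma>2)" "b1 \<in> evG G" "b2 \<in> evG G" "b3 \<in> evG G"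
    "\<gamma>1 \<in> galg G" "\<gamma>1 \<in> godd" "\<gamma>2 \<in> galg G" "\<gamma>2 \<in> godd"
    by (rule H32_components[OF cH G(1)])
  have b3: "evbody b3 > 0"
    using c by (auto simp: b(1) H32_plus_def body_gr)
  have mG: "mass c \<in> evG G" by (rule mass_evG[OF cH G(1)])
  have "\<gamma>2 * \<gamma>1 = - (\<gamma>1 * \<gamma>2)" by (rule godd_anticommute) fact+
  moreover have "gr (Ev (\<gamma>1 * \<gamma>2)) = \<gamma>1 * \<gamma>2"
    using b by (intro gr_Ev[OF _ _ G(1)] godd_mult galg_mult)
  moreover have "gr (evs c c) = gr b1 * gr b1 + gr b2 * gr b2 - gr b3 * gr b3 + \<gamma>1 * \<gamma>2 - \<gamma>2 * \<gamma>1"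
    by (subst gr_evs[OF cH cH G(1,1)]) (simp only: b(1) sinner.simps)
  ultimately have "gr (evs c c) = gr (b1 ^ 2 + b2 ^ 2 - b3 ^ 2 + (Ev (\<gamma>1 * \<gamma>2) + Ev (\<gamma>1 * \<gamma>2)))"
    by (simp only: gr_simps power2_eq_square diff_minus_eq_add add.assoc)
  then have "evs c c = b1 ^ 2 + b2 ^ 2 - b3 ^ 2 + (Ev (\<gamma>1 * \<gamma>2) + Ev (\<gamma>1 * \<gamma>2))" by (simp only: gr_eq_iff)
  then have m2: "mass c ^ 2 = b3 ^ 2 - b1 ^ 2 - b2 ^ 2 - 2 * Ev (\<gamma>1 * \<gamma>2)"
    unfolding mass_square[OF c G(1)] mult_2 by simp
  have mp: "evbody (mass c) > 0" by (rule mass_pos[OF c G(1)])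
  have \<kappa>: "\<kappa> \<in> evG G" "evbody \<kappa> > 0"
    using mG mp by (auto simp: \<kappa>_def add_nonneg_pos intro!: evG_simps evG_power)
  have F: "super_fun G (sq_fun \<kappa> (2 * W))" "super_fun (G \<union> {Xi j, Eta j}) (sq_fun \<kappa> (2 * W))"
    using \<kappa> G W by (auto intro!: super_fun_sq_fun intro: evG_mono)
  have F0: "sq_fun \<kappa> (2 * W) 0 q = evexp (- q - evpow (1/2) (\<kappa> + of_real (2 * W) * q))" for q
    by (simp add: sq_fun_def Let_def sq_exp_def sq_root_def)
  have f: "f = (\<lambda>p. vderiv j (inv_z j p * gr (sq_fun \<kappa> (2 * W) 0 (- evs (spin j p) (gr b1, gr b2, gr b3, \<gamma>1, \<gamma>2)))))"
    unfolding f_def F0 b(1)[symmetric] by simp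
  show "gintegrable lborel f"
    unfolding f by (rule single_spin(1)[OF F G b(2-4) mG b(5-8) m2 b3 mp])
  have "\<kappa> + of_real (2 * W) * mass c = (of_real W + mass c) ^ 2"
    by (simp add: \<kappa>_def power2_eq_square algebra_simps)
  then have "evpow (1/2) (\<kappa> + of_real (2 * W) * mass c) = of_real W + mass c"
    using mp W by (simp add: evpow_half_of_square add_nonneg_pos)
  moreover have "gint lborel f = (2 * pi) *\<^sub>R gr (sq_fun \<kappa> (2 * W) 0 (mass c))"
    unfolding f by (rule single_spin(2)[OF F G b(2-4) mG b(5-8) m2 b3 mp])
  ultimately show "gint lborel f = (2 * pi) *\<^sub>R gr (evexp (- mass c - (of_real W + mass c)))"
    by (simp only: F0)
qed

lemma vderiv_gr_mult:
  assumes "e \<in> evG G" "Xi j \<notin> G" "Eta j \<notin> G"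
  shows "vderiv j (z * (gr e * a)) = gr e * vderiv j (z * a)"
proof -
  have "z * (gr e * a) = gr e * (z * a)"
    using geven_commute[OF gr_even, of e z] by (simp flip: mult.assoc)
  moreover have "gr e \<in> galg (- {Xi j, Eta j})"
    using assms by (auto simp: evG_def intro: galg_mono)
  ultimately show ?thesis
    by (simp add: vderiv_mult_even[OF gr_even])
qed

text \<open>The case \<open>W = 0\<close> of \<open>single_sq_fun\<close>: the root is then the
  constant \<open>mass c\<close>, and the prefactor \<open>evexp (e + mass c)\<close> compensates
  for it.\<close>

lemma single_exp:
  fixes j :: "'v::linorder"
  assumes c: "c \<in> H32_plus G" and G: "finite G" "Xi j \<notin> G" "Eta j \<notin> G" and e: "e \<in> evG G"
  defines "f \<equiv> \<lambda>p. vderiv j (inv_z j p * gr (evexp (e + evs (spin j p) c)))"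
  shows "gintegrable lborel f" "gint lborel f = (2 * pi) *\<^sub>R gr (evexp (e - mass c))"
proof -
  have mp: "evbody (mass c) > 0" by (rule mass_pos[OF c G(1)])
  have cH: "c \<in> H32 G" using c by (simp add: H32_plus_iff)
  note s = single_sq_fun[OF c G order_refl]
  have m: "evpow (1/2) (mass c ^ 2) = mass c" using mp by (rule evpow_half_of_square)
  have eG: "evexp (e + mass c) \<in> evG G" using e mass_evG[OF cH G(1)] G(1) by (intro evexp_evG evG_simps)
  have "evexp (e + evs (spin j p) c) = evexp (e + mass c) * evexp (evs (spin j p) c - mass c)" for p
    by (simp flip: evexp_add)
  then have f: "f = (\<lambda>p. gr (evexp (e + mass c)) * vderiv j (inv_z j p * gr (evexp (evs (spin j p) c - mass c))))"
    unfolding f_def by (simp only: gr_simps(4) vderiv_gr_mult[OF eG G(2,3)])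
  have s': "gintegrable lborel (\<lambda>p. vderiv j (inv_z j p * gr (evexp (evs (spin j p) c - mass c))))"
    "gint lborel (\<lambda>p. vderiv j (inv_z j p * gr (evexp (evs (spin j p) c - mass c)))) = (2 * pi) *\<^sub>R gr (evexp (- mass c - mass c))"
    using s by (simp_all add: m)
  show "gintegrable lborel f" unfolding f by (rule gint_mult(1)[OF s'(1)])
  show "gint lborel f = (2 * pi) *\<^sub>R gr (evexp (e - mass c))"
    unfolding f gint_mult(2)[OF s'(1)] s'(2) by (simp flip: gr_simps(4) evexp_add)
qed

text \<open>
  The factor with exponent \<open>- mass (W v + c)\<close> arises from a spin that has been integrated out before,
  with coupling \<open>W\<close> to the spin \<open>v\<close> at \<open>j\<close> and with the same field \<open>c\<close>.
\<close>

lemma pair_exp: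
  fixes j :: "'v::linorder"
  assumes c: "c \<in> H32_plus G" and G: "finite G" "Xi j \<notin> G" "Eta j \<notin> G" and e: "e \<in> evG G" and W: "W \<ge> 0"
  defines "f \<equiv> \<lambda>p. vderiv j (inv_z j p * gr (evexp (e + evs (spin j p) c - mass (W *\<^sub>R spin j p + c))))"
  shows "gintegrable lborel f" "gint lborel f = (2 * pi) *\<^sub>R gr (evexp (e - of_real W - 2 *\<^sub>R mass c))"
proof -
  have cH: "c \<in> H32 G" using c by (simp add: H32_plus_iff)
  note s = single_sq_fun[OF c G W]
  let ?G = "G \<union> {Xi j, Eta j}"
  \<comment> \<open>Since a spin has inner square -1, that of \<open>W v + c\<close> is affine in
    the spin \<open>v\<close>; this brings the mass into the form of
    \<open>single_sq_fun\<close>.\<close>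
  have m: "mass (W *\<^sub>R spin j p + c) = evpow (1/2) (of_real (W ^ 2) + mass c ^ 2 - of_real (2 * W) * evs (spin j p) c)" for p
  proof -
    have H: "spin j p \<in> H32 ?G" "c \<in> H32 ?G" by (rule H32_mono[OF spin_H32], force) (rule H32_mono[OF cH], force)
    have H': "W *\<^sub>R spin j p + c \<in> H32 ?G" using H by (intro H32_add H32_scaleR)
    have fin: "finite ?G" using G by simp
    have "gr (evs (W *\<^sub>R spin j p + c) (W *\<^sub>R spin j p + c)) = gr (- of_real (W ^ 2) + of_real (2 * W) * evs (spin j p) c + evs c c)"
      unfolding gr_simps gr_evs[OF H' H' fin fin] gr_evs[OF H fin fin] gr_evs[OF H(2,2) fin fin] sinner_linear gr_of_real
        sinner_spin_self sinner_commute[OF H(2,1)]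
      by (simp add: of_real_def power2_eq_square algebra_simps scaleR_2[symmetric])
    then have E: "evs (W *\<^sub>R spin j p + c) (W *\<^sub>R spin j p + c) = - of_real (W ^ 2) + of_real (2 * W) * evs (spin j p) c + evs c c"
      by (simp only: gr_eq_iff)
    show ?thesis
      unfolding mass_def[of "W *\<^sub>R spin j p + c"] mass_square[OF c G(1)] E by (simp add: algebra_simps)
  qed
  have eG: "evexp e \<in> evG G" using e G(1) by (intro evexp_evG)
  have "evexp (e + evs (spin j p) c - mass (W *\<^sub>R spin j p + c)) = evexp e * evexp (evs (spin j p) c - mass (W *\<^sub>R spin j p + c))" for p
    by (simp flip: evexp_add add: algebra_simps)
  then have f: "f = (\<lambda>p. gr (evexp e) * vderiv j (inv_z j p * gr (evexp (evs (spin j p) c - mass (W *\<^sub>R spin j p + c)))))"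
    unfolding f_def by (simp only: gr_simps(4) vderiv_gr_mult[OF eG G(2,3)])
  note s' = s[unfolded m[symmetric]]
  show "gintegrable lborel f" unfolding f by (rule gint_mult(1)[OF s'(1)])
  show "gint lborel f = (2 * pi) *\<^sub>R gr (evexp (e - of_real W - 2 *\<^sub>R mass c))"
    unfolding f gint_mult(2)[OF s'(1)] s'(2)
    by (simp flip: gr_simps(4) evexp_add add: scaleR_2 algebra_simps)
qed

section \<open>Integrating out one vertex\<close>

text \<open>\<open>berezin_integrand\<close> with the superfunction replaced by a Grassmann value,
  so that the integrand can be any function of the points \<open>p\<close> once vertices have been
  integrated out.\<close>

definition bz :: "'v::linorder set \<Rightarrow> 'v gen grassmann \<Rightarrow> ('v \<Rightarrow> real \<times> real) \<Rightarrow> 'v gen grassmann" where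
  "bz \<Lambda> a p = foldr vderiv (sorted_list_of_set \<Lambda>) ((\<Prod>j\<leftarrow>sorted_list_of_set \<Lambda>. inv_z j (p j)) * a)"

abbreviation plane_prod :: "'v set \<Rightarrow> ('v \<Rightarrow> real \<times> real) measure" where
  "plane_prod \<Lambda> \<equiv> PiM \<Lambda> (\<lambda>_. lborel)"

definition sint :: "'v::linorder set \<Rightarrow> (('v \<Rightarrow> real \<times> real) \<Rightarrow> 'v gen grassmann) \<Rightarrow> 'v gen grassmann" where
  "sint \<Lambda> g = (1 / (2 * pi) ^ card \<Lambda>) *\<^sub>R gint (plane_prod \<Lambda>) (\<lambda>p. bz \<Lambda> (g p) p)"

definition sintegrable :: "'v::linorder set \<Rightarrow> (('v \<Rightarrow> real \<times> real) \<Rightarrow> 'v gen grassmann) \<Rightarrow> bool" where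
  "sintegrable \<Lambda> g \<longleftrightarrow> gintegrable (plane_prod \<Lambda>) (\<lambda>p. bz \<Lambda> (g p) p)"

lemma berezin_integrand_bz: "berezin_integrand \<Lambda> f p = bz \<Lambda> (f (\<lambda>j. spin j (p j))) p"
  by (simp add: berezin_integrand_def bz_def inv_z_def vderiv_def[abs_def])

lemma super_integrable_sintegrable: "super_integrable \<Lambda> f \<longleftrightarrow> sintegrable \<Lambda> (\<lambda>p. f (\<lambda>j. spin j (p j)))"
  by (simp add: super_integrable_def sintegrable_def gintegrable_def berezin_integrand_bz)

lemma super_integral_sint: "super_integral \<Lambda> f = sint \<Lambda> (\<lambda>p. f (\<lambda>j. spin j (p j)))"
  by (rule grassmann_eqI) (simp add: super_integral.rep_eq sint_def gint.rep_eq berezin_integrand_bz)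

lemma inv_z_even: "inv_z j p \<in> geven" "inv_z j p \<in> galg {Xi j, Eta j}"
  unfolding inv_z_eq by (intro geven_diff geven_of_real geven_scaleR godd_mult godd_gvar galg_diff galg_of_real galg_scaleR galg_mult galg_gvar; simp)+

lemma prod_inv_z_even: "(\<Prod>j\<leftarrow>L. inv_z j (p j)) \<in> geven"
  by (induction L) (auto intro: geven_1 geven_mult inv_z_even)

lemma prod_inv_z_galg: "set L \<subseteq> R \<Longrightarrow> (\<Prod>j\<leftarrow>L. inv_z j (p j)) \<in> galg (Xi ` R \<union> Eta ` R)"
proof (induction L)
  case (Cons x L)
  then have "inv_z x (p x) \<in> galg (Xi ` R \<union> Eta ` R)" by (intro galg_mono[OF inv_z_even(2)]) auto
  then show ?case using Cons by (auto intro: galg_mult)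
qed (auto intro: galg_1)

lemma prod_insort: "(\<Prod>j\<leftarrow>insort x L. inv_z j (p j)) = inv_z x (p x) * (\<Prod>j\<leftarrow>L. inv_z j (p j))"
proof (induction L)
  case (Cons y L)
  have "inv_z y (p y) * (inv_z x (p x) * a) = inv_z x (p x) * (inv_z y (p y) * a)" for a
    using geven_commute[OF inv_z_even(1), of y "p y" "inv_z x (p x)"] by (simp flip: mult.assoc)
  then show ?case using Cons by simp
qed simp

lemma foldr_insort: "foldr vderiv (insort x L) a = foldr vderiv L (vderiv x a)"
proof (induction L arbitrary: a)
  case (Cons y L)
  have comm: "foldr vderiv L (vderiv x a) = vderiv x (foldr vderiv L a)" for a
    by (induction L) (simp_all add: vderiv_commute[of _ x])
  show ?case using Cons by (simp add: comm vderiv_commute[of x y])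
qed simp

text \<open>The factors \<open>1 / z\<close> and the paired derivatives commute, so vertex
  \<open>j\<close> can be made innermost whatever its place in the sorted list.\<close>

lemma bz_insert:
  assumes "finite R" "j \<notin> R"
  shows "bz (insert j R) a p = bz R (vderiv j (inv_z j (p j) * a)) p"
proof -
  let ?L = "sorted_list_of_set R"
  have L: "sorted_list_of_set (insert j R) = insort j ?L"
    using assms by (simp add: sorted_list_of_set.sorted_key_list_of_set_insert)
  let ?Z = "\<Prod>k\<leftarrow>?L. inv_z k (p k)"
  have "?Z \<in> galg (Xi ` R \<union> Eta ` R)" using assms by (intro prod_inv_z_galg) simp
  then have Z: "?Z \<in> geven" "?Z \<in> galg (- {Xi j, Eta j})"
    using assms by (auto intro: prod_inv_z_even galg_mono)
  have "(inv_z j (p j) * ?Z) * a = ?Z * (inv_z j (p j) * a)"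
    using geven_commute[OF Z(1), of "inv_z j (p j)"] by (simp flip: mult.assoc)
  then show ?thesis
    unfolding bz_def L foldr_insort prod_insort by (simp add: vderiv_mult_even[OF Z])
qed

lemma bz_cong: "(\<And>j. j \<in> \<Lambda> \<Longrightarrow> p j = p' j) \<Longrightarrow> finite \<Lambda> \<Longrightarrow> bz \<Lambda> a p = bz \<Lambda> a p'"
  unfolding bz_def by (intro arg_cong[where f = "foldr vderiv _"] arg_cong2[where f = "(*)"] arg_cong[where f = prod_list] map_cong) auto

lemma gint_bz:
  fixes f :: "'x \<Rightarrow> 'v::linorder gen grassmann"
  assumes "gintegrable M f"
  shows "gintegrable M (\<lambda>y. bz \<Lambda> (f y) p)" "gint M (\<lambda>y. bz \<Lambda> (f y) p) = bz \<Lambda> (gint M f) p"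
proof -
  have fold: "gintegrable M (\<lambda>y. foldr vderiv L (f y)) \<and> gint M (\<lambda>y. foldr vderiv L (f y)) = foldr vderiv L (gint M f)"
    if "gintegrable M f" for L and f :: "'x \<Rightarrow> 'v gen grassmann"
  proof (induction L)
    case (Cons x L)
    then show ?case using gint_vderiv[of M "\<lambda>y. foldr vderiv L (f y)" x] by (simp add: comp_def)
  qed (simp add: that)
  show "gintegrable M (\<lambda>y. bz \<Lambda> (f y) p)" "gint M (\<lambda>y. bz \<Lambda> (f y) p) = bz \<Lambda> (gint M f) p"
    using fold[OF gint_mult(1)[OF assms]] gint_mult(2)[OF assms] by (simp_all add: bz_def)
qed

lemma bz_scaleR: "bz \<Lambda> (r *\<^sub>R a) p = r *\<^sub>R bz \<Lambda> a p"
proof -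
  have "foldr vderiv L (r *\<^sub>R a) = r *\<^sub>R foldr vderiv L a" for L and a :: "'a gen grassmann"
    by (induction L) (simp_all add: vderiv_def gderiv_scaleR)
  then show ?thesis by (simp add: bz_def)
qed

interpretation plane: product_sigma_finite "\<lambda>_ :: 'v. lborel :: (real \<times> real) measure" ..

text \<open>Fubini with one factor split off and points written as updates. The partial integral
  being integrable is what allows the next vertex to be integrated out.\<close>

lemma integrable_integral_insert:
  fixes f :: "('v \<Rightarrow> real \<times> real) \<Rightarrow> real"
  assumes I: "finite I" "i \<notin> I" and f: "integrable (plane_prod (insert i I)) f"
  shows "integrable (plane_prod I) (\<lambda>x. \<integral>y. f (x(i := y)) \<partial>lborel)"
proof -
  interpret P: pair_sigma_finite "plane_prod I" "plane_prod {i}"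
    by (intro pair_sigma_finite.intro plane.sigma_finite) (use I in auto)
  have f_int: "integrable (plane_prod I \<Otimes>\<^sub>M plane_prod {i}) (\<lambda>x. f (merge I {i} x))"
    by (rule integrable_distr[OF measurable_merge]) (use I f plane.distr_merge[of I "{i}"] in simp)
  have "integrable (plane_prod I) (\<lambda>x. \<integral>y. f (merge I {i} (x, y)) \<partial>plane_prod {i})"
    by (rule P.integrable_fst'[OF f_int])
  moreover have "(\<integral>y. f (merge I {i} (x, y)) \<partial>plane_prod {i}) = (\<integral>y. f (x(i := y)) \<partial>lborel)"
    if x: "x \<in> space (plane_prod I)" for x
  proof (subst plane.product_integral_singleton[symmetric])
    have f_borel: "f \<in> borel_measurable (plane_prod (insert i I))" using f by auto
    show "(\<lambda>y. f (x(i := y))) \<in> borel_measurable lborel"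
      using measurable_comp[OF measurable_component_update f_borel, OF x I(2)] unfolding comp_def .
    show "(\<integral>y. f (merge I {i} (x, y)) \<partial>plane_prod {i}) = (\<integral>y. f (x(i := y i)) \<partial>plane_prod {i})"
      using x I by (auto intro!: Bochner_Integration.integral_cong arg_cong[where f = f]
          simp: merge_def space_PiM extensional_def PiE_def)
  qed
  ultimately show ?thesis
    by (subst Bochner_Integration.integrable_cong[OF refl, symmetric])
qed

text \<open>The one-spin integral commutes with the Berezin operations at the other vertices, and
  its factor \<open>2 * pi\<close> accounts for the normalization that disappears with the
  vertex.\<close>

lemma integrate_vertex:
  assumes R: "finite R" "j \<notin> R" and g: "sintegrable (insert j R) g"
    and inner: "\<And>x. gintegrable lborel (\<lambda>y. vderiv j (inv_z j y * g (x(j := y))))"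
      "\<And>x. gint lborel (\<lambda>y. vderiv j (inv_z j y * g (x(j := y)))) = (2 * pi) *\<^sub>R g' x"
  shows "sintegrable R g'" "sint (insert j R) g = sint R g'"
proof -
  let ?f = "\<lambda>p S. gcoeff (bz (insert j R) (g p) p) S"
  have f_int: "integrable (plane_prod (insert j R)) (\<lambda>p. ?f p S)" for S
    using g by (simp add: sintegrable_def gintegrable_def)
  have f_inner: "(\<integral>y. ?f (x(j := y)) S \<partial>lborel) = 2 * pi * gcoeff (bz R (g' x) x) S" for x S
  proof -
    have "bz (insert j R) (g (x(j := y))) (x(j := y)) = bz R (vderiv j (inv_z j y * g (x(j := y)))) x" for y
      unfolding bz_insert[OF R] using R by (auto intro!: bz_cong)
    then have "(\<integral>y. ?f (x(j := y)) S \<partial>lborel) = gcoeff (gint lborel (\<lambda>y. bz R (vderiv j (inv_z j y * g (x(j := y)))) x)) S"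
      by (simp add: gint.rep_eq)
    also have "\<dots> = 2 * pi * gcoeff (bz R (g' x) x) S"
      unfolding gint_bz(2)[OF inner(1)] inner(2) bz_scaleR by simp
    finally show ?thesis .
  qed
  have "integrable (plane_prod R) (\<lambda>x. 2 * pi * gcoeff (bz R (g' x) x) S)" for S
    using integrable_integral_insert[OF R f_int, of S] unfolding f_inner .
  then show "sintegrable R g'"
    by (simp add: sintegrable_def gintegrable_def)
  show "sint (insert j R) g = sint R g'"
  proof (rule grassmann_eqI)
    fix S
    have "gcoeff (sint (insert j R) g) S = (1 / (2 * pi) ^ card (insert j R)) * (\<integral>p. ?f p S \<partial>plane_prod (insert j R))"
      by (simp add: sint_def gint.rep_eq)
    also have "(\<integral>p. ?f p S \<partial>plane_prod (insert j R)) = (\<integral>x. 2 * pi * gcoeff (bz R (g' x) x) S \<partial>plane_prod R)"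
      by (simp only: plane.product_integral_insert[OF R f_int] f_inner)
    also have "\<dots> = 2 * pi * (\<integral>x. gcoeff (bz R (g' x) x) S \<partial>plane_prod R)"
      by (rule Bochner_Integration.integral_mult_right_zero)
    finally show "gcoeff (sint (insert j R) g) S = gcoeff (sint R g') S"
      using R by (simp add: sint_def gint.rep_eq)
  qed
qed

section \<open>Merging two vertices\<close>

definition vgens :: "'v set \<Rightarrow> 'v gen set" where
  "vgens R = Xi ` R \<union> Eta ` R"

text \<open>The joint exponent of action and sources. The field \<open>b i\<close> will be
  \<open>h i\<close> times the origin plus the source, so \<open>h\<close> remains visible only in
  the constant part of the pinning term.\<close>

definition texp :: "'v::linorder set \<Rightarrow> ('v \<Rightarrow> 'v \<Rightarrow> real) \<Rightarrow> ('v \<Rightarrow> real) \<Rightarrow> ('v \<Rightarrow> 'v gen svec) \<Rightarrow> ('v \<Rightarrow> real \<times> real) \<Rightarrow> 'v gen ev" where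
  "texp \<Lambda> W h b p = (\<Sum>i\<in>\<Lambda>. \<Sum>k\<in>\<Lambda>. W i k *\<^sub>R (1 + evs (spin i (p i)) (spin k (p k)))) +
     (\<Sum>i\<in>\<Lambda>. of_real (h i) + evs (spin i (p i)) (b i))"

text \<open>The couplings are symmetrized because the action sums over ordered pairs.\<close>

definition field :: "'v::linorder \<Rightarrow> 'v set \<Rightarrow> ('v \<Rightarrow> 'v \<Rightarrow> real) \<Rightarrow> ('v \<Rightarrow> 'v gen svec) \<Rightarrow> ('v \<Rightarrow> real \<times> real) \<Rightarrow> 'v gen svec" where
  "field j R W b p = (\<Sum>k\<in>R. (W j k + W k j) *\<^sub>R spin k (p k)) + b j"

definition field_const :: "'v \<Rightarrow> 'v set \<Rightarrow> ('v \<Rightarrow> 'v \<Rightarrow> real) \<Rightarrow> ('v \<Rightarrow> real) \<Rightarrow> real" where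
  "field_const j R W h = (\<Sum>k\<in>R. W j k + W k j) + h j"

lemma gr_evs_spin: "gr (evs (spin i p) (spin k p')) = sinner (spin i p) (spin k p')"
  by (rule gr_evs[OF spin_H32 spin_H32]) auto

lemma gr_evs_spin': "b \<in> H32 G \<Longrightarrow> finite G \<Longrightarrow> gr (evs (spin i p) b) = sinner (spin i p) b"
  by (rule gr_evs[OF spin_H32]) auto

lemma spin_H32_vgens: "i \<in> R \<Longrightarrow> spin i p \<in> H32 (vgens R)"
  by (rule H32_mono[OF spin_H32]) (auto simp: vgens_def)

lemma field_H32:
  assumes "b j \<in> H32 G"
  shows "field j R W b p \<in> H32 (G \<union> vgens R)"
  unfolding field_def using assms
  by (intro H32_add H32_sum H32_scaleR H32_mono[OF spin_H32_vgens] H32_mono[OF assms]) auto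

lemma evs_spin_evG:
  assumes "b \<in> H32 G" "finite G" "Xi i \<in> G" "Eta i \<in> G"
  shows "evs (spin i p) b \<in> evG G"
proof -
  have "spin i p \<in> H32 G" by (rule H32_mono[OF spin_H32]) (use assms in auto)
  then show ?thesis
    using assms sinner_galg(1)[of "spin i p" G b] by (simp add: evG_def gr_evs_spin')
qed

lemma texp_evG:
  assumes "finite R" "finite G" "\<And>i. i \<in> R \<Longrightarrow> b i \<in> H32 G"
  shows "texp R W h b p \<in> evG (G \<union> vgens R)"
  unfolding texp_def
proof (intro evG_simps evG_sum)
  have fin: "finite (G \<union> vgens R)" using assms by (auto simp: vgens_def)
  show "evs (spin i (p i)) (spin k (p k)) \<in> evG (G \<union> vgens R)" if "i \<in> R" "k \<in> R" for i k
    by (rule evs_spin_evG[OF H32_mono[OF spin_H32_vgens] fin]) (use that in \<open>auto simp: vgens_def\<close>)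
  show "evs (spin i (p i)) (b i) \<in> evG (G \<union> vgens R)" if "i \<in> R" for i
    by (rule evs_spin_evG[OF H32_mono[OF assms(3)] fin]) (use that in \<open>auto simp: vgens_def\<close>)
qed

text \<open>The diagonal term vanishes by \<open>\<langle>v, v\<rangle> = -1\<close>, so the
  exponent is affine in each spin; \<open>field\<close> gives its linear part.\<close>

lemma texp_insert:
  assumes R: "finite R" "j \<notin> R" and b: "finite G" "b j \<in> H32 G"
  shows "texp (insert j R) W h b p = texp R W h b p + of_real (field_const j R W h) + evs (spin j (p j)) (field j R W b p)"
proof -
  let ?s = "\<lambda>i. spin i (p i)"
  have self: "evs (?s j) (?s j) = -1"
    using gr_evs_spin[of j "p j" j "p j"] by (simp add: sinner_spin_self gr_eq_iff[symmetric] gr_simps)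
  have comm: "evs (?s k) (?s j) = evs (?s j) (?s k)" for k
    using sinner_commute[OF spin_H32 spin_H32, of k "p k" j "p j"] by (simp add: evs_def)
  have "evs (?s j) (field j R W b p) = (\<Sum>k\<in>R. (W j k + W k j) *\<^sub>R evs (?s j) (?s k)) + evs (?s j) (b j)"
  proof -
    have "finite (G \<union> vgens R)" using R b by (auto simp: vgens_def)
    then have "gr (evs (?s j) (field j R W b p)) = sinner (?s j) (field j R W b p)"
      by (rule gr_evs_spin'[OF field_H32[where b = b and j = j, OF b(2)]])
    also have "\<dots> = gr ((\<Sum>k\<in>R. (W j k + W k j) *\<^sub>R evs (?s j) (?s k)) + evs (?s j) (b j))"
      by (simp add: field_def sinner_linear sinner_sum gr_simps gr_sum gr_evs_spin gr_evs_spin'[OF b(2,1)])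
    finally show ?thesis by (simp only: gr_eq_iff)
  qed
  moreover have "texp (insert j R) W h b p = texp R W h b p + (\<Sum>k\<in>R. (W j k + W k j) *\<^sub>R (1 + evs (?s j) (?s k))) + (of_real (h j) + evs (?s j) (b j))"
  proof -
    define f where "f i k = W i k *\<^sub>R (1 + evs (?s i) (?s k))" for i k
    have "(\<Sum>i\<in>insert j R. \<Sum>k\<in>insert j R. f i k) = (\<Sum>i\<in>R. \<Sum>k\<in>R. f i k) + (\<Sum>k\<in>R. f j k + f k j) + f j j"
      using R by (simp add: sum.distrib ac_simps)
    moreover have "f j j = 0" by (simp add: f_def self)
    moreover have "f j k + f k j = (W j k + W k j) *\<^sub>R (1 + evs (?s j) (?s k))" for k
      by (simp only: f_def comm scaleR_add_left)
    ultimately have "(\<Sum>i\<in>insert j R. \<Sum>k\<in>insert j R. f i k) =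
        (\<Sum>i\<in>R. \<Sum>k\<in>R. f i k) + (\<Sum>k\<in>R. (W j k + W k j) *\<^sub>R (1 + evs (?s j) (?s k)))"
      by (simp only: add_0_right)
    then show ?thesis
      unfolding texp_def f_def by (simp only: sum.insert[OF R] ac_simps)
  qed
  moreover have "(\<Sum>k\<in>R. (W j k + W k j) *\<^sub>R (1 + evs (?s j) (?s k))) =
      of_real (\<Sum>k\<in>R. W j k + W k j) + (\<Sum>k\<in>R. (W j k + W k j) *\<^sub>R evs (?s j) (?s k))"
    unfolding scaleR_add_right sum.distrib[of "\<lambda>k. (W j k + W k j) *\<^sub>R 1"] of_real_def scaleR_sum_left ..
  ultimately show ?thesis
    by (simp only: field_const_def of_real_add ac_simps)
qed

lemma texp_update: "j \<notin> R \<Longrightarrow> texp R W h b (p(j := y)) = texp R W h b p"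
  unfolding texp_def by (intro arg_cong2[where f = "(+)"] sum.cong) auto

lemma field_update: "j \<notin> R \<Longrightarrow> field i R W b (p(j := y)) = field i R W b p"
  unfolding field_def by (intro arg_cong2[where f = "(+)"] sum.cong) auto

text \<open>With the other spins frozen, their generators in the field count as parameters for the
  one-spin integral at \<open>j\<close>; hence the cone over
  \<open>G \<union> vgens R\<close>.\<close>

lemma eliminate_vertex:
  assumes R: "finite R" "j \<notin> R" and G: "finite G" "G \<inter> vgens (insert j R) = {}"
    and b: "\<And>i. i \<in> insert j R \<Longrightarrow> b i \<in> H32 G"
    and cone: "\<And>x. field j R W b x \<in> H32_plus (G \<union> vgens R)"
    and int: "sintegrable (insert j R) (\<lambda>p. gr (evexp (texp (insert j R) W h b p)))"
  defines "g' \<equiv> \<lambda>x. gr (evexp (texp R W h b x + of_real (field_const j R W h) - mass (field j R W b x)))"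
  shows "sintegrable R g'" "sint (insert j R) (\<lambda>p. gr (evexp (texp (insert j R) W h b p))) = sint R g'"
proof -
  let ?G = "G \<union> vgens R"
  have fin: "finite ?G" and notin: "Xi j \<notin> ?G" "Eta j \<notin> ?G"
    using R G by (auto simp: vgens_def)
  have t: "texp (insert j R) W h b (x(j := y)) =
      (texp R W h b x + of_real (field_const j R W h)) + evs (spin j y) (field j R W b x)" for x y
    using texp_insert[where b = b and W = W and h = h and p = "x(j := y)", OF R G(1) b[OF insertI1]] by (simp add: texp_update[OF R(2)] field_update[OF R(2)])
  have e: "texp R W h b x + of_real (field_const j R W h) \<in> evG ?G" for x
    using texp_evG[OF R(1) G(1)] b by (intro evG_simps) auto
  note s = single_exp[OF cone fin notin e]
  show "sintegrable R g'" "sint (insert j R) (\<lambda>p. gr (evexp (texp (insert j R) W h b p))) = sint R g'"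
    unfolding g'_def by (rule integrate_vertex[OF R int]; unfold t; rule s)+
qed

text \<open>Besides the common field \<open>c\<close>, vertex \<open>i\<close> sees only
  \<open>j\<close>, with total weight \<open>w\<close>. Removing it leaves
  \<open>- mass (w v + c)\<close> at \<open>j\<close>, the form of \<open>pair_exp\<close>. The
  constant \<open>w\<close> in the exponent cancels the \<open>- w\<close> produced there, so the
  coupling between the two drops out.\<close>

lemma eliminate_pair:
  assumes R: "finite R" "j \<notin> R" "i \<notin> R" "i \<noteq> j" and G: "finite G" "G \<inter> vgens (insert i (insert j R)) = {}"
    and b: "\<And>k. k \<in> insert i (insert j R) \<Longrightarrow> b k \<in> H32 G" and W: "W i j \<ge> 0" "W j i \<ge> 0"
    and eq: "\<And>x. field i R W b x = field j R W b x"
    and cone: "\<And>x. field j R W b x \<in> H32_plus (G \<union> vgens R)"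
    and int: "sintegrable (insert i (insert j R)) (\<lambda>p. gr (evexp (texp (insert i (insert j R)) W h b p)))"
  shows "sint (insert i (insert j R)) (\<lambda>p. gr (evexp (texp (insert i (insert j R)) W h b p))) =
    sint R (\<lambda>x. gr (evexp (texp R W h b x + of_real (field_const i R W h + field_const j R W h) - 2 *\<^sub>R mass (field j R W b x))))"
proof -
  let ?G = "G \<union> vgens R" and ?w = "W i j + W j i"
  have fin: "finite ?G" and notin: "Xi j \<notin> ?G" "Eta j \<notin> ?G"
    using R G by (auto simp: vgens_def)
  have f: "field i (insert j R) W b x = ?w *\<^sub>R spin j (x j) + field j R W b x" for x
    using R eq[of x] by (simp add: field_def add.assoc)
  have fc: "field_const i (insert j R) W h = ?w + field_const i R W h"
    using R by (simp add: field_const_def)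
  have sub: "?G \<subseteq> G \<union> vgens (insert j R)" by (auto simp: vgens_def)
  have cone': "field i (insert j R) W b x \<in> H32_plus (G \<union> vgens (insert j R))" for x
    unfolding f
  proof (rule H32_plus_add)
    have "spin j (x j) \<in> H32_plus0 (G \<union> vgens (insert j R))"
      by (rule H32_plus_mono(2)[OF H32_plus_plus0[OF spin_H32_plus]]) (auto simp: vgens_def)
    then show "?w *\<^sub>R spin j (x j) \<in> H32_plus0 (G \<union> vgens (insert j R))"
      using W by (intro H32_plus0_scaleR) auto
    show "field j R W b x \<in> H32_plus (G \<union> vgens (insert j R))"
      by (rule H32_plus_mono(1)[OF cone sub])
  qed
  note 1 = eliminate_vertex[OF _ _ G b cone' int]
  let ?g = "\<lambda>x. gr (evexp (texp (insert j R) W h b x + of_real (field_const i (insert j R) W h) - mass (field i (insert j R) W b x)))"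
  have 2: "sintegrable (insert j R) ?g" using R by (intro 1) auto
  define e where "e x = texp R W h b x + of_real (field_const i R W h + field_const j R W h + ?w)" for x
  have t: "texp (insert j R) W h b (x(j := y)) + of_real (field_const i (insert j R) W h) - mass (field i (insert j R) W b (x(j := y)))
      = e x + evs (spin j y) (field j R W b x) - mass (?w *\<^sub>R spin j y + field j R W b x)" for x y
    using texp_insert[where b = b and W = W and h = h and p = "x(j := y)", OF R(1,2) G(1) b[OF insertI2[OF insertI1]]]
    by (simp add: texp_update[OF R(2)] field_update[OF R(2)] f fc e_def)
  have ew: "e x - of_real ?w = texp R W h b x + of_real (field_const i R W h + field_const j R W h)" for x
    by (simp add: e_def)
  have e: "e x \<in> evG ?G" for x
    unfolding e_def using texp_evG[OF R(1) G(1)] b by (intro evG_simps) auto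
  note s = pair_exp[OF cone fin notin e, of ?w]
  have "sint (insert i (insert j R)) (\<lambda>p. gr (evexp (texp (insert i (insert j R)) W h b p))) = sint (insert j R) ?g"
    using R by (intro 1) auto
  also have "\<dots> = sint R (\<lambda>x. gr (evexp (e x - of_real ?w - 2 *\<^sub>R mass (field j R W b x))))"
    by (rule integrate_vertex(2)[OF R(1,2) 2]; unfold t; rule s; use W in simp)
  finally show ?thesis unfolding ew .
qed

text \<open>Each of \<open>i\<close> and \<open>j\<close> sees half the field of \<open>l\<close>,
  and the mass is homogeneous: \<open>2 * mass (c / 2) = mass c\<close>. So removing the pair leaves
  the same integrand as removing \<open>l\<close>.\<close>

theorem merge_vertices:
  assumes R: "finite R" "j \<notin> R" "i \<notin> R" "i \<noteq> j" "l \<notin> R" and G: "finite G" "G \<inter> vgens UNIV = {}"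
    and b: "\<And>k. k \<in> R \<Longrightarrow> b k \<in> H32 G" "\<And>k. k \<in> R \<Longrightarrow> b' k = b k" "b l \<in> H32 G" "b' i = (1/2) *\<^sub>R b l" "b' j = (1/2) *\<^sub>R b l"
    and W: "W i j \<ge> 0" "W j i \<ge> 0"
      "\<And>k. k \<in> R \<Longrightarrow> W i k + W k i = (W l k + W k l) / 2" "\<And>k. k \<in> R \<Longrightarrow> W j k + W k j = (W l k + W k l) / 2"
    and h: "h i = h l / 2" "h j = h l / 2"
    and cone: "\<And>x. field l R W b x \<in> H32_plus (G \<union> vgens R)"
    and int: "sintegrable (insert i (insert j R)) (\<lambda>p. gr (evexp (texp (insert i (insert j R)) W h b' p)))"
      "sintegrable (insert l R) (\<lambda>p. gr (evexp (texp (insert l R) W h b p)))"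
  shows "sint (insert i (insert j R)) (\<lambda>p. gr (evexp (texp (insert i (insert j R)) W h b' p))) =
    sint (insert l R) (\<lambda>p. gr (evexp (texp (insert l R) W h b p)))"
proof -
  let ?G = "G \<union> vgens R"
  have fin: "finite ?G" using R G by (auto simp: vgens_def)
  have disj: "G \<inter> vgens S = {}" for S using G(2) by (auto simp: vgens_def)
  have f: "field i R W b' x = (1/2) *\<^sub>R field l R W b x" "field j R W b' x = (1/2) *\<^sub>R field l R W b x" for x
    by (simp_all add: field_def scaleR_add_right scaleR_sum_right W(3,4) b(4,5) cong: sum.cong)
  have fc: "field_const i R W h + field_const j R W h = field_const l R W h"
  proof -
    have "(\<Sum>k\<in>R. W i k + W k i) = (\<Sum>k\<in>R. W l k + W k l) / 2" "(\<Sum>k\<in>R. W j k + W k j) = (\<Sum>k\<in>R. W l k + W k l) / 2"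
      unfolding sum_divide_distrib by (simp_all only: W(3,4) cong: sum.cong)
    then show ?thesis by (simp add: field_const_def h)
  qed
  have t: "texp R W h b' x = texp R W h b x" for x
    unfolding texp_def using b(2) by (intro arg_cong2[where f = "(+)"] sum.cong) auto
  have cone': "field j R W b' x \<in> H32_plus ?G" for x
    unfolding f by (rule H32_plus_scaleR[OF cone]) simp
  have bl: "b k \<in> H32 G" if "k \<in> insert l R" for k using that b by auto
  have b': "b' k \<in> H32 G" if "k \<in> insert i (insert j R)" for k
    using that b by (cases "k \<in> R") (auto intro: H32_scaleR)
  have "sint (insert i (insert j R)) (\<lambda>p. gr (evexp (texp (insert i (insert j R)) W h b' p))) =
    sint R (\<lambda>x. gr (evexp (texp R W h b' x + of_real (field_const i R W h + field_const j R W h) - 2 *\<^sub>R mass (field j R W b' x))))"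
    by (rule eliminate_pair[OF R(1-4) G(1) disj b' W(1,2) _ cone' int(1)]) (simp_all add: f)
  also have "\<dots> = sint R (\<lambda>x. gr (evexp (texp R W h b x + of_real (field_const l R W h) - mass (field l R W b x))))"
    unfolding t fc f by (simp add: mass_scaleR[OF cone fin])
  also have "\<dots> = sint (insert l R) (\<lambda>p. gr (evexp (texp (insert l R) W h b p)))"
    by (rule eliminate_vertex(2)[symmetric, OF R(1,5) G(1) disj bl cone int(2)])
  finally show ?thesis .
qed

section \<open>Existence of the superintegrals\<close>

text \<open>The point enters only through its coordinates, \<open>hyp\<close> and
  \<open>1 / hyp\<close>; growth bounds and measurability can be read off from this form.\<close>

lemma evs_spin_expand:
  assumes b: "\<gamma>1 \<in> godd" "\<gamma>2 \<in> godd" "\<gamma>1 \<in> galg G" "\<gamma>2 \<in> galg G" "finite G" "b1 \<in> evG G" "b2 \<in> evG G" "b3 \<in> evG G"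
  shows "evs (spin i P) (gr b1, gr b2, gr b3, \<gamma>1, \<gamma>2) = of_real (fst P) * b1 + of_real (snd P) * b2 -
    (of_real (hyp P) + of_real (1 / hyp P) * Ev (gvar (Xi i) * gvar (Eta i))) * b3 +
    Ev (gvar (Xi i) * \<gamma>2) - Ev (gvar (Eta i) * \<gamma>1)"
proof -
  let ?G = "G \<union> {Xi i, Eta i}"
  have fin: "finite ?G" using b by simp
  have \<gamma>': "\<gamma>1 \<in> galg ?G" "\<gamma>2 \<in> galg ?G" using b by (auto intro: galg_mono)
  have vars: "gvar (Xi i) \<in> galg ?G" "gvar (Eta i) \<in> galg ?G" by (auto intro: galg_gvar)
  have e: "gr (Ev (gvar (Xi i) * \<gamma>2)) = gvar (Xi i) * \<gamma>2" "gr (Ev (gvar (Eta i) * \<gamma>1)) = gvar (Eta i) * \<gamma>1"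
     "gr (Ev (gvar (Xi i) * gvar (Eta i))) = gvar (Xi i) * gvar (Eta i)"
    by (rule gr_Ev[OF _ _ fin]; use b \<gamma>' vars in \<open>auto intro!: godd_mult godd_gvar galg_mult\<close>)+
  have "(gr b1, gr b2, gr b3, \<gamma>1, \<gamma>2) \<in> H32 G"
    using b by (auto simp: H32_def Let_def evG_def gr_even)
  from gr_evs_spin'[OF this b(5)] have "gr (evs (spin i P) (gr b1, gr b2, gr b3, \<gamma>1, \<gamma>2)) = sinner (spin i P) (gr b1, gr b2, gr b3, \<gamma>1, \<gamma>2)" .
  also have "\<dots> = gr (of_real (fst P) * b1 + of_real (snd P) * b2 -
    (of_real (hyp P) + of_real (1 / hyp P) * Ev (gvar (Xi i) * gvar (Eta i))) * b3 +
    Ev (gvar (Xi i) * \<gamma>2) - Ev (gvar (Eta i) * \<gamma>1))"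
    by (simp only: spin_def sinner.simps spin_z_hyp gr_simps gr_of_real e scaleR_conv_of_real)
  finally show ?thesis by (simp only: gr_eq_iff)
qed

lemma spin_components: "spin k P = (gr (of_real (fst P)), gr (of_real (snd P)),
    gr (of_real (hyp P) + of_real (1 / hyp P) * Ev (gvar (Xi k) * gvar (Eta k))), gvar (Xi k), gvar (Eta k))"
proof -
  have "gr (Ev (gvar (Xi k) * gvar (Eta k))) = gvar (Xi k) * gvar (Eta k)"
    by (rule gr_Ev[where G = "{Xi k, Eta k}"]) (auto intro!: godd_mult godd_gvar galg_mult galg_gvar)
  then show ?thesis by (simp add: spin_def spin_z_hyp gr_simps gr_of_real scaleR_conv_of_real)
qed

lemma evbody_evs_spin: "evbody (evs (spin i P) (spin k P')) = P \<bullet> P' - hyp P * hyp P'"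
  using body_sinner[OF spin_H32 spin_H32, of i P k P'] by (simp add: body_gr[symmetric] gr_evs_spin bpart_spin)

lemma evbody_evs_spin': "b \<in> H32 G \<Longrightarrow> finite G \<Longrightarrow> evbody (evs (spin i P) b) = P \<bullet> bpart b - hyp P * tpart b"
  using body_sinner[OF spin_H32, of b G i P] by (simp add: body_gr[symmetric] gr_evs_spin' bpart_spin)

lemma hyp_norm: "hyp P = sqrt (1 + (norm P)\<^sup>2)" "norm P \<le> hyp P"
  by (auto simp: hyp_def norm_prod_def add_nonneg_nonneg add.assoc)

text \<open>Cauchy-Schwarz and \<open>norm P \<le> hyp P\<close>. For a field in the open cone the
  first bound is coercive in \<open>hyp P\<close>.\<close>

lemma cone_pairing:
  assumes "norm B \<le> t"
  shows "hyp P * t - P \<bullet> B \<ge> hyp P * (t - norm B)" "hyp P * t - P \<bullet> B \<ge> 0"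
proof -
  have "P \<bullet> B \<le> norm P * norm B" by (rule norm_cauchy_schwarz)
  also have "\<dots> \<le> hyp P * norm B" using hyp_norm(2) by (intro mult_right_mono) auto
  finally show *: "hyp P * t - P \<bullet> B \<ge> hyp P * (t - norm B)" by (simp add: algebra_simps)
  show "hyp P * t - P \<bullet> B \<ge> 0"
    using * assms hyp_pos[of P] by (smt (verit) mult_nonneg_nonneg)
qed

text \<open>The quantity is the hyperbolic cosine of the distance between two points of the
  hyperboloid; the bound makes each interaction energy nonnegative.\<close>

lemma hyp_product_ge_1: "hyp P * hyp P' - P \<bullet> P' \<ge> 1"
proof -
  have "P \<bullet> P' \<le> norm P * norm P'" by (rule norm_cauchy_schwarz)
  moreover have "(1 + norm P * norm P')\<^sup>2 \<le> (hyp P * hyp P')\<^sup>2"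
    using sum_squares_bound[of "norm P" "norm P'"]
    by (simp add: power_mult_distrib hyp_norm(1) algebra_simps power2_sum)
  then have "1 + norm P * norm P' \<le> hyp P * hyp P'"
    by (rule power2_le_imp_le) (simp add: hyp_pos less_imp_le)
  ultimately show ?thesis by linarith
qed

text \<open>A form of \<open>cosh a \<le> 2 cosh (a - b) cosh b\<close> for hyperbolic distances.\<close>

lemma hyp_le_product: "hyp P \<le> 2 * (hyp P * hyp P' - P \<bullet> P') * hyp P'"
proof -
  let ?d = "hyp P' - norm P'"
  have d: "?d \<ge> 0" using hyp_norm(2)[of P'] by simp
  have "(hyp P' - norm P') * (hyp P' + norm P') = 1"
    by (simp add: algebra_simps hyp_norm(1) power2_eq_square[symmetric] add_nonneg_nonneg)
  moreover have "?d * (hyp P' + norm P') \<le> ?d * (2 * hyp P')"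
    using hyp_norm(2)[of P'] d by (intro mult_left_mono) auto
  ultimately have "1 \<le> ?d * (2 * hyp P')" by linarith
  then have "1 \<le> 2 * ?d * hyp P'" by (simp only: mult_ac)
  then have "hyp P * 1 \<le> hyp P * (2 * ?d * hyp P')" using hyp_pos[of P] by (intro mult_left_mono) auto
  also have "\<dots> = 2 * (hyp P * ?d) * hyp P'" by simp
  also have "\<dots> \<le> 2 * (hyp P * hyp P' - P \<bullet> P') * hyp P'"
    using cone_pairing(1)[of P' "hyp P'" P] hyp_norm(2)[of P'] hyp_pos[of P'] by (intro mult_right_mono mult_left_mono) auto
  finally show ?thesis by simp
qed

text \<open>A Grassmann derivative only moves coefficients and changes their signs, so it cannot
  increase a common bound on them.\<close>

lemma foldr_vderiv_coeff_le:
  assumes "\<And>T. \<bar>gcoeff a T\<bar> \<le> B"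
  shows "\<bar>gcoeff (foldr vderiv L a) S\<bar> \<le> B"
  using assms
proof (induction L arbitrary: S)
  case (Cons x L)
  have g: "\<bar>gcoeff (gderiv g c) S\<bar> \<le> B" if "\<And>T. \<bar>gcoeff c T\<bar> \<le> B" for g and c :: "'a gen grassmann" and S
    using that[of "insert g S"] order_trans[OF abs_ge_zero that] by (auto simp: gcoeff_gderiv abs_mult)
  show ?case using Cons by (simp add: vderiv_def g)
qed simp

lemma foldr_vderiv_measurable:
  assumes "\<And>T. (\<lambda>x. gcoeff (f x) T) \<in> borel_measurable M"
  shows "(\<lambda>x. gcoeff (foldr vderiv L (f x)) S) \<in> borel_measurable M"
  using assms
proof (induction L arbitrary: S)
  case (Cons x L)
  have g: "(\<lambda>x. gcoeff (gderiv g (c x)) S) \<in> borel_measurable M"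
    if "\<And>T. (\<lambda>x. gcoeff (c x) T) \<in> borel_measurable M" for g and c :: "_ \<Rightarrow> 'a gen grassmann" and S
    using that[of "insert g S"] by (cases "g \<in> S") (auto simp: gcoeff_gderiv intro!: borel_measurable_times)
  show ?case using Cons by (simp add: vderiv_def g)
qed simp

text \<open>\<open>inv_z\<close> inside the commutative normed algebra, where the product over
  vertices is order-free and can be estimated.\<close>

definition inv_z_ev :: "'v::linorder \<Rightarrow> real \<times> real \<Rightarrow> 'v gen ev" where
  "inv_z_ev j p = of_real (1 / hyp p) - of_real ((1 / hyp p) ^ 3) * Ev (gvar (Xi j) * gvar (Eta j))"

lemma gr_inv_z_ev: "gr (inv_z_ev j p) = inv_z j p"
proof -
  have "gr (Ev (gvar (Xi j) * gvar (Eta j))) = gvar (Xi j) * gvar (Eta j)"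
    by (rule gr_Ev[where G = "{Xi j, Eta j}"]) (auto intro!: godd_mult godd_gvar galg_mult galg_gvar)
  then show ?thesis
    unfolding inv_z_eq inv_z_ev_def by (simp only: gr_simps gr_of_real scaleR_conv_of_real)
qed

lemma bz_gr:
  assumes "finite \<Lambda>"
  shows "bz \<Lambda> (gr a) p = foldr vderiv (sorted_list_of_set \<Lambda>) (gr ((\<Prod>j\<in>\<Lambda>. inv_z_ev j (p j)) * a))"
proof -
  have "gr (\<Prod>j\<leftarrow>L. inv_z_ev j (p j)) = (\<Prod>j\<leftarrow>L. inv_z j (p j))" for L
    by (induction L) (simp_all add: gr_simps gr_inv_z_ev)
  moreover have "(\<Prod>j\<leftarrow>sorted_list_of_set \<Lambda>. inv_z_ev j (p j)) = (\<Prod>j\<in>\<Lambda>. inv_z_ev j (p j))"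
    using assms by (simp add: prod.distinct_set_conv_list[symmetric])
  ultimately show ?thesis by (simp add: bz_def gr_simps(4) flip: \<open>_ = (\<Prod>j\<in>\<Lambda>. inv_z_ev j (p j))\<close>)
qed

text \<open>The edges as a symmetric relation, for induction along paths.\<close>

definition weight_edges :: "'v set \<Rightarrow> ('v \<Rightarrow> 'v \<Rightarrow> real) \<Rightarrow> ('v \<times> 'v) set" where
  "weight_edges \<Lambda> W = {(u, v). u \<in> \<Lambda> \<and> v \<in> \<Lambda> \<and> (W u v > 0 \<or> W v u > 0)}"

section \<open>Control of all spins by the energy\<close>

locale spin_system =
  fixes \<Lambda> :: "'v::linorder set" and W :: "'v \<Rightarrow> 'v \<Rightarrow> real" and h :: "'v \<Rightarrow> real" and b :: "'v \<Rightarrow> 'v gen svec" and G :: "'v gen set"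
  assumes fin: "finite \<Lambda>" "finite G"
    and W_nonneg: "\<And>i k. i \<in> \<Lambda> \<Longrightarrow> k \<in> \<Lambda> \<Longrightarrow> W i k \<ge> 0"
    and b_cone: "\<And>i. i \<in> \<Lambda> \<Longrightarrow> b i \<in> H32_plus0 G"
begin

definition "GG = G \<union> vgens \<Lambda>"
definition "wt p = (\<Prod>k\<in>\<Lambda>. hyp (p k))" for p :: "'v \<Rightarrow> real \<times> real"
text \<open>Minus the body of the exponent up to the constant sum of \<open>h\<close> (see
  \<open>body_texp\<close>), arranged as a sum of nonnegative terms.\<close>

definition "energy p = (\<Sum>i\<in>\<Lambda>. \<Sum>k\<in>\<Lambda>. W i k * (hyp (p i) * hyp (p k) - p i \<bullet> p k - 1)) +
   (\<Sum>i\<in>\<Lambda>. hyp (p i) * tpart (b i) - p i \<bullet> bpart (b i))"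
definition "Z p = (\<Prod>j\<in>\<Lambda>. inv_z_ev j (p j))"

lemma finite_GG: "finite GG"
  using fin by (simp add: GG_def vgens_def)

lemma bH: "i \<in> \<Lambda> \<Longrightarrow> b i \<in> H32 G"
  using b_cone by (simp add: H32_plus0_iff)

lemma wt_ge_1: "wt p \<ge> 1"
  unfolding wt_def by (intro prod_ge_1 hyp_ge_1)

lemma hyp_le_wt:
  assumes "i \<in> \<Lambda>"
  shows "hyp (p i) \<le> wt p"
proof -
  have "wt p = hyp (p i) * (\<Prod>k\<in>\<Lambda> - {i}. hyp (p k))"
    unfolding wt_def using fin assms by (intro prod.remove) auto
  moreover have "(\<Prod>k\<in>\<Lambda> - {i}. hyp (p k)) \<ge> 1" by (intro prod_ge_1 hyp_ge_1)
  ultimately show ?thesis using hyp_pos[of "p i"] by (simp add: mult_le_cancel_left1)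
qed

lemma body_texp: "evbody (texp \<Lambda> W h b p) = (\<Sum>i\<in>\<Lambda>. h i) - energy p"
proof -
  have "evbody (texp \<Lambda> W h b p) = (\<Sum>i\<in>\<Lambda>. \<Sum>k\<in>\<Lambda>. W i k * (1 + (p i \<bullet> p k - hyp (p i) * hyp (p k)))) +
      (\<Sum>i\<in>\<Lambda>. h i + (p i \<bullet> bpart (b i) - hyp (p i) * tpart (b i)))"
    unfolding texp_def by (simp add: evbody_evs_spin evbody_evs_spin'[OF bH fin(2)] cong: sum.cong)
  also have "\<dots> = (\<Sum>i\<in>\<Lambda>. h i) - energy p"
    unfolding energy_def by (simp add: sum.distrib sum_subtractf sum_negf[symmetric] algebra_simps)
  finally show ?thesis .
qed

lemma energy_terms:
  assumes "i \<in> \<Lambda>"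
  shows "hyp (p i) * tpart (b i) - p i \<bullet> bpart (b i) \<le> energy p"
    and "k \<in> \<Lambda> \<Longrightarrow> W i k * (hyp (p i) * hyp (p k) - p i \<bullet> p k - 1) \<le> energy p"
    and "0 \<le> energy p"
proof -
  let ?w = "\<lambda>i k. W i k * (hyp (p i) * hyp (p k) - p i \<bullet> p k - 1)"
    and ?q = "\<lambda>i. hyp (p i) * tpart (b i) - p i \<bullet> bpart (b i)"
  have w: "?w i k \<ge> 0" if "i \<in> \<Lambda>" "k \<in> \<Lambda>" for i k
    using W_nonneg[OF that] hyp_product_ge_1[of "p i" "p k"] by (intro mult_nonneg_nonneg) auto
  have q: "?q i \<ge> 0" if "i \<in> \<Lambda>" for i
    using b_cone[OF that] by (intro cone_pairing(2)) (simp add: H32_plus0_iff)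
  have s: "(\<Sum>i\<in>\<Lambda>. \<Sum>k\<in>\<Lambda>. ?w i k) \<ge> 0" "(\<Sum>i\<in>\<Lambda>. ?q i) \<ge> 0"
    using w q by (auto intro!: sum_nonneg)
  show "0 \<le> energy p" using s by (simp add: energy_def)
  have "?q i \<le> (\<Sum>i\<in>\<Lambda>. ?q i)" using assms q fin by (intro member_le_sum) auto
  then show "?q i \<le> energy p" using s by (simp add: energy_def)
  assume k: "k \<in> \<Lambda>"
  have "?w i k \<le> (\<Sum>k\<in>\<Lambda>. ?w i k)" using assms k w fin by (intro member_le_sum) auto
  also have "\<dots> \<le> (\<Sum>i\<in>\<Lambda>. \<Sum>k\<in>\<Lambda>. ?w i k)"
    using assms w fin by (intro member_le_sum) (auto intro!: sum_nonneg)
  finally show "?w i k \<le> energy p" using s by (simp add: energy_def)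
qed

abbreviation "edges \<equiv> weight_edges \<Lambda> W"

text \<open>The energy bounds the hyperbolic cosine of the distance between neighbours, and
  \<open>hyp_le_product\<close> converts this into a comparison of their distances from the
  origin.\<close>

lemma edge_bound:
  assumes "(i, k) \<in> edges"
  shows "\<exists>C\<ge>0. \<forall>p. hyp (p i) \<le> C * (1 + energy p) * hyp (p k)"
proof -
  obtain u where u: "u > 0" "\<And>p. u * (hyp (p i) * hyp (p k) - p i \<bullet> p k - 1) \<le> energy p"
  proof (cases "W i k > 0")
    case True
    then show ?thesis using assms energy_terms(2) that[of "W i k"] by (auto simp: weight_edges_def)
  next
    case False
    then have "W k i > 0" "i \<in> \<Lambda>" "k \<in> \<Lambda>" using assms by (auto simp: weight_edges_def)
    then show ?thesis using energy_terms(2)[of k i] that[of "W k i"] by (auto simp: inner_commute mult.commute)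
  qed
  have "hyp (p i) \<le> (2 + 2 / u) * (1 + energy p) * hyp (p k)" for p
  proof -
    let ?C = "hyp (p i) * hyp (p k) - p i \<bullet> p k"
    have e: "energy p \<ge> 0" using assms energy_terms(3) by (auto simp: weight_edges_def)
    have "?C - 1 \<le> energy p / u" using u by (simp add: pos_le_divide_eq mult.commute)
    then have "?C \<le> 1 + energy p / u" by simp
    also have "\<dots> \<le> (1 + 1 / u) * (1 + energy p)" using u e by (simp add: algebra_simps)
    finally have "2 * ?C * hyp (p k) \<le> 2 * ((1 + 1 / u) * (1 + energy p)) * hyp (p k)"
      using hyp_pos[of "p k"] by (intro mult_right_mono mult_left_mono) auto
    moreover have "2 * ((1 + 1 / u) * (1 + energy p)) = (2 + 2 / u) * (1 + energy p)"
      by (simp add: algebra_simps)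
    ultimately show ?thesis
      using hyp_le_product[of "p i" "p k"] by (simp only:)
  qed
  moreover have "2 + 2 / u \<ge> 0" using u by simp
  ultimately show ?thesis by blast
qed

text \<open>A field in the open cone is coercive at its own vertex, and each edge of the path costs
  one more factor \<open>1 + energy p\<close>. This is why every component must contain such a
  vertex.\<close>

lemma path_bound:
  assumes "(i, k) \<in> edges\<^sup>*" "k \<in> \<Lambda>" "b k \<in> H32_plus G"
  shows "\<exists>C\<ge>0. \<exists>n. \<forall>p. hyp (p i) \<le> C * (1 + energy p) ^ n"
  using assms(1)
proof (induction rule: converse_rtrancl_induct)
  case base
  let ?e = "tpart (b k) - norm (bpart (b k))"
  have e: "?e > 0" using assms(3) by (simp add: H32_plus_iff)
  have "hyp (p k) \<le> (1 / ?e) * (1 + energy p) ^ 1" for p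
  proof -
    have "hyp (p k) * ?e \<le> energy p"
      using cone_pairing(1)[of "bpart (b k)" "tpart (b k)" "p k"] energy_terms(1)[OF assms(2), of p] e by linarith
    then have "hyp (p k) \<le> energy p / ?e" using e by (simp add: pos_le_divide_eq)
    also have "\<dots> \<le> (1 + energy p) / ?e" using e by (intro divide_right_mono) auto
    finally show ?thesis by simp
  qed
  moreover have "1 / ?e \<ge> 0" using e by simp
  ultimately show ?case by blast
next
  case (step i i')
  then obtain C n where C: "C \<ge> 0" "\<And>p. hyp (p i') \<le> C * (1 + energy p) ^ n" by blast
  obtain D where D: "D \<ge> 0" "\<And>p. hyp (p i) \<le> D * (1 + energy p) * hyp (p i')"
    using edge_bound[OF step(1)] by blast
  have "hyp (p i) \<le> (D * C) * (1 + energy p) ^ Suc n" for p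
  proof -
    have e: "energy p \<ge> 0" using assms(2) energy_terms(3) by blast
    have "hyp (p i) \<le> D * (1 + energy p) * hyp (p i')" by (rule D)
    also have "\<dots> \<le> D * (1 + energy p) * (C * (1 + energy p) ^ n)"
      using C D e by (intro mult_left_mono) auto
    finally show ?thesis by (simp add: mult_ac)
  qed
  then show ?case using C(1) D(1) by (meson mult_nonneg_nonneg)
qed

lemma wt_bound:
  assumes "\<And>i. i \<in> \<Lambda> \<Longrightarrow> \<exists>k\<in>\<Lambda>. (i, k) \<in> edges\<^sup>* \<and> b k \<in> H32_plus G"
  shows "\<exists>C\<ge>0. \<exists>n. \<forall>p. wt p \<le> C * (1 + energy p) ^ n"
proof -
  have "\<exists>C\<ge>0. \<exists>n. \<forall>p. (\<Prod>k\<in>L. hyp (p k)) \<le> C * (1 + energy p) ^ n" if "finite L" "L \<subseteq> \<Lambda>" for L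
    using that
  proof (induction L)
    case empty
    show ?case by (rule exI[of _ 1], simp, rule exI[of _ 0], simp)
  next
    case (insert i L)
    then obtain C n where C: "C \<ge> 0" "\<And>p. (\<Prod>k\<in>L. hyp (p k)) \<le> C * (1 + energy p) ^ n" by auto
    have i: "i \<in> \<Lambda>" using insert by simp
    then obtain D m where D: "D \<ge> 0" "\<And>p. hyp (p i) \<le> D * (1 + energy p) ^ m"
      using assms[OF i] path_bound by blast
    have "(\<Prod>k\<in>insert i L. hyp (p k)) \<le> (D * C) * (1 + energy p) ^ (m + n)" for p
    proof -
      have "hyp (p i) * (\<Prod>k\<in>L. hyp (p k)) \<le> (D * (1 + energy p) ^ m) * (C * (1 + energy p) ^ n)"
        using C D energy_terms(3)[OF i, of p]
        by (intro mult_mono prod_nonneg) (auto simp: hyp_pos less_imp_le simp del: split_paired_All)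
      then show ?thesis using insert by (simp add: power_add mult_ac)
    qed
    then show ?case using C(1) D(1) by (meson mult_nonneg_nonneg)
  qed
  from this[OF fin(1) order_refl] show ?thesis by (simp add: wt_def)
qed

interpretation g: growth GG UNIV wt
  by unfold_locales (auto simp: finite_GG wt_ge_1)

lemma pb_coords:
  assumes "i \<in> \<Lambda>"
  shows "g.pb (\<lambda>p. of_real (fst (p i)))" "g.pb (\<lambda>p. of_real (snd (p i)))" "g.pb (\<lambda>p. of_real (hyp (p i)))"
    "g.pb (\<lambda>p. of_real (1 / hyp (p i)))"
proof -
  have *: "\<bar>r\<bar> \<le> 1 * wt p ^ 1" if "\<bar>r\<bar> \<le> hyp (p i)" for r and p :: "'v \<Rightarrow> real \<times> real"
    using order_trans[OF that hyp_le_wt[OF assms, of p]] by simp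
  have "1 / hyp (p i) \<le> hyp (p i)" for p :: "'v \<Rightarrow> real \<times> real"
    using hyp_ge_1[of "p i"] by (simp add: divide_le_eq) (metis mult_mono' mult_1 zero_le_one)
  then show "g.pb (\<lambda>p. of_real (1 / hyp (p i)))"
    using hyp_pos by (intro g.pb_of_real[where C = 1 and K = 1] *) (auto simp: less_imp_le)
  show "g.pb (\<lambda>p. of_real (fst (p i)))" "g.pb (\<lambda>p. of_real (snd (p i)))" "g.pb (\<lambda>p. of_real (hyp (p i)))"
    by (rule g.pb_of_real[where C = 1 and K = 1], simp, rule *, simp add: abs_le_hyp hyp_pos less_imp_le)+
qed

lemma evm_coords:
  assumes "i \<in> \<Lambda>"
  shows "evm (plane_prod \<Lambda>) (\<lambda>p. of_real (fst (p i)))" "evm (plane_prod \<Lambda>) (\<lambda>p. of_real (snd (p i)))"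
    "evm (plane_prod \<Lambda>) (\<lambda>p. of_real (hyp (p i)))" "evm (plane_prod \<Lambda>) (\<lambda>p. of_real (1 / hyp (p i)))"
proof -
  have c: "(\<lambda>p. f (p i)) \<in> borel_measurable (plane_prod \<Lambda>)" if "f \<in> borel_measurable borel" for f :: "real \<times> real \<Rightarrow> real"
    using that by (intro measurable_compose[OF measurable_component_singleton[OF assms]]) simp
  have m: "fst \<in> borel_measurable borel" "snd \<in> borel_measurable borel" "(\<lambda>p. 1 / hyp p) \<in> borel_measurable borel"
    by (auto intro!: borel_measurable_continuous_onI continuous_intros borel_measurable_divide borel_measurable_hyp)
  show "evm (plane_prod \<Lambda>) (\<lambda>p. of_real (fst (p i)))" "evm (plane_prod \<Lambda>) (\<lambda>p. of_real (snd (p i)))"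
    "evm (plane_prod \<Lambda>) (\<lambda>p. of_real (hyp (p i)))" "evm (plane_prod \<Lambda>) (\<lambda>p. of_real (1 / hyp (p i)))"
    by (intro evm_of_real c m borel_measurable_hyp)+
qed

lemma Ev_godd_evG: "a \<in> godd \<Longrightarrow> c \<in> godd \<Longrightarrow> a \<in> galg GG \<Longrightarrow> c \<in> galg GG \<Longrightarrow> Ev (a * c) \<in> evG GG"
  by (simp add: evG_def gr_Ev[OF godd_mult galg_mult finite_GG] galg_mult)

lemma gvar_GG: "i \<in> \<Lambda> \<Longrightarrow> gvar (Xi i) \<in> galg GG" "i \<in> \<Lambda> \<Longrightarrow> gvar (Eta i) \<in> galg GG"
  by (auto intro!: galg_gvar simp: GG_def vgens_def)

lemma pb_evs_field:
  assumes "i \<in> \<Lambda>"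
  shows "g.pb (\<lambda>p. evs (spin i (p i)) (b i)) \<and> evm (plane_prod \<Lambda>) (\<lambda>p. evs (spin i (p i)) (b i))"
proof -
  have "b i \<in> H32 GG" by (rule H32_mono[OF bH[OF assms]]) (auto simp: GG_def)
  then obtain b1 b2 b3 \<gamma>1 \<gamma>2 where b: "b i = (gr b1, gr b2, gr b3, \<gamma>1, \<gamma>2)" "b1 \<in> evG GG" "b2 \<in> evG GG" "b3 \<in> evG GG"
    "\<gamma>1 \<in> galg GG" "\<gamma>1 \<in> godd" "\<gamma>2 \<in> galg GG" "\<gamma>2 \<in> godd"
    by (rule H32_components[OF _ finite_GG])
  note c = gvar_GG[OF assms]
  show ?thesis
    unfolding b(1) evs_spin_expand[OF b(6,8,5,7) finite_GG b(2-4)]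
    by (intro conjI g.pb_intros pb_coords evm_add evm_diff evm_mult evm_const evm_coords Ev_godd_evG godd_gvar assms b c)
qed

lemma pb_evs_pair:
  assumes "i \<in> \<Lambda>" "k \<in> \<Lambda>"
  shows "g.pb (\<lambda>p. evs (spin i (p i)) (spin k (p k))) \<and> evm (plane_prod \<Lambda>) (\<lambda>p. evs (spin i (p i)) (spin k (p k)))"
proof -
  note ci = gvar_GG[OF assms(1)] and ck = gvar_GG[OF assms(2)]
  have e: "Ev (gvar (Xi k) * gvar (Eta k)) \<in> evG GG" by (intro Ev_godd_evG godd_gvar ck)
  have "evs (spin i P) (spin k P') = of_real (fst P) * of_real (fst P') + of_real (snd P) * of_real (snd P') -
    (of_real (hyp P) + of_real (1 / hyp P) * Ev (gvar (Xi i) * gvar (Eta i))) * (of_real (hyp P') + of_real (1 / hyp P') * Ev (gvar (Xi k) * gvar (Eta k))) +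
    Ev (gvar (Xi i) * gvar (Eta k)) - Ev (gvar (Eta i) * gvar (Xi k))" for P P'
    unfolding spin_components[of k] by (rule evs_spin_expand[OF godd_gvar godd_gvar ck finite_GG]; intro evG_simps e)
  then show ?thesis
    by (simp only:) (intro conjI g.pb_intros pb_coords evm_add evm_diff evm_mult evm_const evm_coords Ev_godd_evG godd_gvar assms ci ck)
qed

lemma pb_texp: "g.pb (texp \<Lambda> W h b)" "evm (plane_prod \<Lambda>) (texp \<Lambda> W h b)"
  unfolding texp_def[abs_def]
  by (intro g.pb_intros evm_add evm_sum evm_scaleR evm_const borel_measurable_const evG_simps
      pb_evs_pair[THEN conjunct1] pb_evs_pair[THEN conjunct2] pb_evs_field[THEN conjunct1] pb_evs_field[THEN conjunct2]; assumption)+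

lemma pb_Z: "g.pb Z" "evm (plane_prod \<Lambda>) Z"
proof -
  have e: "Ev (gvar (Xi i) * gvar (Eta i)) \<in> evG GG" if "i \<in> \<Lambda>" for i
    using gvar_GG[OF that] by (intro Ev_godd_evG godd_gvar)
  show "g.pb Z" unfolding Z_def[abs_def] inv_z_ev_def of_real_power
    by (intro g.pb_prod g.pb_intros pb_coords e; assumption)
  show "evm (plane_prod \<Lambda>) Z" unfolding Z_def[abs_def] inv_z_ev_def of_real_power
    by (intro evm_prod evm_diff evm_mult evm_power evm_const evm_coords; assumption)
qed

text \<open>The prefactor of \<open>exp (- energy)\<close> is polynomial in \<open>wt\<close>, and
  \<open>wt\<close> is polynomial in the energy. So the exponential absorbs the prefactor and still
  leaves \<open>1 / wt ^ 4\<close>, the product of the one-vertex majorants.\<close>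

theorem sintegrable_texp:
  assumes "\<And>i. i \<in> \<Lambda> \<Longrightarrow> \<exists>k\<in>\<Lambda>. (i, k) \<in> edges\<^sup>* \<and> b k \<in> H32_plus G"
  shows "sintegrable \<Lambda> (\<lambda>p. gr (evexp (texp \<Lambda> W h b p)))"
  unfolding sintegrable_def gintegrable_def
proof
  fix S
  let ?T = "texp \<Lambda> W h b"
  obtain D n where D: "D \<ge> 0" "\<And>p. wt p \<le> D * (1 + energy p) ^ n"
    using wt_bound[OF assms] by blast
  have "g.pb (\<lambda>p. Z p * (exp (- evbody (?T p)) *\<^sub>R evexp (?T p)))"
    by (intro g.pb_mult pb_Z g.pb_evexp pb_texp)
  then obtain C K where C: "C \<ge> 0" "\<And>p. norm (Z p * (exp (- evbody (?T p)) *\<^sub>R evexp (?T p))) \<le> C * wt p ^ K"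
    using g.pb_bound by blast
  define H where "H = (\<Sum>i\<in>\<Lambda>. h i)"
  \<comment> \<open>\<open>K\<close> powers of \<open>wt\<close> come from the prefactor and four
    from the majorant, each costing \<open>n\<close> powers of the energy.\<close>
  define N where "N = n * (K + 4)"
  \<comment> \<open>The factor \<open>exp 1\<close> compensates for taking
    \<open>s = 1 + energy p\<close>; with decay order 0 the lemma below gives a plain bound.\<close>
  have "C * exp H * D ^ (K + 4) * exp 1 \<ge> 0" using C D by simp
  from power_exp_decay[of 1, OF _ this, of N 0]
  obtain B where B: "B \<ge> 0" "\<And>s. s \<ge> 1 \<Longrightarrow> C * exp H * D ^ (K + 4) * exp 1 * s ^ N * exp (- s) \<le> B" by auto
  have energy0: "energy p \<ge> 0" for p
  proof (cases "\<Lambda> = {}")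
    case False
    then show ?thesis using energy_terms(3) by blast
  next
    case True
    then show ?thesis unfolding energy_def by simp
  qed
  have bound: "norm (Z p * evexp (?T p)) \<le> B * (\<Prod>i\<in>\<Lambda>. 1 / hyp (p i) ^ 4)" for p
  proof -
    have wt0: "wt p > 0" using wt_ge_1[of p] by simp
    have "norm (Z p * evexp (?T p)) = exp (evbody (?T p)) * norm (Z p * (exp (- evbody (?T p)) *\<^sub>R evexp (?T p)))"
      by (simp add: exp_minus)
    also have "\<dots> \<le> exp (evbody (?T p)) * (C * wt p ^ K)"
      using C(2) by (intro mult_left_mono) auto
    finally have "norm (Z p * evexp (?T p)) * wt p ^ 4 \<le> exp (evbody (?T p)) * (C * wt p ^ K) * wt p ^ 4"
      using wt0 by (intro mult_right_mono) auto
    also have "\<dots> = C * exp H * exp 1 * (wt p ^ (K + 4) * exp (- (1 + energy p)))"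
      by (simp add: body_texp H_def exp_diff exp_minus exp_add power_add field_simps)
    also have "\<dots> \<le> C * exp H * exp 1 * ((D * (1 + energy p) ^ n) ^ (K + 4) * exp (- (1 + energy p)))"
      using C(1) D(2)[of p] wt0 by (intro mult_left_mono mult_right_mono power_mono) auto
    also have "\<dots> = C * exp H * D ^ (K + 4) * exp 1 * (1 + energy p) ^ N * exp (- (1 + energy p))"
      by (simp add: N_def power_mult_distrib power_mult mult_ac)
    also have "\<dots> \<le> B" using energy0[of p] by (intro B(2)) simp
    finally have "norm (Z p * evexp (?T p)) \<le> B / wt p ^ 4" using wt0 by (simp add: pos_le_divide_eq)
    also have "\<dots> = B * (\<Prod>i\<in>\<Lambda>. 1 / hyp (p i) ^ 4)"
      by (simp add: wt_def prod_dividef prod_power_distrib)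
    finally show ?thesis .
  qed
  show "integrable (plane_prod \<Lambda>) (\<lambda>p. gcoeff (bz \<Lambda> (gr (evexp (?T p))) p) S)"
  proof (rule Bochner_Integration.integrable_bound)
    show "integrable (plane_prod \<Lambda>) (\<lambda>p. B * (\<Prod>i\<in>\<Lambda>. 1 / hyp (p i) ^ 4))"
      by (intro integrable_mult_right plane.product_integrable_prod fin integrable_hyp_power)
    have "evm (plane_prod \<Lambda>) (\<lambda>p. Z p * evexp (?T p))"
      by (intro evm_mult pb_Z evm_evexp[OF pb_texp(2) _ finite_GG]) (auto intro: g.pb_evG[OF pb_texp(1)])
    then show "(\<lambda>p. gcoeff (bz \<Lambda> (gr (evexp (?T p))) p) S) \<in> borel_measurable (plane_prod \<Lambda>)"
      unfolding bz_gr[OF fin(1)] Z_def[symmetric] by (intro foldr_vderiv_measurable) (simp add: evm_def evcoeff_def)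
    show "AE p in plane_prod \<Lambda>. norm (gcoeff (bz \<Lambda> (gr (evexp (?T p))) p) S) \<le> norm (B * (\<Prod>i\<in>\<Lambda>. 1 / hyp (p i) ^ 4))"
    proof (rule AE_I2)
      fix p
      have "\<bar>gcoeff (bz \<Lambda> (gr (evexp (?T p))) p) S\<bar> \<le> norm (Z p * evexp (?T p))"
        unfolding bz_gr[OF fin(1)] Z_def[symmetric]
        by (rule foldr_vderiv_coeff_le) (simp add: evcoeff_def[symmetric] evcoeff_le_norm)
      then show "norm (gcoeff (bz \<Lambda> (gr (evexp (?T p))) p) S) \<le> norm (B * (\<Prod>i\<in>\<Lambda>. 1 / hyp (p i) ^ 4))"
        using bound[of p] by simp
    qed
  qed
qed

end

section \<open>The spin model in terms of even elements\<close>

text \<open>The two exponentials combine, and the linear part of the pinning term joins the source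
  in the field \<open>h j *\<^sub>R sorigin + a j\<close>.\<close>

lemma model_integrand:
  assumes \<Lambda>: "finite \<Lambda>" and G: "finite G" and a: "\<And>i. i \<in> \<Lambda> \<Longrightarrow> a i \<in> H32 G"
  shows "gext exp (action \<Lambda> W h (\<lambda>j. spin j (p j))) * gext exp (\<Sum>j\<in>\<Lambda>. sinner (a j) (spin j (p j))) =
    gr (evexp (texp \<Lambda> W h (\<lambda>j. h j *\<^sub>R sorigin + a j) p))"
proof -
  let ?s = "\<lambda>i. spin i (p i)"
  define X where "X = (\<Sum>i\<in>\<Lambda>. \<Sum>k\<in>\<Lambda>. W i k *\<^sub>R (1 + evs (?s i) (?s k))) + (\<Sum>i\<in>\<Lambda>. h i *\<^sub>R (1 + evs (?s i) sorigin))"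
  define Y where "Y = (\<Sum>i\<in>\<Lambda>. evs (?s i) (a i))"
  have o: "gr (evs (?s i) sorigin) = sinner (?s i) sorigin" for i
    by (rule gr_evs_spin'[OF sorigin_H32[of "{}"]]) simp
  have X: "action \<Lambda> W h ?s = gr X"
    by (simp add: action_def X_def gr_simps gr_sum gr_evs_spin o)
  have "sinner (a i) (?s i) = gr (evs (?s i) (a i))" if "i \<in> \<Lambda>" for i
    using gr_evs_spin'[OF a[OF that] G] sinner_commute[OF a[OF that] spin_H32] by simp
  then have Y: "(\<Sum>j\<in>\<Lambda>. sinner (a j) (?s j)) = gr Y"
    by (simp add: Y_def gr_sum)
  have "evs (?s i) (h i *\<^sub>R sorigin + a i) = h i *\<^sub>R evs (?s i) sorigin + evs (?s i) (a i)" if "i \<in> \<Lambda>" for i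
  proof -
    have "gr (evs (?s i) (h i *\<^sub>R sorigin + a i)) = sinner (?s i) (h i *\<^sub>R sorigin + a i)"
      by (rule gr_evs_spin'[OF H32_add[OF H32_scaleR[OF sorigin_H32] a[OF that]] G])
    also have "\<dots> = gr (h i *\<^sub>R evs (?s i) sorigin + evs (?s i) (a i))"
      by (simp add: sinner_linear gr_simps o gr_evs_spin'[OF a[OF that] G])
    finally show ?thesis by (simp only: gr_eq_iff)
  qed
  then have "(\<Sum>i\<in>\<Lambda>. of_real (h i) + evs (?s i) (h i *\<^sub>R sorigin + a i)) =
      (\<Sum>i\<in>\<Lambda>. h i *\<^sub>R (1 + evs (?s i) sorigin) + evs (?s i) (a i))"
    by (intro sum.cong) (simp_all add: scaleR_add_right of_real_def)
  then have "texp \<Lambda> W h (\<lambda>j. h j *\<^sub>R sorigin + a j) p = X + Y"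
    unfolding texp_def X_def Y_def sum.distrib[of "\<lambda>i. h i *\<^sub>R (1 + evs (?s i) sorigin)"] by (simp only: add.assoc)
  then show ?thesis
    unfolding X Y by (simp add: evexp_add gr_simps gr_evexp)
qed

lemma model_expectation:
  assumes "finite \<Lambda>" "finite G" "\<And>i. i \<in> \<Lambda> \<Longrightarrow> a i \<in> H32 G"
  shows "has_expectation \<Lambda> W h (\<lambda>v. gext exp (\<Sum>j\<in>\<Lambda>. sinner (a j) (v j))) \<longleftrightarrow>
      sintegrable \<Lambda> (\<lambda>p. gr (evexp (texp \<Lambda> W h (\<lambda>j. h j *\<^sub>R sorigin + a j) p)))"
    and "expectation \<Lambda> W h (\<lambda>v. gext exp (\<Sum>j\<in>\<Lambda>. sinner (a j) (v j))) =
      sint \<Lambda> (\<lambda>p. gr (evexp (texp \<Lambda> W h (\<lambda>j. h j *\<^sub>R sorigin + a j) p)))"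
  unfolding has_expectation_def expectation_def super_integrable_sintegrable super_integral_sint
  by (simp_all only: model_integrand[OF assms])

lemma expectation_cong:
  assumes "\<And>i. i \<in> \<Lambda> \<Longrightarrow> h i = h' i"
  shows "has_expectation \<Lambda> W h f = has_expectation \<Lambda> W h' f" "expectation \<Lambda> W h f = expectation \<Lambda> W h' f"
proof -
  have "action \<Lambda> W h = action \<Lambda> W h'"
    using assms by (auto simp: action_def fun_eq_iff intro!: sum.cong)
  then show "has_expectation \<Lambda> W h f = has_expectation \<Lambda> W h' f" "expectation \<Lambda> W h f = expectation \<Lambda> W h' f"
    by (simp_all add: has_expectation_def expectation_def)
qed

section \<open>The binary tree\<close>

lemma cut_power: "(cut ^^ l) j = drop l j"
  by (induction l arbitrary: j) (simp_all add: drop_Suc tl_drop)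

text \<open>\<open>cut\<close> removes the first letter, so ancestors are suffixes and the children
  of \<open>j\<close> are the words \<open>b # j\<close>.\<close>

lemma ancestor_iff: "i \<preceq> j \<longleftrightarrow> (\<exists>zs. j = zs @ i)"
  unfolding ancestor_eq_def cut_power
  by (metis append_eq_conv_conj append_take_drop_id)

lemma ancestor_drop: "i \<preceq> j \<longleftrightarrow> (\<exists>l. i = drop l j)"
  by (simp add: ancestor_eq_def cut_power)

lemma ancestor_child: "i \<preceq> j \<Longrightarrow> length i < length j \<Longrightarrow> \<exists>b. (b # i) \<preceq> j"
proof -
  assume "i \<preceq> j" "length i < length j"
  from this(1) obtain zs where zs1: "j = zs @ i" unfolding ancestor_iff by blast
  then have zs: "j = zs @ i" "zs \<noteq> []" using \<open>length i < length j\<close> by auto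
  obtain ys b where "zs = ys @ [b]" using zs(2) by (cases zs rule: rev_cases) auto
  then have "j = ys @ (b # i)" using zs(1) by simp
  then have "(b # i) \<preceq> j" unfolding ancestor_iff by (rule exI)
  then show ?thesis by (rule exI)
qed

lemma ancestor_of_child: "(b # i) \<preceq> j \<Longrightarrow> i \<preceq> j"
  unfolding ancestor_iff by (metis append.assoc append_Cons append_Nil)

lemma child_descendant: "k \<preceq> (b # i) \<Longrightarrow> k = b # i \<or> k \<preceq> i"
  unfolding ancestor_drop by (metis drop_Cons' drop_0)

lemma lca_eq: "lca i j = drop (LEAST m. drop m i \<preceq> j) i"
  by (simp add: lca_def cut_power ancestor_drop)

text \<open>\<open>b # j\<close> itself is no ancestor of \<open>k\<close>, so the search for the
  first common ancestor moves on to its parent \<open>j\<close>.\<close>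

lemma lca_child_left:
  assumes "\<not> j \<preceq> k"
  shows "lca (b # j) k = lca j k"
proof -
  have "\<not> drop 0 (b # j) \<preceq> k" using assms ancestor_of_child by auto
  moreover have "drop (length (b # j)) (b # j) \<preceq> k" by (auto simp: ancestor_iff)
  ultimately have "(LEAST m. drop m (b # j) \<preceq> k) = Suc (LEAST m. drop (Suc m) (b # j) \<preceq> k)"
    by (intro Least_Suc)
  then show ?thesis by (simp add: lca_eq)
qed

lemma lca_child_right:
  assumes "\<not> j \<preceq> k"
  shows "lca k (b # j) = lca k j"
proof -
  have "drop m k \<preceq> (b # j) \<longleftrightarrow> drop m k \<preceq> j" for m
  proof
    assume "drop m k \<preceq> (b # j)"
    moreover have "drop m k \<noteq> b # j"
      using assms ancestor_of_child ancestor_drop by metis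
    ultimately show "drop m k \<preceq> j" using child_descendant by blast
  next
    assume "drop m k \<preceq> j"
    then show "drop m k \<preceq> (b # j)" by (metis ancestor_iff append_Cons)
  qed
  then show ?thesis by (simp add: lca_eq)
qed

text \<open>The least common ancestor stays the same while one level drops by one, halving the
  prefactor. This is the property of the weights on which merging siblings rests.\<close>

lemma tree_weight_child:
  assumes "\<not> j \<preceq> k" "length j < N"
  shows "tree_weight N w (b # j) k = tree_weight N w j k / 2" "tree_weight N w k (b # j) = tree_weight N w k j / 2"
proof -
  have "level N j = Suc (level N (b # j))" using assms(2) by (simp add: level_def)
  then show "tree_weight N w (b # j) k = tree_weight N w j k / 2" "tree_weight N w k (b # j) = tree_weight N w k j / 2"
    by (simp_all add: tree_weight_def lca_child_left[OF assms(1)] lca_child_right[OF assms(1)])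
qed

lemma finite_leaves: "finite (leaves N)"
  using finite_lists_length_eq[of "UNIV :: bool set" N] by (simp add: leaves_def)

lemma finite_tree: "finite (tree N)"
  by (simp add: tree_def finite_leaves)

section \<open>Blocks of leaves\<close>

lemma blk_eq: "length j \<le> N \<Longrightarrow> blk N j = (\<lambda>zs. zs @ j) ` {zs. length zs = N - length j}"
  by (auto simp: blk_def leaves_def ancestor_iff image_iff)

lemma finite_blk: "finite (blk N j)"
  unfolding blk_def using finite_leaves by simp

lemma card_blk:
  assumes "length j \<le> N"
  shows "card (blk N j) = 2 ^ level N j"
proof -
  have "card (blk N j) = card {zs :: bool list. length zs = N - length j}"
    unfolding blk_eq[OF assms] by (rule card_image) (simp add: inj_on_def)
  also have "\<dots> = 2 ^ level N j"
    using card_lists_length_eq[of "UNIV :: bool set" "N - length j"] by (simp add: level_def)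
  finally show ?thesis .
qed

lemma blk_child:
  assumes "length j < N"
  shows "blk N j = blk N (False # j) \<union> blk N (True # j)" "blk N (False # j) \<inter> blk N (True # j) = {}"
proof -
  have "(False # j) \<preceq> i \<or> (True # j) \<preceq> i" if i: "j \<preceq> i" "length i = N" for i
  proof -
    obtain b where "(b # j) \<preceq> i" using ancestor_child[OF i(1)] i(2) assms by auto
    then show ?thesis by (cases b) auto
  qed
  then show "blk N j = blk N (False # j) \<union> blk N (True # j)"
    by (auto simp: blk_def leaves_def dest: ancestor_of_child)
  show "blk N (False # j) \<inter> blk N (True # j) = {}"
    by (auto simp: blk_def ancestor_iff)
qed

lemma block_spin_child:
  assumes "length j < N"
  shows "block_spin N v j = (1/2) *\<^sub>R (block_spin N v (False # j) + block_spin N v (True # j))"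
proof -
  have "level N j = Suc (level N (b # j))" for b using assms by (simp add: level_def)
  then show ?thesis
    unfolding block_spin_def blk_child(1)[OF assms]
    by (subst sum.union_disjoint[OF finite_blk finite_blk blk_child(2)[OF assms]])
      (simp add: scaleR_add_right level_def)
qed

text \<open>Constancy of \<open>h\<close> makes the block sum proportional to the number of leaves,
  and a child has half of them.\<close>

lemma block_pinning_child:
  assumes "length j < N" "h constant_on blk N j"
  shows "block_pinning N h (b # j) = block_pinning N h j / 2"
proof -
  obtain c where c: "\<And>i. i \<in> blk N j \<Longrightarrow> h i = c" using assms(2) by (auto simp: constant_on_def)
  have "blk N (b # j) \<subseteq> blk N j" using blk_child(1)[OF assms(1)] by (cases b) auto
  then have "block_pinning N h (b # j) = real (card (blk N (b # j))) * c" "block_pinning N h j = real (card (blk N j)) * c"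
    using c by (auto simp: block_pinning_def subset_iff)
  moreover have "level N j = Suc (level N (b # j))" using assms(1) by (simp add: level_def)
  ultimately show ?thesis using assms(1) by (simp add: card_blk)
qed

lemma blk_leaf: "length j = N \<Longrightarrow> blk N j = {j}"
  by (simp add: blk_eq)

text \<open>A leaf without ancestor in \<open>A\<close> could be added to \<open>A\<close>, since
  the only descendant of a leaf in the tree is the leaf itself.\<close>

lemma maximal_antichain_covers:
  assumes "maximal_antichain N A" "i \<in> leaves N"
  shows "\<exists>j\<in>A. j \<preceq> i"
proof (rule ccontr)
  assume *: "\<not> (\<exists>j\<in>A. j \<preceq> i)"
  have A: "antichain N A" using assms by (simp add: maximal_antichain_def)
  have i: "i \<notin> A" using * by (auto simp: ancestor_iff)
  have "\<not> i \<preceq> j" if "j \<in> A" for j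
  proof
    assume "i \<preceq> j"
    then obtain zs where "j = zs @ i" by (auto simp: ancestor_iff)
    moreover have "length j \<le> N" using A that by (auto simp: antichain_def tree_def leaves_def)
    ultimately have "j = i" using assms(2) by (auto simp: leaves_def)
    with i that show False by simp
  qed
  then have "antichain N (insert i A)"
    using A * assms(2) by (auto simp: antichain_def tree_def)
  with i show False using assms(1) unfolding maximal_antichain_def by blast
qed

section \<open>Block spins\<close>

abbreviation "pinned N h a j \<equiv> block_pinning N h j *\<^sub>R sorigin + a j"

text \<open>The hypotheses on \<open>A\<close> and \<open>a\<close>, in a form inherited by refinements of \<open>A\<close>.\<close>

definition coarse_graining :: "nat \<Rightarrow> (nat \<Rightarrow> real) \<Rightarrow> (word \<Rightarrow> real) \<Rightarrow> word gen set \<Rightarrow> word set \<Rightarrow> (word \<Rightarrow> word gen svec) \<Rightarrow> bool" where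
  "coarse_graining N w h G A a \<longleftrightarrow> antichain N A \<and> (\<forall>i\<in>leaves N. \<exists>j\<in>A. j \<preceq> i) \<and> compatible N h A \<and>
     (\<forall>j\<in>A. a j \<in> H32 G \<and> pinned N h a j \<in> H32_plus0 G) \<and>
     (\<forall>j\<in>A. \<exists>k\<in>A. (j, k) \<in> (weight_edges A (tree_weight N w))\<^sup>* \<and> pinned N h a k \<in> H32_plus G)"

text \<open>If every edge out of \<open>j\<close> were a loop, no path could leave
  \<open>j\<close>.\<close>

lemma exists_proper_edge:
  assumes "(j, k) \<in> E\<^sup>*" "j \<noteq> k"
  shows "\<exists>u. u \<noteq> j \<and> (j, u) \<in> E"
proof (rule ccontr)
  assume *: "\<not> ?thesis"
  have "k = j" using assms(1) by (induction rule: rtrancl_induct) (use * in auto)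
  with assms(2) show False by simp
qed

context
  fixes N :: nat and w :: "nat \<Rightarrow> real" and h :: "word \<Rightarrow> real" and G :: "word gen set"
  assumes w_nonneg: "\<And>k. w k \<ge> 0" and finite_G: "finite G" and G_vgens: "G \<inter> vgens UNIV = {}"
begin

abbreviation "TW \<equiv> tree_weight N w"
abbreviation "TH \<equiv> block_pinning N h"

lemma tree_weight_nonneg: "TW i k \<ge> 0"
  using w_nonneg by (simp add: tree_weight_def)

lemma coarse_graining_spin_system:
  assumes "coarse_graining N w h G A a"
  shows "spin_system A TW (pinned N h a) G"
proof
  show "finite A" using assms finite_tree finite_subset by (auto simp: coarse_graining_def antichain_def)
qed (use assms finite_G tree_weight_nonneg in \<open>auto simp: coarse_graining_def\<close>)

lemma coarse_graining_sintegrable: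
  assumes "coarse_graining N w h G A a"
  shows "sintegrable A (\<lambda>p. gr (evexp (texp A TW TH (pinned N h a) p)))"
proof -
  interpret spin_system A TW TH "pinned N h a" G by (rule coarse_graining_spin_system[OF assms])
  show ?thesis using assms by (intro sintegrable_texp) (auto simp: coarse_graining_def)
qed

text \<open>If the own field of \<open>j\<close> lies only in the closed cone, the path to a vertex
  with open field starts with a proper neighbour. Its spin, with positive weight, lies in the open
  cone, and adding vectors of the closed cone does not leave the open one.\<close>

lemma coarse_graining_field:
  assumes A: "coarse_graining N w h G A a" and j: "j \<in> A"
  shows "field j (A - {j}) TW (pinned N h a) x \<in> H32_plus (G \<union> vgens (A - {j}))"
proof -
  let ?R = "A - {j}" and ?b = "pinned N h a"
  let ?G = "G \<union> vgens ?R"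
  interpret spin_system A TW TH ?b G by (rule coarse_graining_spin_system[OF A])
  have bj: "?b j \<in> H32_plus0 ?G"
    by (rule H32_plus_mono(2)[of _ G]) (use A j in \<open>auto simp: coarse_graining_def\<close>)
  have s: "spin k (x k) \<in> H32_plus ?G" if "k \<in> ?R" for k
    by (rule H32_plus_mono(1)[OF spin_H32_plus]) (use that in \<open>auto simp: vgens_def\<close>)
  have t: "(TW j k + TW k j) *\<^sub>R spin k (x k) \<in> H32_plus0 ?G" if "k \<in> ?R" for k
    using tree_weight_nonneg s[OF that] by (intro H32_plus0_scaleR H32_plus_plus0) auto
  show ?thesis
  proof (cases "?b j \<in> H32_plus G")
    case True
    then have bp: "?b j \<in> H32_plus ?G" by (rule H32_plus_mono(1)) auto
    show ?thesis unfolding field_def by (rule H32_plus_add[OF H32_plus0_sum[OF t] bp])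
  next
    case False
    obtain k where k: "k \<in> A" "(j, k) \<in> edges\<^sup>*" "?b k \<in> H32_plus G"
      using A j by (auto simp: coarse_graining_def)
    then have "j \<noteq> k" using False by auto
    then obtain u where u: "u \<noteq> j" "(j, u) \<in> edges" using exists_proper_edge[OF k(2)] by blast
    then have uR: "u \<in> ?R" and pos: "TW j u + TW u j > 0"
      using tree_weight_nonneg[of j u] tree_weight_nonneg[of u j] by (auto simp: weight_edges_def)
    let ?t = "\<lambda>k. (TW j k + TW k j) *\<^sub>R spin k (x k)"
    have "field j ?R TW ?b x = (sum ?t (?R - {u}) + ?b j) + ?t u"
      unfolding field_def using uR fin by (subst sum.remove[of _ u]) (auto simp: ac_simps)
    moreover have "?t u \<in> H32_plus ?G" using s[OF uR] pos by (intro H32_plus_scaleR)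
    moreover have "sum ?t (?R - {u}) \<in> H32_plus0 ?G" by (rule H32_plus0_sum, rule t) simp
    then have "sum ?t (?R - {u}) + ?b j \<in> H32_plus0 ?G" by (rule H32_plus0_add[OF _ bj])
    ultimately show ?thesis by (simp add: H32_plus_add)
  qed
qed

text \<open>Weights to other vertices and the field at \<open>j\<close> are only halved, so signs
  and cones persist. The path condition survives because old paths lift edge by edge to the refined
  graph.\<close>

lemma coarse_graining_split:
  assumes A: "coarse_graining N w h G A a" and j: "j \<in> A" "length j < N"
  defines "A' \<equiv> insert (False # j) (insert (True # j) (A - {j}))"
  defines "a' \<equiv> a(False # j := (1/2) *\<^sub>R a j, True # j := (1/2) *\<^sub>R a j)"
  shows "coarse_graining N w h G A' a'" "False # j \<notin> A" "True # j \<notin> A"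
    "\<And>b. pinned N h a' (b # j) = (1/2) *\<^sub>R pinned N h a j"
    "\<And>k. k \<in> A - {j} \<Longrightarrow> pinned N h a' k = pinned N h a k"
    "\<And>b k. k \<in> A - {j} \<Longrightarrow> TW (b # j) k = TW j k / 2" "\<And>b k. k \<in> A - {j} \<Longrightarrow> TW k (b # j) = TW k j / 2"
proof -
  have anti: "\<not> j \<preceq> k" "\<not> k \<preceq> j" if "k \<in> A - {j}" for k
    using A j that by (auto simp: coarse_graining_def antichain_def)
  have notin: "b # j \<notin> A" for b
  proof
    assume "b # j \<in> A"
    then have "\<not> j \<preceq> (b # j)" using anti[of "b # j"] by simp
    then show False by (metis ancestor_iff append_Cons append_Nil)
  qed
  show n: "False # j \<notin> A" "True # j \<notin> A" by (rule notin)+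
  show W1: "TW (b # j) k = TW j k / 2" and W2: "TW k (b # j) = TW k j / 2" if "k \<in> A - {j}" for b k
    using tree_weight_child[OF anti(1)[OF that] j(2)] by simp_all
  have const: "h constant_on blk N j" using A j by (auto simp: coarse_graining_def compatible_def)
  have a'c: "a' (b # j) = (1/2) *\<^sub>R a j" for b by (cases b) (auto simp: a'_def)
  show pc: "pinned N h a' (b # j) = (1/2) *\<^sub>R pinned N h a j" for b
    by (simp add: a'c block_pinning_child[OF j(2) const] scaleR_add_right)
  have a'R: "a' k = a k" if "k \<in> A - {j}" for k using that n by (auto simp: a'_def)
  then show pR: "pinned N h a' k = pinned N h a k" if "k \<in> A - {j}" for k using that by simp
  have cases: "(\<exists>b. k = b # j) \<or> k \<in> A - {j}" if "k \<in> A'" for k using that by (auto simp: A'_def)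
  \<comment> \<open>Relates a vertex of the refined antichain to the one it comes from;
    \<open>j\<close> has both its children as lifts.\<close>
  define lift where "lift u k \<longleftrightarrow> u \<in> A' \<and> (u = k \<and> k \<noteq> j \<or> (\<exists>b. u = b # j) \<and> k = j)" for u k
  have mem: "b # j \<in> A'" for b by (cases b) (auto simp: A'_def)
  have memR: "k \<in> A'" if "k \<in> A - {j}" for k using that by (auto simp: A'_def)
  have Wpos: "0 < TW (b # j) k \<longleftrightarrow> 0 < TW j k" "0 < TW k (b # j) \<longleftrightarrow> 0 < TW k j" if "k \<in> A - {j}" for b k
    using W1[OF that, of b] W2[OF that, of b] by linarith+
  have up: "(u, v) \<in> weight_edges A' TW"
    if "(k, k') \<in> weight_edges A TW" "k \<noteq> k'" "lift u k" "lift v k'" for k k' u v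
    using that by (cases "k = j"; cases "k' = j") (auto simp: weight_edges_def lift_def Wpos)
  have path: "\<exists>v\<in>A'. (u, v) \<in> (weight_edges A' TW)\<^sup>* \<and> pinned N h a' v \<in> H32_plus G"
    if k: "(k, k0) \<in> (weight_edges A TW)\<^sup>*" "k0 \<in> A" "pinned N h a k0 \<in> H32_plus G" and u: "lift u k" for k k0 u
    using k(1) u
  proof (induction arbitrary: u rule: converse_rtrancl_induct)
    case base
    have "pinned N h a' u \<in> H32_plus G"
    proof (cases "k0 = j")
      case True
      then obtain b where "u = b # j" using base by (auto simp: lift_def)
      then show ?thesis unfolding pc[of b, folded \<open>u = b # j\<close>] using k(3) True by (intro H32_plus_scaleR) auto
    next
      case False
      then show ?thesis using pR[of k0] k(2,3) base by (simp add: lift_def)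
    qed
    then show ?case using base by (auto simp: lift_def)
  next
    case (step k k')
    show ?case
    \<comment> \<open>A loop at \<open>j\<close> need not lift to an edge between prescribed lifts,
      and the path can do without it.\<close>
    proof (cases "k = k'")
      case True
      then show ?thesis using step by simp
    next
      case False
      have "k' \<in> A" using step(1) by (auto simp: weight_edges_def)
      \<comment> \<open>When the path passes through \<open>j\<close>, either child may serve, since
        both see the same outside neighbours.\<close>
      then have v: "lift (if k' = j then False # j else k') k'"
        using mem memR by (auto simp: lift_def)
      show ?thesis
        using step.IH[OF v] up[OF step(1) False step.prems v] by (meson converse_rtrancl_into_rtrancl)
    qed
  qed
  show "coarse_graining N w h G A' a'"
    unfolding coarse_graining_def
  proof (intro conjI ballI)
    have notprec: "\<not> u \<preceq> v" if "u \<in> A'" "v \<in> A'" "u \<noteq> v" for u v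
    proof
      assume uv: "u \<preceq> v"
      from cases[OF that(1)] cases[OF that(2)] show False
      proof (elim disjE exE)
        fix b b' assume "u = b # j" "v = b' # j"
        then have "(b # j) \<preceq> j" using child_descendant[of u b' j] uv that(3) by auto
        then show False by (auto simp: ancestor_iff)
      next
        fix b assume "u = b # j" "v \<in> A - {j}"
        then show False using uv anti(1) ancestor_of_child by blast
      next
        fix b assume "u \<in> A - {j}" "v = b # j"
        then show False using uv anti(2) child_descendant notin by blast
      next
        assume "u \<in> A - {j}" "v \<in> A - {j}"
        then show False using A that(3) uv by (auto simp: coarse_graining_def antichain_def)
      qed
    qed
    have "A' \<subseteq> tree N"
      using A j by (auto simp: A'_def coarse_graining_def antichain_def tree_def leaves_def)
    then show "antichain N A'" using notprec by (auto simp: antichain_def)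
  next
    fix i assume i: "i \<in> leaves N"
    then obtain k where k: "k \<in> A" "k \<preceq> i" using A by (auto simp: coarse_graining_def)
    show "\<exists>k\<in>A'. k \<preceq> i"
    proof (cases "k = j")
      case True
      then show ?thesis using ancestor_child[of j i] k(2) i j(2) mem by (auto simp: leaves_def)
    next
      case False
      then show ?thesis using k memR by blast
    qed
  next
    have sub: "blk N (b # j) \<subseteq> blk N j" for b
      by (auto simp: blk_def dest: ancestor_of_child)
    have "h constant_on blk N k" if "k \<in> A'" for k
      using cases[OF that] constant_on_subset[OF const sub] A by (auto simp: coarse_graining_def compatible_def)
    then show "compatible N h A'" by (simp add: compatible_def)
  next
    fix k assume "k \<in> A'"
    then consider b where "k = b # j" | "k \<in> A - {j}" using cases by blast
    then have "a' k \<in> H32 G \<and> pinned N h a' k \<in> H32_plus0 G"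
    proof cases
      case (1 b)
      have "a j \<in> H32 G" "pinned N h a j \<in> H32_plus0 G" using A j by (auto simp: coarse_graining_def)
      then have "a' (b # j) \<in> H32 G" "pinned N h a' (b # j) \<in> H32_plus0 G"
        unfolding pc unfolding a'c by (simp_all add: H32_scaleR H32_plus0_scaleR del: scaleR_add_right)
      then show ?thesis unfolding 1 by blast
    next
      case 2
      then show ?thesis using A a'R[OF 2] by (simp add: coarse_graining_def)
    qed
    then show "a' k \<in> H32 G" "pinned N h a' k \<in> H32_plus0 G" by auto
  next
    fix u assume u: "u \<in> A'"
    then obtain k where k: "k \<in> A" "lift u k" using cases[OF u] j(1) by (auto simp: lift_def)
    then obtain k0 where "k0 \<in> A" "(k, k0) \<in> (weight_edges A TW)\<^sup>*" "pinned N h a k0 \<in> H32_plus G"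
      using A by (auto simp: coarse_graining_def)
    then show "\<exists>k\<in>A'. (u, k) \<in> (weight_edges A' TW)\<^sup>* \<and> pinned N h a' k \<in> H32_plus G"
      using path k(2) by blast
  qed
qed

lemma coarse_graining_merge:
  assumes A: "coarse_graining N w h G A a" and j: "j \<in> A" "length j < N"
  defines "A' \<equiv> insert (False # j) (insert (True # j) (A - {j}))"
  defines "a' \<equiv> a(False # j := (1/2) *\<^sub>R a j, True # j := (1/2) *\<^sub>R a j)"
  shows "sint A' (\<lambda>p. gr (evexp (texp A' TW TH (pinned N h a') p))) = sint A (\<lambda>p. gr (evexp (texp A TW TH (pinned N h a) p)))"
proof -
  let ?R = "A - {j}"
  note split = coarse_graining_split[OF A j, folded A'_def a'_def]
  have ins: "insert j ?R = A" using j(1) by auto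
  have bH: "pinned N h a k \<in> H32 G" if "k \<in> A" for k
    using A that by (auto simp: coarse_graining_def H32_plus0_iff)
  have const: "h constant_on blk N j" using A j by (auto simp: coarse_graining_def compatible_def)
  have fin: "finite ?R" using spin_system.fin(1)[OF coarse_graining_spin_system[OF A]] by simp
  have "sint (insert (False # j) (insert (True # j) ?R)) (\<lambda>p. gr (evexp (texp (insert (False # j) (insert (True # j) ?R)) TW TH (pinned N h a') p))) =
    sint (insert j ?R) (\<lambda>p. gr (evexp (texp (insert j ?R) TW TH (pinned N h a) p)))"
  proof (rule merge_vertices[OF fin _ _ _ _ finite_G G_vgens])
    show "sintegrable (insert (False # j) (insert (True # j) ?R)) (\<lambda>p. gr (evexp (texp (insert (False # j) (insert (True # j) ?R)) TW TH (pinned N h a') p)))"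
      using coarse_graining_sintegrable[OF split(1)] by (simp add: A'_def)
    show "sintegrable (insert j ?R) (\<lambda>p. gr (evexp (texp (insert j ?R) TW TH (pinned N h a) p)))"
      unfolding ins by (rule coarse_graining_sintegrable[OF A])
    show "field j ?R TW (pinned N h a) x \<in> H32_plus (G \<union> vgens ?R)" for x
      by (rule coarse_graining_field[OF A j(1)])
    show "TH (False # j) = TH j / 2" "TH (True # j) = TH j / 2"
      by (rule block_pinning_child[OF j(2) const])+
    show "pinned N h a k \<in> H32 G" if "k \<in> ?R" for k using that bH by blast
    show "pinned N h a j \<in> H32 G" by (rule bH[OF j(1)])
    show "pinned N h a' k = pinned N h a k" if "k \<in> ?R" for k by (rule split(5)[OF that])
    show "pinned N h a' (False # j) = (1/2) *\<^sub>R pinned N h a j" "pinned N h a' (True # j) = (1/2) *\<^sub>R pinned N h a j"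
      by (rule split(4))+
    show "TW (False # j) k + TW k (False # j) = (TW j k + TW k j) / 2" "TW (True # j) k + TW k (True # j) = (TW j k + TW k j) / 2"
      if "k \<in> ?R" for k
      using split(6,7)[OF that] by simp_all
  qed (use split(2,3) tree_weight_nonneg in auto)
  then show ?thesis by (simp only: ins A'_def)
qed

text \<open>Each split halves the source. By \<open>block_spin_child\<close> the block-spin source
  term is then literally unchanged, so both antichains have the same left-hand side, while the
  right-hand sides agree by \<open>coarse_graining_merge\<close>.\<close>

theorem block_spin_expectation:
  assumes "coarse_graining N w h G A a"
  shows "has_expectation (leaves N) TW h (\<lambda>v. gext exp (\<Sum>j\<in>A. sinner (a j) (block_spin N v j))) \<and>
    expectation (leaves N) TW h (\<lambda>v. gext exp (\<Sum>j\<in>A. sinner (a j) (block_spin N v j))) =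
    expectation A TW TH (\<lambda>v. gext exp (\<Sum>j\<in>A. sinner (a j) (v j)))"
  using assms
\<comment> \<open>Base three makes the measure drop: a split replaces \<open>3 ^ Suc l\<close> by
  \<open>2 * 3 ^ l\<close>. With base two the sum would stay the same.\<close>
proof (induction "\<Sum>j\<in>A. (3::nat) ^ level N j" arbitrary: A a rule: less_induct)
  case less
  note A = less.prems
  have fin: "finite A" using spin_system.fin(1)[OF coarse_graining_spin_system[OF A]] .
  have aH: "a i \<in> H32 G" if "i \<in> A" for i using A that by (simp add: coarse_graining_def)
  have len: "length j \<le> N" if "j \<in> A" for j
    using A that by (auto simp: coarse_graining_def antichain_def tree_def leaves_def)
  show ?case
  proof (cases "\<exists>j\<in>A. length j < N")
    case False
    then have sub: "length j = N" if "j \<in> A" for j using len[OF that] that by force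
    have "A = leaves N"
    proof
      show "A \<subseteq> leaves N" using sub by (auto simp: leaves_def)
      show "leaves N \<subseteq> A"
      proof
        fix i assume i: "i \<in> leaves N"
        then obtain k where "k \<in> A" "k \<preceq> i" using A by (auto simp: coarse_graining_def)
        moreover from this(2) obtain zs where "i = zs @ k" unfolding ancestor_iff by blast
        ultimately show "i \<in> A" using sub[of k] i by (simp add: leaves_def)
      qed
    qed
    have "block_spin N v j = v j" "TH j = h j" if "j \<in> A" for v j
      using sub[OF that] by (simp_all add: block_spin_def block_pinning_def blk_leaf level_def)
    then show ?thesis
      using coarse_graining_sintegrable[OF A] expectation_cong[of "leaves N" TH h] model_expectation[where W = TW and h = TH, OF fin finite_G aH]
      by (simp add: \<open>A = leaves N\<close> cong: sum.cong)
  next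
    case True
    then obtain j where j: "j \<in> A" "length j < N" by blast
    define A' where "A' = insert (False # j) (insert (True # j) (A - {j}))"
    define a' where "a' = a(False # j := (1/2) *\<^sub>R a j, True # j := (1/2) *\<^sub>R a j)"
    note split = coarse_graining_split[OF A j, folded A'_def a'_def]
    have fin': "finite A'" using fin by (simp add: A'_def)
    have a'H: "a' i \<in> H32 G" if "i \<in> A'" for i using split(1) that by (simp add: coarse_graining_def)
    have lev: "level N j = Suc (level N (b # j))" for b using j(2) by (simp add: level_def)
    have sum': "sum f A' = f (False # j) + (f (True # j) + sum f (A - {j}))" for f :: "word \<Rightarrow> 'z::comm_monoid_add"
      using split(2,3) fin unfolding A'_def by simp
    have sum: "sum f A = f j + sum f (A - {j})" for f :: "word \<Rightarrow> 'z::comm_monoid_add"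
      using fin j(1) by (rule sum.remove)
    have "(\<Sum>j\<in>A'. (3::nat) ^ level N j) < (\<Sum>j\<in>A. 3 ^ level N j)"
      unfolding sum' sum using lev[of False] lev[of True] by simp
    note IH = less.hyps[OF this split(1)]
    have "(\<Sum>j\<in>A'. sinner (a' j) (block_spin N v j)) = (\<Sum>j\<in>A. sinner (a j) (block_spin N v j))" for v
    proof -
      have "(\<Sum>k\<in>A - {j}. sinner (a' k) (block_spin N v k)) = (\<Sum>k\<in>A - {j}. sinner (a k) (block_spin N v k))"
        using split(2,3) by (intro sum.cong) (auto simp: a'_def)
      moreover have "a' (False # j) = (1/2) *\<^sub>R a j" "a' (True # j) = (1/2) *\<^sub>R a j" by (simp_all add: a'_def)
      ultimately show ?thesis
        unfolding sum' sum block_spin_child[OF j(2), of v] by (simp add: sinner_linear scaleR_add_right)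
    qed
    moreover have "expectation A' TW TH (\<lambda>v. gext exp (\<Sum>j\<in>A'. sinner (a' j) (v j))) = expectation A TW TH (\<lambda>v. gext exp (\<Sum>j\<in>A. sinner (a j) (v j)))"
      using model_expectation(2)[where W = TW and h = TH, OF fin finite_G aH] model_expectation(2)[where W = TW and h = TH, OF fin' finite_G a'H]
        coarse_graining_merge[OF A j, folded A'_def a'_def] by (simp only:)
    ultimately show ?thesis using IH by simp
  qed
qed

end

theorem theorem2p2:
  fixes N P :: nat and w :: "nat \<Rightarrow> real" and h :: "word \<Rightarrow> real"
    and A :: "word set" and a :: "word \<Rightarrow> word gen svec"
  defines "W \<equiv> tree_weight N w"
    and "H \<equiv> block_pinning N h"
    and "params \<equiv> Param ` {..<P}"
  assumes w_nonneg: "\<And>k. w k \<ge> 0"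
    and h_nonneg: "\<And>i. i \<in> leaves N \<Longrightarrow> h i \<ge> 0"
    and h_pos: "\<And>C. C \<in> graph_components (leaves N) W \<Longrightarrow> \<exists>j\<in>C. h j > 0"
    and A_max: "maximal_antichain N A"
    and A_comp: "compatible N h A"
    and a_H32: "\<And>j. j \<in> A \<Longrightarrow> a j \<in> H32 params"
    and a_cone: "\<And>j. j \<in> A \<Longrightarrow> H j *\<^sub>R sorigin + a j \<in> H32_plus0 params"
    and a_open: "\<And>C. C \<in> graph_components A W \<Longrightarrow>
                   \<exists>j\<in>C. H j *\<^sub>R sorigin + a j \<in> H32_plus params"
  shows "has_expectation (leaves N) W h (\<lambda>v. gext exp (\<Sum>j\<in>A. sinner (a j) (block_spin N v j)))
       \<and> has_expectation A W H (\<lambda>v. gext exp (\<Sum>j\<in>A. sinner (a j) (v j)))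
       \<and> expectation (leaves N) W h (\<lambda>v. gext exp (\<Sum>j\<in>A. sinner (a j) (block_spin N v j)))
         = expectation A W H (\<lambda>v. gext exp (\<Sum>j\<in>A. sinner (a j) (v j)))"
proof -
  have params: "finite params" "params \<inter> vgens UNIV = {}"
    by (auto simp: params_def vgens_def)
  have "\<exists>k\<in>A. (j, k) \<in> (weight_edges A W)\<^sup>* \<and> H k *\<^sub>R sorigin + a k \<in> H32_plus params" if j: "j \<in> A" for j
  proof -
    \<comment> \<open>The equivalence class of \<open>j\<close> is its component; the vertex with
      open field found there is reached from \<open>j\<close> by a path.\<close>
    let ?r = "{(i, j) \<in> A \<times> A. (i, j) \<in> {(u, v). {u, v} \<in> graph_edges A W}\<^sup>*}"
    have "?r `` {j} \<in> graph_components A W"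
      unfolding graph_components_def using j by (rule quotientI)
    then obtain k where k: "k \<in> ?r `` {j}" "H k *\<^sub>R sorigin + a k \<in> H32_plus params"
      using a_open by blast
    have "{(u, v). {u, v} \<in> graph_edges A W} \<subseteq> weight_edges A W"
      by (auto simp: graph_edges_def weight_edges_def doubleton_eq_iff)
    then have "{(u, v). {u, v} \<in> graph_edges A W}\<^sup>* \<subseteq> (weight_edges A W)\<^sup>*" by (rule rtrancl_mono)
    with k show ?thesis by blast
  qed
  then have A: "coarse_graining N w h params A a"
    using A_max A_comp a_H32 a_cone maximal_antichain_covers[OF A_max]
    unfolding coarse_graining_def W_def H_def by (auto simp: maximal_antichain_def)
  have "finite A" using spin_system.fin(1)[OF coarse_graining_spin_system[OF w_nonneg params A]] .
  from model_expectation(1)[where W = W and h = H, OF this params(1) a_H32]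
  have "has_expectation A W H (\<lambda>v. gext exp (\<Sum>j\<in>A. sinner (a j) (v j)))"
    using coarse_graining_sintegrable[OF w_nonneg params A] by (simp add: W_def H_def)
  with block_spin_expectation[OF w_nonneg params A] show ?thesis
    by (simp add: W_def H_def)
qed

end
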